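(* Let $M$ be a complete Riemannian manifold with non-compact boundary $\partial M$, with a fixed isometry between a neighborhood of $\partial M$ and $Z_r=[0,r)\times\partial M$, and let $E\to M$ be a Dirac bundle. For every strongly Callias-type operator $\mathcal{D}=D+i\Phi$ on $E$ which is product on $Z_r$ there exists an almost compact essential support of $\mathcal{D}$.
   Context: $TM$ and $T^*M$ are identified by the metric. A Dirac bundle over $M$ is a Hermitian vector bundle $E$ with a Clifford multiplication $c:T^*M\to\operatorname{End}(E)$, $c(\xi)^2=-|\xi|^2$, $c(\xi)^*=-c(\xi)$, and a Hermitian connection $\nabla^E$ with $\nabla^E(c(\xi)u)=c(\nabla^{LC}\xi)u+c(\xi)\nabla^Eu$. Its Dirac operator is $D=\sum_j c(e_j)\nabla^E_{e_j}$ ($e_j$ a local orthonormal frame). A strongly Callias-type operator is $\mathcal{D}=D+i\Phi$, where $\Phi\in\operatorname{End}(E)$ is a self-adjoint bundle map such that (i) $[D,\Phi]$ is a bundle map; (ii) for every $R>0$ there is a compact $K_R\subset M$ with $\Phi^2(x)-|[D,\Phi](x)|\ge R$ for all $x\in M\setminus K_R$ ($|\cdot|$ the operator norm on $E_x$). Such a $K_R$ is called an $R$-essential support; a compact set is an essential support of $\mathcal{D}$ if it is an $R$-essential support for some $R>0$. $\mathcal{D}$ is product on $Z_r$ if the Dirac bundle structure ($E$, its metric, $c$, $\nabla^E$) is product on $Z_r$ and $\Phi|_{Z_r}$ does not depend on the coordinate $t\in[0,r)$. An almost compact essential support of $\mathcal{D}$ is a smooth submanifold $M_1\subset M$ (of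 full dimension) with smooth boundary, which contains $\partial M$ and such that (i) $M_1$ contains an essential support of $\mathcal{D}$; (ii) there exist a compact set $K\subset M$ and $\varepsilon\in(0,r)$ such that $M_1\setminus K=(\partial M\setminus K)\times[0,\varepsilon]\subset Z_r$. *)

theory Defs
  imports "HOL-Analysis.Analysis"
begin

section \<open>Smooth maps between subsets of Euclidean spaces\<close>

text \<open>Partial derivatives of order at most \<open>k\<close> exist and are continuous on the open set \<open>U\<close>.\<close>

primrec Ck_on :: "nat \<Rightarrow> 'a::euclidean_space set \<Rightarrow> ('a \<Rightarrow> 'b::real_normed_vector) \<Rightarrow> bool" where
  "Ck_on 0 U f \<longleftrightarrow> continuous_on U f"
| "Ck_on (Suc k) U f \<longleftrightarrow>
     (\<forall>x\<in>U. f differentiable (at x)) \<and> (\<forall>v. Ck_on k U (\<lambda>x. frechet_derivative f (at x) v))"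

text \<open>Smoothness on an arbitrary subset means local extendability to smooth maps on open sets.\<close>

definition smooth_on :: "'a::euclidean_space set \<Rightarrow> ('a \<Rightarrow> 'b::real_normed_vector) \<Rightarrow> bool" where
  "smooth_on S f \<longleftrightarrow>
     (\<forall>x\<in>S. \<exists>U F. open U \<and> x \<in> U \<and> (\<forall>k. Ck_on k U F) \<and> (\<forall>y\<in>S \<inter> U. f y = F y))"


section \<open>Smooth manifolds with boundary\<close>

text \<open>Charts take values in the closed half-space \<open>0 \<le> x \<bullet> bdir\<close> of \<open>'v\<close>, where \<open>bdir\<close> is
  an arbitrary but fixed basis vector; \<open>DIM('v)\<close> is the dimension of the manifold. The underlying
  set of the manifold is the type \<open>'m\<close>; its topology is the one of \<open>'m\<close>.\<close>

definition bdir :: "'v::euclidean_space" where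
  "bdir = (SOME b. b \<in> Basis)"

definition half_space :: "'v::euclidean_space set" where
  "half_space = {x. 0 \<le> x \<bullet> bdir}"

definition tang :: "'v::euclidean_space \<Rightarrow> 'v" where
  "tang v = v - (v \<bullet> bdir) *\<^sub>R bdir"

type_synonym ('m, 'v) chart = "'m set \<times> ('m \<Rightarrow> 'v)"

definition cinv :: "('m, 'v) chart \<Rightarrow> 'v \<Rightarrow> 'm" where
  "cinv \<kappa> = inv_into (fst \<kappa>) (snd \<kappa>)"

definition is_chart :: "('m::topological_space, 'v::euclidean_space) chart \<Rightarrow> bool" where
  "is_chart \<kappa> \<longleftrightarrow>
     open (fst \<kappa>) \<and>
     openin (top_of_set half_space) (snd \<kappa> ` fst \<kappa>) \<and>
     homeomorphism (fst \<kappa>) (snd \<kappa> ` fst \<kappa>) (snd \<kappa>) (cinv \<kappa>)"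

definition compatible :: "('m, 'v::euclidean_space) chart \<Rightarrow> ('m, 'v) chart \<Rightarrow> bool" where
  "compatible \<kappa> \<kappa>' \<longleftrightarrow>
     smooth_on (snd \<kappa> ` (fst \<kappa> \<inter> fst \<kappa>')) (snd \<kappa>' \<circ> cinv \<kappa>) \<and>
     smooth_on (snd \<kappa>' ` (fst \<kappa> \<inter> fst \<kappa>')) (snd \<kappa> \<circ> cinv \<kappa>')"

text \<open>The field \<open>rmetric M x\<close> is the Riemannian metric on the tangent space at \<open>x\<close>, see below.\<close>

record ('m, 'v) riem =
  atlas :: "('m, 'v) chart set"
  rmetric :: "'m \<Rightarrow> 'v \<Rightarrow> 'v \<Rightarrow> real"

definition smooth_manifold ::
  "('m::{t2_space,second_countable_topology}, 'v::euclidean_space) riem \<Rightarrow> bool" where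
  "smooth_manifold M \<longleftrightarrow>
     (\<forall>\<kappa>\<in>atlas M. is_chart \<kappa>) \<and>
     (\<Union>\<kappa>\<in>atlas M. fst \<kappa>) = UNIV \<and>
     (\<forall>\<kappa>\<in>atlas M. \<forall>\<kappa>'\<in>atlas M. compatible \<kappa> \<kappa>')"

definition bdry :: "('m, 'v::euclidean_space) riem \<Rightarrow> 'm set" where
  "bdry M = {x. \<exists>\<kappa>\<in>atlas M. x \<in> fst \<kappa> \<and> snd \<kappa> x \<bullet> bdir = 0}"

definition smooth_from ::
  "('m, 'v::euclidean_space) riem \<Rightarrow> 'm set \<Rightarrow> ('m \<Rightarrow> 'b::real_normed_vector) \<Rightarrow> bool" where
  "smooth_from M S f \<longleftrightarrow>
     (\<forall>\<kappa>\<in>atlas M. smooth_on (snd \<kappa> ` (S \<inter> fst \<kappa>)) (f \<circ> cinv \<kappa>))"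

definition smooth_into ::
  "('m::topological_space, 'v::euclidean_space) riem \<Rightarrow> 'a::euclidean_space set \<Rightarrow> ('a \<Rightarrow> 'm) \<Rightarrow> bool" where
  "smooth_into M S f \<longleftrightarrow>
     continuous_on S f \<and> (\<forall>\<kappa>\<in>atlas M. smooth_on (S \<inter> f -` fst \<kappa>) (snd \<kappa> \<circ> f))"

text \<open>Full-dimensional smooth submanifold with smooth boundary, closed as a subset: locally \<open>S\<close> is
  diffeomorphic, in the smooth structure of the ambient manifold, to an open subset of the
  half-space. (The chart \<open>\<psi>\<close> of \<open>S\<close> need not be a restriction of a chart of \<open>M\<close>: near a boundary
  point of \<open>S\<close> interior to \<open>M\<close> it is not.)\<close>

definition full_submanifold :: "('m::topological_space, 'v::euclidean_space) riem \<Rightarrow> 'm set \<Rightarrow> bool" where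
  "full_submanifold M S \<longleftrightarrow>
     closed S \<and>
     (\<forall>p\<in>S. \<exists>V (\<psi> :: 'm \<Rightarrow> 'v). open V \<and> p \<in> V \<and>
        openin (top_of_set half_space) (\<psi> ` (S \<inter> V)) \<and>
        homeomorphism (S \<inter> V) (\<psi> ` (S \<inter> V)) \<psi> (inv_into (S \<inter> V) \<psi>) \<and>
        smooth_from M (S \<inter> V) \<psi> \<and>
        smooth_into M (\<psi> ` (S \<inter> V)) (inv_into (S \<inter> V) \<psi>))"


section \<open>Tangent vectors\<close>

text \<open>For every point \<open>x\<close> a chart \<open>chart_at M x\<close> is singled out, and the tangent space at \<open>x\<close> is
  identified with \<open>'v\<close> by the differential of this chart. No continuity in \<open>x\<close> is implied, so the
  smooth structure of the tangent bundle is only visible through \<open>tderiv\<close>.\<close>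

definition chart_at :: "('m, 'v) riem \<Rightarrow> 'm \<Rightarrow> ('m, 'v) chart" where
  "chart_at M x = (SOME \<kappa>. \<kappa> \<in> atlas M \<and> x \<in> fst \<kappa>)"

text \<open>\<open>tderiv M x v f\<close> is the derivative of \<open>f\<close> at \<open>x\<close> in the direction of the tangent vector \<open>v\<close>.
  In particular \<open>tderiv M x v (snd \<kappa>)\<close> are the coordinates of \<open>v\<close> in the chart \<open>\<kappa>\<close>. Derivatives
  within the half-space are one-sided at boundary points and unique.\<close>

definition tderiv ::
  "('m, 'v::euclidean_space) riem \<Rightarrow> 'm \<Rightarrow> 'v \<Rightarrow> ('m \<Rightarrow> 'b::real_normed_vector) \<Rightarrow> 'b" where
  "tderiv M x v f =
     frechet_derivative (f \<circ> cinv (chart_at M x)) (at (snd (chart_at M x) x) within half_space) v"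

text \<open>The tangent vector at \<open>x\<close> whose coordinates in the chart \<open>\<kappa>\<close> are \<open>v\<close>.\<close>

definition tvec ::
  "('m, 'v::euclidean_space) riem \<Rightarrow> ('m, 'v) chart \<Rightarrow> 'm \<Rightarrow> 'v \<Rightarrow> 'v" where
  "tvec M \<kappa> x v =
     frechet_derivative (snd (chart_at M x) \<circ> cinv \<kappa>) (at (snd \<kappa> x) within half_space) v"

definition smooth_vfield ::
  "('m, 'v::euclidean_space) riem \<Rightarrow> 'm set \<Rightarrow> ('m \<Rightarrow> 'v) \<Rightarrow> bool" where
  "smooth_vfield M U X \<longleftrightarrow>
     (\<forall>\<kappa>\<in>atlas M. smooth_from M (U \<inter> fst \<kappa>) (\<lambda>x. tderiv M x (X x) (snd \<kappa>)))"


section \<open>Riemannian manifolds\<close>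

definition riemannian_manifold ::
  "('m::{t2_space,second_countable_topology}, 'v::euclidean_space) riem \<Rightarrow> bool" where
  "riemannian_manifold M \<longleftrightarrow>
     smooth_manifold M \<and>
     (\<forall>x. bilinear (rmetric M x)) \<and>
     (\<forall>x v w. rmetric M x v w = rmetric M x w v) \<and>
     (\<forall>x v. v \<noteq> 0 \<longrightarrow> rmetric M x v v > 0) \<and>
     (\<forall>U X Y. open U \<and> smooth_vfield M U X \<and> smooth_vfield M U Y \<longrightarrow>
        smooth_from M U (\<lambda>x. rmetric M x (X x) (Y x)))"

definition piecewise_smooth_curve ::
  "('m::topological_space, 'v::euclidean_space) riem \<Rightarrow> (real \<Rightarrow> 'm) \<Rightarrow> bool" where
  "piecewise_smooth_curve M \<gamma> \<longleftrightarrow>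
     continuous_on {0..1} \<gamma> \<and>
     (\<exists>F. finite F \<and>
        (\<forall>a b. 0 \<le> a \<and> a < b \<and> b \<le> 1 \<and> {a<..<b} \<inter> F = {} \<longrightarrow> smooth_into M {a..b} \<gamma>))"

definition velocity :: "('m, 'v::euclidean_space) riem \<Rightarrow> (real \<Rightarrow> 'm) \<Rightarrow> real \<Rightarrow> 'v" where
  "velocity M \<gamma> t = vector_derivative (snd (chart_at M (\<gamma> t)) \<circ> \<gamma>) (at t within {0..1})"

definition curve_length :: "('m, 'v::euclidean_space) riem \<Rightarrow> (real \<Rightarrow> 'm) \<Rightarrow> real" where
  "curve_length M \<gamma> =
     integral {0..1} (\<lambda>t. sqrt (rmetric M (\<gamma> t) (velocity M \<gamma> t) (velocity M \<gamma> t)))"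

text \<open>The distance is \<open>\<infinity>\<close> between different components.\<close>

definition rdist ::
  "('m::topological_space, 'v::euclidean_space) riem \<Rightarrow> 'm \<Rightarrow> 'm \<Rightarrow> ereal" where
  "rdist M x y =
     (INF \<gamma>\<in>{\<gamma>. piecewise_smooth_curve M \<gamma> \<and> \<gamma> 0 = x \<and> \<gamma> 1 = y}. ereal (curve_length M \<gamma>))"

definition complete_manifold ::
  "('m::topological_space, 'v::euclidean_space) riem \<Rightarrow> bool" where
  "complete_manifold M \<longleftrightarrow>
     (\<forall>X :: nat \<Rightarrow> 'm.
        (\<forall>\<epsilon>>0. \<exists>N. \<forall>m\<ge>N. \<forall>n\<ge>N. rdist M (X m) (X n) < ereal \<epsilon>) \<longrightarrow>
        (\<exists>l. (\<lambda>n. rdist M (X n) l) \<longlonglongrightarrow> 0))"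

text \<open>The covariant derivative \<open>lc x v Y\<close> of the vector field \<open>Y\<close> in the direction \<open>v\<close> at \<open>x\<close>.
  The last condition is vanishing torsion, tested on functions.\<close>

definition levi_civita ::
  "('m::topological_space, 'v::euclidean_space) riem \<Rightarrow> ('m \<Rightarrow> 'v \<Rightarrow> ('m \<Rightarrow> 'v) \<Rightarrow> 'v) \<Rightarrow> bool" where
  "levi_civita M lc \<longleftrightarrow>
     (\<forall>U X Y Z (f :: 'm \<Rightarrow> real). open U \<and> smooth_vfield M U X \<and> smooth_vfield M U Y \<and>
        smooth_vfield M U Z \<and> smooth_from M U f \<longrightarrow>
        smooth_vfield M U (\<lambda>x. lc x (X x) Y) \<and>
        (\<forall>x\<in>U. \<forall>v.
           linear (\<lambda>v. lc x v Y) \<and>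
           lc x v (\<lambda>y. Y y + Z y) = lc x v Y + lc x v Z \<and>
           lc x v (\<lambda>y. f y *\<^sub>R Y y) = tderiv M x v f *\<^sub>R Y x + f x *\<^sub>R lc x v Y \<and>
           tderiv M x v (\<lambda>y. rmetric M y (Y y) (Z y)) =
             rmetric M x (lc x v Y) (Z x) + rmetric M x (Y x) (lc x v Z) \<and>
           tderiv M x (lc x (X x) Y - lc x (Y x) X) f =
             tderiv M x (X x) (\<lambda>y. tderiv M y (Y y) f)
             - tderiv M x (Y x) (\<lambda>y. tderiv M y (X y) f)))"


section \<open>Dirac bundles\<close>

text \<open>The fibres \<open>fib E x\<close> are finite-dimensional subspaces of a complex vector space \<open>'e\<close> with scalar
  multiplication \<open>scl E\<close>. The space \<open>'e\<close> carries no topology and only serves to host the fibres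
  (every family of vector spaces embeds into its direct sum); different fibres are unrelated.
  The smooth structure is given by local frames \<open>(V, k, s)\<close>: the sections \<open>s 0, \<dots>, s (k - 1)\<close> form
  a basis of each fibre over the open set \<open>V\<close>. Fields \<open>herm\<close>, \<open>cliff\<close>, \<open>conn\<close> are the Hermitian metric
  (linear in the first argument), Clifford multiplication by tangent vectors (identified with
  covectors), and the covariant derivative \<open>conn E x v u\<close> of the section \<open>u\<close> in direction \<open>v\<close> at \<open>x\<close>.\<close>

record ('m, 'v, 'e) dbundle =
  scl :: "complex \<Rightarrow> 'e \<Rightarrow> 'e"
  fib :: "'m \<Rightarrow> 'e set"
  frames :: "('m set \<times> nat \<times> (nat \<Rightarrow> 'm \<Rightarrow> 'e)) set"
  herm :: "'m \<Rightarrow> 'e \<Rightarrow> 'e \<Rightarrow> complex"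
  cliff :: "'m \<Rightarrow> 'v \<Rightarrow> 'e \<Rightarrow> 'e"
  conn :: "'m \<Rightarrow> 'v \<Rightarrow> ('m \<Rightarrow> 'e) \<Rightarrow> 'e"

definition smooth_section ::
  "('m, 'v::euclidean_space) riem \<Rightarrow> ('m, 'v, 'e::ab_group_add) dbundle \<Rightarrow> 'm set \<Rightarrow> ('m \<Rightarrow> 'e) \<Rightarrow> bool" where
  "smooth_section M E U u \<longleftrightarrow>
     (\<forall>x\<in>U. u x \<in> fib E x) \<and>
     (\<forall>(V, k, s)\<in>frames E. \<exists>a :: nat \<Rightarrow> 'm \<Rightarrow> complex.
        (\<forall>i<k. smooth_from M (U \<inter> V) (a i)) \<and>
        (\<forall>x\<in>U \<inter> V. u x = (\<Sum>i<k. scl E (a i x) (s i x))))"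

definition vector_bundle ::
  "('m::topological_space, 'v::euclidean_space) riem \<Rightarrow> ('m, 'v, 'e::ab_group_add) dbundle \<Rightarrow> bool" where
  "vector_bundle M E \<longleftrightarrow>
     vector_space (scl E) \<and>
     (\<forall>x. module.subspace (scl E) (fib E x)) \<and>
     (\<forall>(V, k, s)\<in>frames E.
        open V \<and>
        (\<forall>x\<in>V. inj_on (\<lambda>i. s i x) {..<k} \<and>
           \<not> module.dependent (scl E) ((\<lambda>i. s i x) ` {..<k}) \<and>
           module.span (scl E) ((\<lambda>i. s i x) ` {..<k}) = fib E x) \<and>
        (\<forall>i<k. smooth_section M E V (s i))) \<and>
     (\<Union>(V, k, s)\<in>frames E. V) = UNIV"

definition fib_linear :: "('m, 'v, 'e::ab_group_add) dbundle \<Rightarrow> 'e set \<Rightarrow> 'e set \<Rightarrow> ('e \<Rightarrow> 'e) \<Rightarrow> bool" where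
  "fib_linear E F F' T \<longleftrightarrow>
     T ` F \<subseteq> F' \<and>
     (\<forall>e\<in>F. \<forall>e'\<in>F. T (e + e') = T e + T e') \<and>
     (\<forall>e\<in>F. \<forall>a. T (scl E a e) = scl E a (T e))"

definition bundle_map ::
  "('m::topological_space, 'v::euclidean_space) riem \<Rightarrow> ('m, 'v, 'e::ab_group_add) dbundle \<Rightarrow>
   ('m \<Rightarrow> 'e \<Rightarrow> 'e) \<Rightarrow> bool" where
  "bundle_map M E A \<longleftrightarrow>
     (\<forall>x. fib_linear E (fib E x) (fib E x) (A x)) \<and>
     (\<forall>U u. open U \<and> smooth_section M E U u \<longrightarrow> smooth_section M E U (\<lambda>x. A x (u x)))"

definition hermitian_metric ::
  "('m::topological_space, 'v::euclidean_space) riem \<Rightarrow> ('m, 'v, 'e::ab_group_add) dbundle \<Rightarrow> bool" where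
  "hermitian_metric M E \<longleftrightarrow>
     (\<forall>x. \<forall>u\<in>fib E x. \<forall>v\<in>fib E x. \<forall>w\<in>fib E x. \<forall>a.
        herm E x (u + v) w = herm E x u w + herm E x v w \<and>
        herm E x (scl E a u) w = a * herm E x u w \<and>
        herm E x w u = cnj (herm E x u w) \<and>
        (u \<noteq> 0 \<longrightarrow> Re (herm E x u u) > 0)) \<and>
     (\<forall>U u w. open U \<and> smooth_section M E U u \<and> smooth_section M E U w \<longrightarrow>
        smooth_from M U (\<lambda>x. herm E x (u x) (w x)))"

definition clifford_mult ::
  "('m::topological_space, 'v::euclidean_space) riem \<Rightarrow> ('m, 'v, 'e::ab_group_add) dbundle \<Rightarrow> bool" where
  "clifford_mult M E \<longleftrightarrow>
     (\<forall>x v. fib_linear E (fib E x) (fib E x) (cliff E x v)) \<and>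
     (\<forall>x. \<forall>e\<in>fib E x. \<forall>v w a b.
        cliff E x (a *\<^sub>R v + b *\<^sub>R w) e =
          scl E (of_real a) (cliff E x v e) + scl E (of_real b) (cliff E x w e)) \<and>
     (\<forall>x. \<forall>e\<in>fib E x. \<forall>v. cliff E x v (cliff E x v e) = scl E (- of_real (rmetric M x v v)) e) \<and>
     (\<forall>x. \<forall>e\<in>fib E x. \<forall>e'\<in>fib E x. \<forall>v.
        herm E x (cliff E x v e) e' = - herm E x e (cliff E x v e')) \<and>
     (\<forall>U X u. open U \<and> smooth_vfield M U X \<and> smooth_section M E U u \<longrightarrow>
        smooth_section M E U (\<lambda>x. cliff E x (X x) (u x)))"

definition hermitian_connection ::
  "('m::topological_space, 'v::euclidean_space) riem \<Rightarrow> ('m, 'v, 'e::ab_group_add) dbundle \<Rightarrow> bool" where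
  "hermitian_connection M E \<longleftrightarrow>
     (\<forall>U X u w (f :: 'm \<Rightarrow> complex). open U \<and> smooth_vfield M U X \<and> smooth_section M E U u \<and>
        smooth_section M E U w \<and> smooth_from M U f \<longrightarrow>
        smooth_section M E U (\<lambda>x. conn E x (X x) u) \<and>
        (\<forall>x\<in>U. \<forall>v v' a b.
           conn E x v u \<in> fib E x \<and>
           conn E x (a *\<^sub>R v + b *\<^sub>R v') u =
             scl E (of_real a) (conn E x v u) + scl E (of_real b) (conn E x v' u) \<and>
           conn E x v (\<lambda>y. u y + w y) = conn E x v u + conn E x v w \<and>
           conn E x v (\<lambda>y. scl E (f y) (u y)) =
             scl E (tderiv M x v f) (u x) + scl E (f x) (conn E x v u) \<and>
           tderiv M x v (\<lambda>y. herm E y (u y) (w y)) =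
             herm E x (conn E x v u) (w x) + herm E x (u x) (conn E x v w)))"

definition dirac_bundle ::
  "('m::topological_space, 'v::euclidean_space) riem \<Rightarrow> ('m, 'v, 'e::ab_group_add) dbundle \<Rightarrow> bool" where
  "dirac_bundle M E \<longleftrightarrow>
     vector_bundle M E \<and> hermitian_metric M E \<and> clifford_mult M E \<and> hermitian_connection M E \<and>
     (\<exists>lc. levi_civita M lc \<and>
        (\<forall>U Y u. open U \<and> smooth_vfield M U Y \<and> smooth_section M E U u \<longrightarrow>
           (\<forall>x\<in>U. \<forall>v. conn E x v (\<lambda>y. cliff E y (Y y) (u y)) =
              cliff E x (lc x v Y) (u x) + cliff E x (Y x) (conn E x v u))))"


section \<open>Strongly Callias-type operators\<close>

definition orthonormal_basis ::
  "('m, 'v::euclidean_space) riem \<Rightarrow> 'm \<Rightarrow> 'v set \<Rightarrow> bool" where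
  "orthonormal_basis M x B \<longleftrightarrow>
     finite B \<and> card B = DIM('v) \<and>
     (\<forall>a\<in>B. \<forall>b\<in>B. rmetric M x a b = (if a = b then 1 else 0))"

text \<open>The value at \<open>x\<close> depends on a local orthonormal frame only through its value at \<open>x\<close>, and does
  not depend on the choice of the orthonormal basis.\<close>

definition dirac_op ::
  "('m, 'v::euclidean_space) riem \<Rightarrow> ('m, 'v, 'e::ab_group_add) dbundle \<Rightarrow> ('m \<Rightarrow> 'e) \<Rightarrow> 'm \<Rightarrow> 'e" where
  "dirac_op M E u x =
     (\<Sum>b\<in>(SOME B. orthonormal_basis M x B). cliff E x b (conn E x b u))"

definition fnorm :: "('m, 'v, 'e) dbundle \<Rightarrow> 'm \<Rightarrow> 'e \<Rightarrow> real" where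
  "fnorm E x e = sqrt (Re (herm E x e e))"

definition opnorm :: "('m, 'v, 'e) dbundle \<Rightarrow> 'm \<Rightarrow> ('e \<Rightarrow> 'e) \<Rightarrow> real" where
  "opnorm E x T = Sup {fnorm E x (T e) | e. e \<in> fib E x \<and> fnorm E x e \<le> 1}"

text \<open>\<open>[D, \<Phi>]\<close> is the bundle map \<open>A\<close>. On the fibres \<open>A\<close> is uniquely determined.\<close>

definition commutator_is ::
  "('m::topological_space, 'v::euclidean_space) riem \<Rightarrow> ('m, 'v, 'e::ab_group_add) dbundle \<Rightarrow>
   ('m \<Rightarrow> 'e \<Rightarrow> 'e) \<Rightarrow> ('m \<Rightarrow> 'e \<Rightarrow> 'e) \<Rightarrow> bool" where
  "commutator_is M E \<Phi> A \<longleftrightarrow>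
     bundle_map M E A \<and>
     (\<forall>U u. open U \<and> smooth_section M E U u \<longrightarrow>
        (\<forall>x\<in>U. dirac_op M E (\<lambda>y. \<Phi> y (u y)) x - \<Phi> x (dirac_op M E u x) = A x (u x)))"

text \<open>The operator \<open>D + i\<Phi>\<close> is represented by \<open>E\<close> and \<open>\<Phi>\<close>. The inequality
  \<open>\<Phi>\<^sup>2(x) - |[D, \<Phi>](x)| \<ge> R\<close> is an inequality between self-adjoint operators on the fibre.\<close>

definition R_essential_support ::
  "('m::topological_space, 'v::euclidean_space) riem \<Rightarrow> ('m, 'v, 'e::ab_group_add) dbundle \<Rightarrow>
   ('m \<Rightarrow> 'e \<Rightarrow> 'e) \<Rightarrow> real \<Rightarrow> 'm set \<Rightarrow> bool" where
  "R_essential_support M E \<Phi> R K \<longleftrightarrow>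
     compact K \<and>
     (\<exists>A. commutator_is M E \<Phi> A \<and>
        (\<forall>x\<in>- K. \<forall>e\<in>fib E x.
           Re (herm E x (\<Phi> x (\<Phi> x e)) e) - opnorm E x (A x) * (fnorm E x e)\<^sup>2 \<ge> R * (fnorm E x e)\<^sup>2))"

definition essential_support ::
  "('m::topological_space, 'v::euclidean_space) riem \<Rightarrow> ('m, 'v, 'e::ab_group_add) dbundle \<Rightarrow>
   ('m \<Rightarrow> 'e \<Rightarrow> 'e) \<Rightarrow> 'm set \<Rightarrow> bool" where
  "essential_support M E \<Phi> K \<longleftrightarrow> (\<exists>R>0. R_essential_support M E \<Phi> R K)"

definition strongly_callias ::
  "('m::topological_space, 'v::euclidean_space) riem \<Rightarrow> ('m, 'v, 'e::ab_group_add) dbundle \<Rightarrow>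
   ('m \<Rightarrow> 'e \<Rightarrow> 'e) \<Rightarrow> bool" where
  "strongly_callias M E \<Phi> \<longleftrightarrow>
     bundle_map M E \<Phi> \<and>
     (\<forall>x. \<forall>e\<in>fib E x. \<forall>e'\<in>fib E x. herm E x (\<Phi> x e) e' = herm E x e (\<Phi> x e')) \<and>
     (\<exists>A. commutator_is M E \<Phi> A) \<and>
     (\<forall>R>0. \<exists>K. R_essential_support M E \<Phi> R K)"


section \<open>Product structures near the boundary\<close>

text \<open>The collar is a map \<open>\<iota>\<close> with \<open>\<iota> t y\<close> the point of \<open>M\<close> corresponding to \<open>(t, y)\<close> in
  \<open>Z\<^sub>r = [0,r) \<times> \<partial>M\<close>. The smooth structure of \<open>Z\<^sub>r\<close> is given by the charts
  \<open>(t, y) \<mapsto> snd \<kappa> y + t *\<^sub>R bdir\<close>; the \<open>collar_chart\<close> is such a chart transported to \<open>M\<close>.\<close>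

definition collar_coords ::
  "('m, 'v::euclidean_space) riem \<Rightarrow> real \<Rightarrow> (real \<Rightarrow> 'm \<Rightarrow> 'm) \<Rightarrow> 'm \<Rightarrow> real \<times> 'm" where
  "collar_coords M r \<iota> = inv_into ({0..<r} \<times> bdry M) (\<lambda>(t, y). \<iota> t y)"

definition collar_over ::
  "('m, 'v::euclidean_space) riem \<Rightarrow> real \<Rightarrow> (real \<Rightarrow> 'm \<Rightarrow> 'm) \<Rightarrow> 'm set \<Rightarrow> 'm set" where
  "collar_over M r \<iota> U = (\<lambda>(t, y). \<iota> t y) ` ({0..<r} \<times> (U \<inter> bdry M))"

definition collar_chart ::
  "('m, 'v::euclidean_space) riem \<Rightarrow> real \<Rightarrow> (real \<Rightarrow> 'm \<Rightarrow> 'm) \<Rightarrow> ('m, 'v) chart \<Rightarrow> ('m, 'v) chart" where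
  "collar_chart M r \<iota> \<kappa> =
     (collar_over M r \<iota> (fst \<kappa>),
      \<lambda>p. let (t, y) = collar_coords M r \<iota> p in snd \<kappa> y + t *\<^sub>R bdir)"

text \<open>\<open>\<iota>\<close> is an isometry from \<open>Z\<^sub>r\<close>, with the metric \<open>dt\<^sup>2 + g\<close> for \<open>g\<close> the metric induced on the
  boundary, onto an open neighbourhood of \<open>\<partial>M\<close>.\<close>

definition isometric_collar ::
  "('m::topological_space, 'v::euclidean_space) riem \<Rightarrow> real \<Rightarrow> (real \<Rightarrow> 'm \<Rightarrow> 'm) \<Rightarrow> bool" where
  "isometric_collar M r \<iota> \<longleftrightarrow>
     0 < r \<and>
     inj_on (\<lambda>(t, y). \<iota> t y) ({0..<r} \<times> bdry M) \<and>
     (\<forall>y\<in>bdry M. \<iota> 0 y = y) \<and>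
     (\<forall>\<kappa>\<in>atlas M.
        is_chart (collar_chart M r \<iota> \<kappa>) \<and>
        (\<forall>\<kappa>'\<in>atlas M. compatible (collar_chart M r \<iota> \<kappa>) \<kappa>') \<and>
        (\<forall>y\<in>bdry M \<inter> fst \<kappa>. \<forall>t\<in>{0..<r}. \<forall>v w.
           rmetric M (\<iota> t y)
             (tvec M (collar_chart M r \<iota> \<kappa>) (\<iota> t y) v) (tvec M (collar_chart M r \<iota> \<kappa>) (\<iota> t y) w) =
           (v \<bullet> bdir) * (w \<bullet> bdir) + rmetric M y (tvec M \<kappa> y (tang v)) (tvec M \<kappa> y (tang w))))"

text \<open>A product structure on \<open>E\<close> over \<open>Z\<^sub>r\<close> is an isomorphism \<open>\<theta> t y\<close> from the fibre at \<open>(0, y)\<close> to the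
  fibre at \<open>(t, y)\<close>, identifying \<open>E\<close> with the pull-back of its restriction to \<open>\<partial>M\<close>.
  \<open>const_ext\<close> is the \<open>t\<close>-independent extension of the restriction of a section to \<open>\<partial>M\<close>.\<close>

definition const_ext ::
  "('m, 'v::euclidean_space) riem \<Rightarrow> real \<Rightarrow> (real \<Rightarrow> 'm \<Rightarrow> 'm) \<Rightarrow>
   (real \<Rightarrow> 'm \<Rightarrow> 'e \<Rightarrow> 'e) \<Rightarrow> ('m \<Rightarrow> 'e) \<Rightarrow> 'm \<Rightarrow> 'e" where
  "const_ext M r \<iota> \<theta> u p = (let (t, y) = collar_coords M r \<iota> p in \<theta> t y (u y))"

definition product_identification ::
  "('m::topological_space, 'v::euclidean_space) riem \<Rightarrow> ('m, 'v, 'e::ab_group_add) dbundle \<Rightarrow>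
   real \<Rightarrow> (real \<Rightarrow> 'm \<Rightarrow> 'm) \<Rightarrow> (real \<Rightarrow> 'm \<Rightarrow> 'e \<Rightarrow> 'e) \<Rightarrow> bool" where
  "product_identification M E r \<iota> \<theta> \<longleftrightarrow>
     (\<forall>y\<in>bdry M. \<forall>t\<in>{0..<r}.
        fib_linear E (fib E y) (fib E (\<iota> t y)) (\<theta> t y) \<and>
        bij_betw (\<theta> t y) (fib E y) (fib E (\<iota> t y))) \<and>
     (\<forall>y\<in>bdry M. \<forall>e\<in>fib E y. \<theta> 0 y e = e) \<and>
     (\<forall>U u. open U \<and> smooth_section M E U u \<longrightarrow>
        smooth_section M E (collar_over M r \<iota> U) (const_ext M r \<iota> \<theta> u))"

text \<open>In the last condition the right hand side is the pull-back of the connection which \<open>conn E\<close>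
  induces on the restriction of \<open>E\<close> to \<open>\<partial>M\<close>; in particular \<open>t\<close>-independent sections are parallel in
  the direction of \<open>\<partial>/\<partial>t\<close>, for which \<open>v = bdir\<close> and \<open>tang v = 0\<close>.\<close>

definition dirac_bundle_product ::
  "('m::topological_space, 'v::euclidean_space) riem \<Rightarrow> ('m, 'v, 'e::ab_group_add) dbundle \<Rightarrow>
   real \<Rightarrow> (real \<Rightarrow> 'm \<Rightarrow> 'm) \<Rightarrow> (real \<Rightarrow> 'm \<Rightarrow> 'e \<Rightarrow> 'e) \<Rightarrow> bool" where
  "dirac_bundle_product M E r \<iota> \<theta> \<longleftrightarrow>
     product_identification M E r \<iota> \<theta> \<and>
     (\<forall>y\<in>bdry M. \<forall>t\<in>{0..<r}. \<forall>e\<in>fib E y. \<forall>e'\<in>fib E y.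
        herm E (\<iota> t y) (\<theta> t y e) (\<theta> t y e') = herm E y e e') \<and>
     (\<forall>\<kappa>\<in>atlas M. \<forall>y\<in>bdry M \<inter> fst \<kappa>. \<forall>t\<in>{0..<r}. \<forall>v.
        (\<forall>e\<in>fib E y.
           cliff E (\<iota> t y) (tvec M (collar_chart M r \<iota> \<kappa>) (\<iota> t y) v) (\<theta> t y e) =
           \<theta> t y (cliff E y (tvec M (collar_chart M r \<iota> \<kappa>) y v) e)) \<and>
        (\<forall>U u. open U \<and> y \<in> U \<and> smooth_section M E U u \<longrightarrow>
           conn E (\<iota> t y) (tvec M (collar_chart M r \<iota> \<kappa>) (\<iota> t y) v) (const_ext M r \<iota> \<theta> u) =
           \<theta> t y (conn E y (tvec M \<kappa> y (tang v)) u)))"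

definition callias_product ::
  "('m::topological_space, 'v::euclidean_space) riem \<Rightarrow> ('m, 'v, 'e::ab_group_add) dbundle \<Rightarrow>
   ('m \<Rightarrow> 'e \<Rightarrow> 'e) \<Rightarrow> real \<Rightarrow> (real \<Rightarrow> 'm \<Rightarrow> 'm) \<Rightarrow> bool" where
  "callias_product M E \<Phi> r \<iota> \<longleftrightarrow>
     (\<exists>\<theta>. dirac_bundle_product M E r \<iota> \<theta> \<and>
        (\<forall>y\<in>bdry M. \<forall>t\<in>{0..<r}. \<forall>e\<in>fib E y. \<Phi> (\<iota> t y) (\<theta> t y e) = \<theta> t y (\<Phi> y e)))"


section \<open>Almost compact essential supports\<close>

definition almost_compact_essential_support ::
  "('m::topological_space, 'v::euclidean_space) riem \<Rightarrow> ('m, 'v, 'e::ab_group_add) dbundle \<Rightarrow>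
   ('m \<Rightarrow> 'e \<Rightarrow> 'e) \<Rightarrow> real \<Rightarrow> (real \<Rightarrow> 'm \<Rightarrow> 'm) \<Rightarrow> 'm set \<Rightarrow> bool" where
  "almost_compact_essential_support M E \<Phi> r \<iota> M\<^sub>1 \<longleftrightarrow>
     full_submanifold M M\<^sub>1 \<and>
     bdry M \<subseteq> M\<^sub>1 \<and>
     (\<exists>K\<subseteq>M\<^sub>1. essential_support M E \<Phi> K) \<and>
     (\<exists>K \<epsilon>. compact K \<and> 0 < \<epsilon> \<and> \<epsilon> < r \<and>
        M\<^sub>1 - K = (\<lambda>(t, y). \<iota> t y) ` ({0..\<epsilon>} \<times> (bdry M - K)))"

end

theory Submission
  imports Defs
begin

text \<open>Completeness of \<open>M\<close> makes \<open>\<iota> ([0, a] \<times> \<partial>M)\<close> closed for \<open>a < r\<close>: a short path leaving the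
  collar through its open end would project to a curve of finite length in \<open>\<partial>M\<close>, whose end point
  exists by completeness. Hence the collar coordinate, cut off above \<open>r / 2\<close>, extends to a smooth
  function \<open>\<tau>\<close> on \<open>M\<close>. Subtracting from \<open>\<tau> - r / 4\<close> a large compactly supported smooth function makes
  it negative on a given compact set, and a small perturbation, supported in finitely many coordinate
  balls, makes \<open>0\<close> a regular value. The sublevel set \<open>\<le> 0\<close> then contains \<open>\<partial>M\<close> and the compact set, has
  a smooth boundary, and coincides with \<open>\<iota> ([0, r / 4] \<times> \<partial>M)\<close> outside a compact set. Any
  essential support serves as the given compact set.\<close>

section \<open>Calculus of smooth maps\<close>

text \<open>The union of a compact set with a piece of the collar need not have a smooth boundary,
  which is why the domain is a sublevel set. Regularity has to be repaired only where the compactly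
  supported correction acts: elsewhere the function is \<open>t - r / 4\<close> near its zeros, with
  derivative 1 along the collar. The zeros avoid the boundary of \<open>M\<close>, so every
  perturbation lives in an interior chart. The product condition removes the same compact
  \<open>K\<close> from the domain and from the boundary. Hence \<open>K\<close> has to contain,
  with each of its points in the lower collar, the whole collar fibre through that point.
  Completeness is a statement about Cauchy sequences for \<open>rdist\<close>, whereas gluing the
  cut-off collar coordinate to a constant needs a closed set in the topology of \<open>M\<close>.
  The link is a lower bound for the length of curves that leave a coordinate ball. Tangent vectors
  are coordinates in an arbitrarily selected chart at each point. Every computation is therefore
  moved to a suitable chart first, often a collar chart, where the selected chart cancels by the
  chain rule.\<close>

lemma Ck_on_cong:
  assumes "open U" "\<And>x. x \<in> U \<Longrightarrow> f x = g x" "Ck_on k U f"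
  shows "Ck_on k U g"
  using assms(2,3)
proof (induction k arbitrary: f g)
  case 0
  then show ?case by (simp cong: continuous_on_cong_simp)
next
  case (Suc k)
  have d: "(g has_derivative frechet_derivative f (at x)) (at x)" if "x \<in> U" for x
    using has_derivative_transform_within_open[OF _ \<open>open U\<close> that Suc.prems(1)] Suc.prems(2) that
    by (auto simp: frechet_derivative_works)
  have e: "frechet_derivative f (at x) = frechet_derivative g (at x)" if "x \<in> U" for x
    using frechet_derivative_at[OF d[OF that]] .
  have "Ck_on k U (\<lambda>x. frechet_derivative g (at x) v)" for v
    by (rule Suc.IH[of "\<lambda>x. frechet_derivative f (at x) v"]) (use e Suc.prems(2) in auto)
  then show ?case using d by (auto simp: differentiable_def)
qed

text \<open>Uniqueness of the derivative lets it be supplied as an explicit formula, so that the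
  inductions below never unfold \<open>frechet_derivative\<close>.\<close>

lemma Ck_on_SucI:
  assumes "open U" "\<And>x. x \<in> U \<Longrightarrow> (f has_derivative f' x) (at x)" "\<And>v. Ck_on k U (\<lambda>x. f' x v)"
  shows "Ck_on (Suc k) U f"
proof -
  have e: "f' x = frechet_derivative f (at x)" if "x \<in> U" for x
    using frechet_derivative_at[OF assms(2)[OF that]] .
  have "Ck_on k U (\<lambda>x. frechet_derivative f (at x) v)" for v
    by (rule Ck_on_cong[OF assms(1) _ assms(3)[of v]]) (simp add: e)
  then show ?thesis using assms(2) by (auto simp: differentiable_def)
qed

lemma Ck_on_SucD:
  assumes "Ck_on (Suc k) U f"
  shows "\<And>x. x \<in> U \<Longrightarrow> (f has_derivative frechet_derivative f (at x)) (at x)"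
    "\<And>v. Ck_on k U (\<lambda>x. frechet_derivative f (at x) v)"
  using assms by (auto simp: frechet_derivative_works)

lemma Ck_on_subset: "Ck_on k U f \<Longrightarrow> V \<subseteq> U \<Longrightarrow> Ck_on k V f"
  by (induction k arbitrary: f) (auto intro: continuous_on_subset)

lemma Ck_on_lower: "Ck_on (Suc k) U f \<Longrightarrow> Ck_on k U f"
proof (induction k arbitrary: f)
  case 0
  then show ?case
    by (auto intro!: continuous_at_imp_continuous_on differentiable_imp_continuous_within)
qed auto

lemma Ck_on_continuous: "Ck_on k U f \<Longrightarrow> continuous_on U f"
proof (induction k)
  case (Suc k)
  then show ?case using Ck_on_lower by blast
qed auto

lemma Ck_on_local:
  assumes "\<And>x. x \<in> U \<Longrightarrow> \<exists>V. open V \<and> x \<in> V \<and> Ck_on k V f"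
  shows "Ck_on k U f"
  using assms
proof (induction k arbitrary: f)
  case 0
  have "continuous (at x) f" if "x \<in> U" for x
    using 0[OF that] by (auto simp: continuous_on_eq_continuous_at)
  then show ?case by (auto intro: continuous_at_imp_continuous_on)
next
  case (Suc k)
  have "Ck_on k U (\<lambda>x. frechet_derivative f (at x) v)" for v
    by (rule Suc.IH) (use Suc.prems in \<open>auto dest!: meta_spec\<close>)
  moreover have "f differentiable (at x)" if "x \<in> U" for x
    using Suc.prems[OF that] by auto
  ultimately show ?case by auto
qed

lemma Ck_on_const: "open U \<Longrightarrow> Ck_on k U (\<lambda>x. c)"
proof (induction k arbitrary: c)
  case (Suc k)
  show ?case
    by (rule Ck_on_SucI[OF Suc.prems, of _ "\<lambda>x v. 0"]) (use Suc in auto)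
qed auto

lemma Ck_on_bounded_linear:
  assumes "bounded_linear L" "open U" "Ck_on k U f"
  shows "Ck_on k U (\<lambda>x. L (f x))"
  using assms(3)
proof (induction k arbitrary: f)
  case 0
  then show ?case using bounded_linear.continuous_on[OF assms(1)] by auto
next
  case (Suc k)
  note d = Ck_on_SucD[OF Suc.prems]
  show ?case
    by (rule Ck_on_SucI[OF assms(2) bounded_linear.has_derivative[OF assms(1) d(1)] Suc.IH[OF d(2)]])
qed

lemma Ck_on_id: "open U \<Longrightarrow> Ck_on k U (\<lambda>x. x)"
proof (cases k)
  case (Suc n)
  assume "open U"
  then show ?thesis unfolding Suc
    by (intro Ck_on_SucI[of U _ "\<lambda>x v. v"] Ck_on_const) auto
qed auto

lemma Ck_on_linear: "bounded_linear L \<Longrightarrow> open U \<Longrightarrow> Ck_on k U L"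
  using Ck_on_bounded_linear[OF _ _ Ck_on_id] .

lemma Ck_on_add: "open U \<Longrightarrow> Ck_on k U f \<Longrightarrow> Ck_on k U g \<Longrightarrow> Ck_on k U (\<lambda>x. f x + g x)"
proof (induction k arbitrary: f g)
  case 0
  then show ?case by (auto intro: continuous_on_add)
next
  case (Suc k)
  note d = Ck_on_SucD[OF Suc.prems(2)] and e = Ck_on_SucD[OF Suc.prems(3)]
  show ?case
    by (rule Ck_on_SucI[OF Suc.prems(1) has_derivative_add[OF d(1) e(1)] Suc.IH[OF Suc.prems(1) d(2) e(2)]])
qed

lemma Ck_on_sum: "open U \<Longrightarrow> (\<And>i. i \<in> I \<Longrightarrow> Ck_on k U (f i)) \<Longrightarrow> Ck_on k U (\<lambda>x. \<Sum>i\<in>I. f i x)"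
  by (induction I rule: infinite_finite_induct) (auto intro: Ck_on_const Ck_on_add)

lemma Ck_on_bilinear:
  assumes B: "bounded_bilinear B" and U: "open U"
  shows "Ck_on k U f \<Longrightarrow> Ck_on k U g \<Longrightarrow> Ck_on k U (\<lambda>x. B (f x) (g x))"
proof (induction k arbitrary: f g)
  case 0
  then show ?case using bounded_bilinear.continuous_on[OF B] by auto
next
  case (Suc k)
  note d = Ck_on_SucD[OF Suc.prems(1)] and e = Ck_on_SucD[OF Suc.prems(2)]
  show ?case
    by (rule Ck_on_SucI[OF U bounded_bilinear.FDERIV[OF B d(1) e(1)]])
      (auto intro!: Ck_on_add[OF U] Suc.IH d e Ck_on_lower[OF Suc.prems(1)] Ck_on_lower[OF Suc.prems(2)])
qed

lemmas Ck_on_mult = Ck_on_bilinear[OF bounded_bilinear_mult]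
lemmas Ck_on_scaleR = Ck_on_bilinear[OF bounded_bilinear_scaleR]
lemmas Ck_on_inner = Ck_on_bilinear[OF bounded_bilinear_inner]

lemma Ck_on_compose:
  fixes f :: "'a::euclidean_space \<Rightarrow> 'b::euclidean_space" and g :: "'b \<Rightarrow> 'c::real_normed_vector"
  assumes U: "open U" and V: "open V" and fV: "f ` U \<subseteq> V"
  shows "Ck_on k U f \<Longrightarrow> Ck_on k V g \<Longrightarrow> Ck_on k U (\<lambda>x. g (f x))"
proof (induction k arbitrary: g)
  case 0
  then show ?case using fV by (auto intro: continuous_on_compose2)
next
  case (Suc k)
  note d = Ck_on_SucD[OF Suc.prems(1)] and e = Ck_on_SucD[OF Suc.prems(2)]
  let ?f' = "\<lambda>x. frechet_derivative f (at x)" and ?g' = "\<lambda>y. frechet_derivative g (at y)"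
  have der: "((\<lambda>x. g (f x)) has_derivative (\<lambda>v. ?g' (f x) (?f' x v))) (at x)" if "x \<in> U" for x
    using diff_chain_at[OF d(1)[OF that] e(1)] that fV by (auto simp: o_def)
  have lin: "linear (?g' (f x))" if "x \<in> U" for x
    using e(1)[of "f x"] that fV by (auto intro: has_derivative_linear)
  have "Ck_on k U (\<lambda>x. ?g' (f x) (?f' x v))" for v
  proof (rule Ck_on_cong[OF U])
    \<comment> \<open>The direction \<open>?f' x v\<close> varies with \<open>x\<close>, while
      \<open>Ck_on\<close> controls derivatives of \<open>g\<close> in fixed directions only.
      Expanding in the basis separates coefficient and direction.\<close>
    show "Ck_on k U (\<lambda>x. \<Sum>b\<in>Basis. (?f' x v \<bullet> b) *\<^sub>R ?g' (f x) b)"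
      by (intro Ck_on_sum Ck_on_scaleR U Suc.IH Ck_on_lower[OF Suc.prems(1)] e(2)
          Ck_on_bounded_linear[OF bounded_linear_inner_left] d(2))
    show "(\<Sum>b\<in>Basis. (?f' x v \<bullet> b) *\<^sub>R ?g' (f x) b) = ?g' (f x) (?f' x v)" if "x \<in> U" for x
    proof -
      have "?g' (f x) (\<Sum>b\<in>Basis. (?f' x v \<bullet> b) *\<^sub>R b) = (\<Sum>b\<in>Basis. (?f' x v \<bullet> b) *\<^sub>R ?g' (f x) b)"
        by (simp add: linear_sum[OF lin[OF that]] linear_scale[OF lin[OF that]])
      then show ?thesis by (simp add: euclidean_representation)
    qed
  qed
  then show ?case by (intro Ck_on_SucI[OF U der])
qed

lemma Ck_on_inverse:
  fixes f :: "'a::euclidean_space \<Rightarrow> real"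
  assumes U: "open U" and nz: "\<And>x. x \<in> U \<Longrightarrow> f x \<noteq> 0"
  shows "Ck_on k U f \<Longrightarrow> Ck_on k U (\<lambda>x. inverse (f x))"
proof (induction k)
  case 0
  then show ?case using nz by (auto intro: continuous_on_inverse)
next
  case (Suc k)
  note d = Ck_on_SucD[OF Suc.prems(1)]
  have "Ck_on k U (\<lambda>x. inverse (f x))" using Suc Ck_on_lower by blast
  then have "Ck_on k U (\<lambda>x. - (inverse (f x) * frechet_derivative f (at x) v * inverse (f x)))" for v
    by (intro Ck_on_bounded_linear[OF bounded_linear_minus[OF bounded_linear_ident]] Ck_on_mult U d(2))
  then show ?case
    by (intro Ck_on_SucI[OF U Deriv.has_derivative_inverse[OF nz d(1)]])
qed

text \<open>For local inverses, whose derivative is an explicit expression in \<open>g\<close>; this avoids the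
  smoothness of matrix inversion.\<close>

lemma Ck_on_bootstrap:
  fixes g :: "'a::euclidean_space \<Rightarrow> 'b::real_normed_vector"
  assumes V: "open V" and der: "\<And>y. y \<in> V \<Longrightarrow> (g has_derivative g' y) (at y)"
    and step: "\<And>k v. Ck_on k V g \<Longrightarrow> Ck_on k V (\<lambda>y. g' y v)"
  shows "Ck_on k V g"
proof (induction k)
  case 0
  then show ?case using der
    by (auto intro!: continuous_at_imp_continuous_on has_derivative_continuous)
next
  case (Suc k)
  then show ?case by (intro Ck_on_SucI[OF V der step])
qed

section \<open>Smoothness on arbitrary subsets through local extensions\<close>

definition smooth_extension ::
  "'a::euclidean_space set \<Rightarrow> ('a \<Rightarrow> 'b::real_normed_vector) \<Rightarrow> 'a \<Rightarrow> 'a set \<Rightarrow> ('a \<Rightarrow> 'b) \<Rightarrow> bool" where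
  "smooth_extension S f x U F \<longleftrightarrow>
     open U \<and> x \<in> U \<and> (\<forall>k. Ck_on k U F) \<and> (\<forall>y\<in>S \<inter> U. f y = F y)"

lemma smooth_extensionD:
  assumes "smooth_extension S f x U F"
  shows "open U" "x \<in> U" "\<And>k. Ck_on k U F" "\<And>y. y \<in> S \<Longrightarrow> y \<in> U \<Longrightarrow> f y = F y"
  using assms by (auto simp: smooth_extension_def)

lemma smooth_on_iff_extension: "smooth_on S f \<longleftrightarrow> (\<forall>x\<in>S. \<exists>U F. smooth_extension S f x U F)"
  unfolding smooth_on_def smooth_extension_def ..

lemma smooth_on_extension:
  assumes "smooth_on S f" "x \<in> S"
  obtains U F where "smooth_extension S f x U F"
  using assms unfolding smooth_on_iff_extension by blast

lemma smooth_onI: "(\<And>x. x \<in> S \<Longrightarrow> \<exists>U F. smooth_extension S f x U F) \<Longrightarrow> smooth_on S f"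
  unfolding smooth_on_iff_extension by (rule ballI)

lemma smooth_on_witness:
  assumes "open U" "x \<in> U" "\<And>k. Ck_on k U F" "\<And>y. y \<in> S \<Longrightarrow> y \<in> U \<Longrightarrow> f y = F y"
  shows "\<exists>U F. smooth_extension S f x U F"
  unfolding smooth_extension_def
  using assms(1,2,4) by (intro exI[of _ U] exI[of _ F] conjI allI assms(3)) auto

lemma smooth_onI_open: "open U \<Longrightarrow> (\<And>k. Ck_on k U f) \<Longrightarrow> smooth_on U f"
  by (rule smooth_onI, rule smooth_on_witness) auto

lemma smooth_on_subset:
  assumes "smooth_on S f" "T \<subseteq> S"
  shows "smooth_on T f"
proof (rule smooth_onI)
  fix x assume "x \<in> T"
  then have x: "x \<in> S" using assms by auto
  obtain U F where UF0: "smooth_extension S f x U F"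
    by (rule smooth_on_extension[OF assms(1) x])
  note UF = smooth_extensionD[OF UF0]
  show "\<exists>U F. smooth_extension T f x U F"
    by (rule smooth_on_witness[OF UF(1-3)]) (use UF(4) assms(2) in auto)
qed

lemma smooth_on_cong:
  assumes "smooth_on S f" "\<And>x. x \<in> S \<Longrightarrow> f x = g x"
  shows "smooth_on S g"
proof (rule smooth_onI)
  fix x assume x: "x \<in> S"
  obtain U F where UF0: "smooth_extension S f x U F"
    by (rule smooth_on_extension[OF assms(1) x])
  note UF = smooth_extensionD[OF UF0]
  show "\<exists>U F. smooth_extension S g x U F"
    by (rule smooth_on_witness[OF UF(1-3)]) (use UF(4) assms(2) in auto)
qed

lemma smooth_on_local:
  assumes "\<And>x. x \<in> S \<Longrightarrow> \<exists>W. open W \<and> x \<in> W \<and> smooth_on (S \<inter> W) f"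
  shows "smooth_on S f"
proof (rule smooth_onI)
  fix x assume x: "x \<in> S"
  then obtain W where W: "open W" "x \<in> W" "smooth_on (S \<inter> W) f" using assms by blast
  have x2: "x \<in> S \<inter> W" using x W by simp
  obtain U F where UF0: "smooth_extension (S \<inter> W) f x U F"
    by (rule smooth_on_extension[OF W(3) x2])
  note UF = smooth_extensionD[OF UF0]
  have "Ck_on k (U \<inter> W) F" for k using Ck_on_subset[OF UF(3)] by blast
  then show "\<exists>U F. smooth_extension S f x U F"
    by (rule smooth_on_witness[rotated 2]) (use UF W in auto)
qed

lemma smooth_on_Ck:
  assumes "open S" "smooth_on S f"
  shows "Ck_on k S f"
proof (rule Ck_on_local)
  fix x assume x: "x \<in> S"
  obtain U F where UF0: "smooth_extension S f x U F"
    by (rule smooth_on_extension[OF assms(2) x])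
  note UF = smooth_extensionD[OF UF0]
  have "Ck_on k (S \<inter> U) f"
    using UF assms(1) by (intro Ck_on_cong[OF _ _ Ck_on_subset[OF UF(3)], of "S \<inter> U" f]) auto
  then show "\<exists>V. open V \<and> x \<in> V \<and> Ck_on k V f"
    using UF assms(1) x by (intro exI[of _ "S \<inter> U"]) auto
qed

lemma smooth_on_continuous:
  assumes "smooth_on S f"
  shows "continuous_on S f"
  unfolding continuous_on_eq_continuous_within
proof (rule ballI)
  fix x assume x: "x \<in> S"
  obtain U F where UF0: "smooth_extension S f x U F"
    by (rule smooth_on_extension[OF assms x])
  note UF = smooth_extensionD[OF UF0]
  have "isCont F x"
    using UF(1,2) Ck_on_continuous[OF UF(3)] by (auto simp: continuous_on_eq_continuous_at)
  then have "continuous (at x within S) F" by (rule continuous_at_imp_continuous_at_within)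
  moreover have "\<forall>\<^sub>F y in at x within S. F y = f y"
    using UF(1,2,4) by (auto simp: eventually_at_topological)
  ultimately show "continuous (at x within S) f"
    using UF(2,4) x by (simp add: continuous_within) (metis Lim_transform_eventually)
qed

lemma smooth_on_compose:
  fixes f :: "'a::euclidean_space \<Rightarrow> 'b::euclidean_space" and g :: "'b \<Rightarrow> 'c::real_normed_vector"
  assumes f: "smooth_on S f" and g: "smooth_on T g" and fT: "f ` S \<subseteq> T"
  shows "smooth_on S (g \<circ> f)"
proof (rule smooth_onI)
  fix x assume x: "x \<in> S"
  obtain U F where UF0: "smooth_extension S f x U F"
    by (rule smooth_on_extension[OF f x])
  note UF = smooth_extensionD[OF UF0]
  have x2: "f x \<in> T" using x fT by auto
  obtain V G where VG0: "smooth_extension T g (f x) V G"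
    by (rule smooth_on_extension[OF g x2])
  note VG = smooth_extensionD[OF VG0]
  let ?W = "U \<inter> F -` V"
  have W: "open ?W" using continuous_open_preimage[OF Ck_on_continuous[OF UF(3)] UF(1) VG(1)] .
  have "Ck_on k ?W (\<lambda>y. G (F y))" for k
    by (rule Ck_on_compose[OF W VG(1) _ Ck_on_subset[OF UF(3)] VG(3)]) auto
  moreover have "x \<in> ?W" using x UF VG by auto
  moreover have "(g \<circ> f) y = G (F y)" if "y \<in> S" "y \<in> ?W" for y
    using that UF(4)[of y] VG(4)[of "f y"] fT by auto
  ultimately show "\<exists>U F. smooth_extension S (g \<circ> f) x U F"
    using W by (intro smooth_on_witness[of ?W x "\<lambda>y. G (F y)"])
qed

lemma smooth_on_add:
  fixes f g :: "'a::euclidean_space \<Rightarrow> 'b::real_normed_vector"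
  assumes f: "smooth_on S f" and g: "smooth_on S g"
  shows "smooth_on S (\<lambda>x. f x + g x)"
proof (rule smooth_onI)
  fix x assume x: "x \<in> S"
  obtain U F where UF0: "smooth_extension S f x U F"
    by (rule smooth_on_extension[OF f x])
  note UF = smooth_extensionD[OF UF0]
  obtain V G where VG0: "smooth_extension S g x V G"
    by (rule smooth_on_extension[OF g x])
  note VG = smooth_extensionD[OF VG0]
  have C: "Ck_on k (U \<inter> V) (\<lambda>y. F y + G y)" for k
    by (rule Ck_on_add[OF _ Ck_on_subset[OF UF(3)] Ck_on_subset[OF VG(3)]]) (use UF VG in auto)
  show "\<exists>U F. smooth_extension S (\<lambda>x. f x + g x) x U F"
    by (rule smooth_on_witness[OF _ _ C]) (use UF VG in auto)
qed

lemma smooth_on_linear: "bounded_linear L \<Longrightarrow> smooth_on S L"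
  using smooth_on_subset[OF smooth_onI_open[OF open_UNIV Ck_on_linear[OF _ open_UNIV]]] by blast

lemma smooth_on_const: "smooth_on S (\<lambda>x. c)"
  using smooth_on_subset[OF smooth_onI_open[OF open_UNIV Ck_on_const[OF open_UNIV]]] by blast


section \<open>Derivatives within the half-space\<close>

lemma bdir_Basis [simp]: "(bdir :: 'v::euclidean_space) \<in> Basis"
  unfolding bdir_def using nonempty_Basis by (simp add: some_in_eq)

lemma inner_bdir_bdir [simp]: "(bdir :: 'v::euclidean_space) \<bullet> bdir = 1"
  by (simp add: inner_same_Basis)

lemma tang_inner_bdir [simp]: "tang v \<bullet> bdir = 0"
  by (simp add: tang_def inner_diff_left)

lemma bounded_linear_tang: "bounded_linear tang"
  unfolding tang_def
  by (intro bounded_linear_sub bounded_linear_ident bounded_linear_scaleR_const[OF bounded_linear_inner_left])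

lemma tang_id: "v \<bullet> bdir = 0 \<Longrightarrow> tang v = v"
  by (simp add: tang_def)

lemma tang_add_bdir: "tang (v + t *\<^sub>R bdir) = tang v"
  by (simp add: tang_def algebra_simps)

lemma tang_decomp: "tang v + (v \<bullet> bdir) *\<^sub>R bdir = v"
  by (simp add: tang_def)

lemma closed_half_space: "closed (half_space :: 'v::euclidean_space set)"
  unfolding half_space_def by (intro closed_Collect_le continuous_intros)

text \<open>From any point of the half-space one may move a little in every positive basis
  direction, since basis vectors have inner product 0 or 1 with \<open>bdir\<close>. This determines
  one-sided derivatives at the boundary as well.\<close>

lemma half_space_derivative_unique:
  assumes "(f has_derivative f') (at x within half_space)"
    and "(f has_derivative f'') (at x within half_space)" and "x \<in> half_space"
  shows "f' = f''"
proof (rule frechet_derivative_unique_within[OF assms(1,2)])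
  fix i :: 'a and e :: real assume "i \<in> Basis" "e > 0"
  moreover have "0 \<le> (x + (e / 2) *\<^sub>R i) \<bullet> bdir"
    using assms(3) calculation inner_Basis[of i "bdir :: 'a"]
    by (auto simp: inner_add_left half_space_def)
  ultimately show "\<exists>d. 0 < \<bar>d\<bar> \<and> \<bar>d\<bar> < e \<and> x + d *\<^sub>R i \<in> half_space"
    by (intro exI[of _ "e / 2"]) (auto simp: half_space_def)
qed

abbreviation dH :: "('v::euclidean_space \<Rightarrow> 'b::real_normed_vector) \<Rightarrow> 'v \<Rightarrow> 'v \<Rightarrow> 'b" where
  "dH f x \<equiv> frechet_derivative f (at x within half_space)"

lemma dH_eq:
  "(f has_derivative f') (at x within half_space) \<Longrightarrow> x \<in> half_space \<Longrightarrow> dH f x = f'"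
  by (metis half_space_derivative_unique frechet_derivative_works differentiableI)

abbreviation relopen :: "'v::euclidean_space set \<Rightarrow> bool" where
  "relopen S \<equiv> openin (top_of_set half_space) S"

lemma relopen_half_space: "relopen S \<Longrightarrow> x \<in> S \<Longrightarrow> x \<in> half_space"
  using openin_imp_subset by blast

lemma relopen_at:
  assumes "relopen S" "x \<in> S"
  shows "at x within S = at x within half_space"
proof -
  obtain T where "open T" "S = half_space \<inter> T" using assms(1) by (auto simp: openin_open)
  then show ?thesis using assms(2) by (intro at_within_nhd[of x T]) auto
qed

lemma dH_extension:
  assumes e: "smooth_extension S f x U F" and S: "relopen S" "x \<in> S"
  shows "(f has_derivative frechet_derivative F (at x)) (at x within half_space)"
proof -
  note UF = smooth_extensionD[OF e]
  have r: "relopen (S \<inter> U)" using S(1) UF(1) by (simp add: openin_Int_open)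
  have "(F has_derivative frechet_derivative F (at x)) (at x)"
    using Ck_on_SucD(1)[OF UF(3) UF(2)] .
  then have "(F has_derivative frechet_derivative F (at x)) (at x within S \<inter> U)"
    by (rule has_derivative_at_withinI)
  then have "(f has_derivative frechet_derivative F (at x)) (at x within S \<inter> U)"
    using UF(2,4) S(2) by (intro has_derivative_transform[of x "S \<inter> U" f F]) auto
  then show ?thesis using relopen_at[OF r] UF(2) S(2) by simp
qed

lemma smooth_on_has_dH:
  assumes "smooth_on S f" "relopen S" "x \<in> S"
  shows "(f has_derivative dH f x) (at x within half_space)"
proof -
  obtain U F where e: "smooth_extension S f x U F" by (rule smooth_on_extension[OF assms(1,3)])
  from dH_extension[OF e assms(2,3)] show ?thesis
    using dH_eq relopen_half_space[OF assms(2,3)] by metis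
qed

text \<open>One extension \<open>F\<close> serves all points of \<open>S\<close> in its domain.
  Since half-space derivatives are unique, the derivative of \<open>F\<close> is itself an extension
  of the derivative of \<open>f\<close>.\<close>

lemma smooth_on_dH:
  assumes "smooth_on S f" "relopen S"
  shows "smooth_on S (\<lambda>z. dH f z v)"
proof (rule smooth_onI)
  fix x assume x: "x \<in> S"
  obtain U F where e: "smooth_extension S f x U F" by (rule smooth_on_extension[OF assms(1) x])
  note UF = smooth_extensionD[OF e]
  have C: "Ck_on k U (\<lambda>z. frechet_derivative F (at z) v)" for k
    by (rule Ck_on_SucD(2)[OF UF(3)])
  have "dH f y v = frechet_derivative F (at y) v" if "y \<in> S" "y \<in> U" for y
  proof -
    have "smooth_extension S f y U F" using e that by (simp add: smooth_extension_def)
    from dH_extension[OF this assms(2) that(1)] show ?thesis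
      using dH_eq relopen_half_space[OF assms(2) that(1)] by metis
  qed
  with UF(1,2) show "\<exists>U F. smooth_extension S (\<lambda>z. dH f z v) x U F"
    by (intro smooth_on_witness[OF _ _ C]) auto
qed

lemma dH_cong:
  assumes "smooth_on S f" "relopen S" "x \<in> S" "\<And>y. y \<in> S \<Longrightarrow> g y = f y"
  shows "dH g x = dH f x"
proof -
  have "(f has_derivative dH f x) (at x within S)"
    using smooth_on_has_dH[OF assms(1-3)] relopen_at[OF assms(2,3)] by simp
  from has_derivative_transform[OF assms(3,4) this]
  have "(g has_derivative dH f x) (at x within S)" by simp
  then show ?thesis
    using relopen_at[OF assms(2,3)] relopen_half_space[OF assms(2,3)] by (simp add: dH_eq)
qed

lemma dH_compose:
  assumes f: "smooth_on S f" "relopen S" "x \<in> S" and fT: "f ` S \<subseteq> T"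
    and g: "smooth_on T g" "relopen T"
  shows "dH (g \<circ> f) x = dH g (f x) \<circ> dH f x"
proof -
  have fx: "f x \<in> T" using f(3) fT by auto
  have "(f has_derivative dH f x) (at x within S)"
    using smooth_on_has_dH[OF f] relopen_at[OF f(2,3)] by simp
  moreover have "(g has_derivative dH g (f x)) (at (f x) within f ` S)"
    using has_derivative_subset[OF smooth_on_has_dH[OF g fx]] fT openin_imp_subset[OF g(2)] by blast
  ultimately have "(g \<circ> f has_derivative dH g (f x) \<circ> dH f x) (at x within S)"
    by (rule diff_chain_within)
  then show ?thesis
    using relopen_at[OF f(2,3)] relopen_half_space[OF f(2,3)] by (simp add: dH_eq)
qed

lemma dH_id: "x \<in> half_space \<Longrightarrow> dH (\<lambda>x. x) x = (\<lambda>v. v)"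
  by (rule dH_eq) auto

lemma at_half_space_interior: "0 < x \<bullet> bdir \<Longrightarrow> at x within half_space = at x"
proof -
  assume x: "0 < x \<bullet> bdir"
  have "open {x :: 'a. 0 < x \<bullet> bdir}" by (intro open_Collect_less continuous_intros)
  then show ?thesis
    using x by (intro at_within_nhd[of x "{x. 0 < x \<bullet> bdir}" half_space UNIV, simplified])
      (auto simp: half_space_def)
qed


section \<open>Admissible charts\<close>

lemma chart_facts:
  assumes "is_chart \<kappa>"
  shows "open (fst \<kappa>)" "relopen (snd \<kappa> ` fst \<kappa>)"
    "\<And>x. x \<in> fst \<kappa> \<Longrightarrow> cinv \<kappa> (snd \<kappa> x) = x"
    "\<And>z. z \<in> snd \<kappa> ` fst \<kappa> \<Longrightarrow> cinv \<kappa> z \<in> fst \<kappa>"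
    "\<And>z. z \<in> snd \<kappa> ` fst \<kappa> \<Longrightarrow> snd \<kappa> (cinv \<kappa> z) = z"
    "continuous_on (fst \<kappa>) (snd \<kappa>)" "continuous_on (snd \<kappa> ` fst \<kappa>) (cinv \<kappa>)"
  using assms unfolding is_chart_def homeomorphism_def by auto

lemma chart_relopen:
  assumes "is_chart \<kappa>" "open W"
  shows "relopen (snd \<kappa> ` (W \<inter> fst \<kappa>))"
proof -
  have "openin (top_of_set (fst \<kappa>)) (W \<inter> fst \<kappa>)"
    using assms(2) by (metis Int_commute openin_open_Int)
  then have "openin (top_of_set (snd \<kappa> ` fst \<kappa>)) (snd \<kappa> ` (W \<inter> fst \<kappa>))"
    using assms(1) unfolding is_chart_def by (blast intro: homeomorphism_imp_open_map)
  then show ?thesis using chart_facts(2)[OF assms(1)] by (rule openin_trans)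
qed

lemma chart_cinv_open:
  assumes "is_chart \<kappa>" "relopen A" "A \<subseteq> snd \<kappa> ` fst \<kappa>"
  shows "open (cinv \<kappa> ` A)"
proof -
  have "openin (top_of_set (snd \<kappa> ` fst \<kappa>)) A"
    using assms(2,3) openin_imp_subset[OF chart_facts(2)[OF assms(1)]]
    by (rule openin_subset_trans)
  then have "openin (top_of_set (fst \<kappa>)) (cinv \<kappa> ` A)"
    using assms(1) unfolding is_chart_def
    by (meson homeomorphism_imp_open_map homeomorphism_symD)
  then show ?thesis using chart_facts(1)[OF assms(1)] openin_open_trans by blast
qed

text \<open>Collar charts are not members of the atlas, but they are compatible with it.\<close>

definition adm :: "('m::topological_space, 'v::euclidean_space) riem \<Rightarrow> ('m, 'v) chart \<Rightarrow> bool" where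
  "adm M \<kappa> \<longleftrightarrow> is_chart \<kappa> \<and> (\<forall>\<kappa>'\<in>atlas M. compatible \<kappa> \<kappa>')"

lemma adm_chart: "adm M \<kappa> \<Longrightarrow> is_chart \<kappa>"
  by (simp add: adm_def)

lemmas adm_facts = chart_facts[OF adm_chart]

text \<open>Locality is available in the coordinate space but needed on the manifold. The chart
  image of an open \<open>W\<close> is the trace of an open \<open>V\<close> on the half-space, and
  injectivity of the chart brings points over \<open>V\<close> back into \<open>W\<close>.\<close>

lemma chart_smooth_local:
  assumes \<kappa>: "is_chart \<kappa>"
    and "\<And>q. q \<in> S \<Longrightarrow> q \<in> fst \<kappa> \<Longrightarrow>
      \<exists>W. open W \<and> q \<in> W \<and> smooth_on (snd \<kappa> ` (S \<inter> W \<inter> fst \<kappa>)) g"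
  shows "smooth_on (snd \<kappa> ` (S \<inter> fst \<kappa>)) g"
proof (rule smooth_on_local)
  fix x assume "x \<in> snd \<kappa> ` (S \<inter> fst \<kappa>)"
  then obtain q where q: "q \<in> S" "q \<in> fst \<kappa>" "x = snd \<kappa> q" by auto
  then obtain W where W: "open W" "q \<in> W" "smooth_on (snd \<kappa> ` (S \<inter> W \<inter> fst \<kappa>)) g"
    using assms(2) by blast
  obtain V where V: "open V" "snd \<kappa> ` (W \<inter> fst \<kappa>) = half_space \<inter> V"
    using chart_relopen[OF \<kappa> W(1)] by (auto simp: openin_open)
  have "snd \<kappa> ` (S \<inter> fst \<kappa>) \<inter> V \<subseteq> snd \<kappa> ` (S \<inter> W \<inter> fst \<kappa>)"
  proof
    fix z assume z: "z \<in> snd \<kappa> ` (S \<inter> fst \<kappa>) \<inter> V"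
    then obtain p where p: "p \<in> S" "p \<in> fst \<kappa>" "z = snd \<kappa> p" by auto
    have "z \<in> half_space" using p chart_facts(2)[OF \<kappa>] relopen_half_space by blast
    then have "z \<in> snd \<kappa> ` (W \<inter> fst \<kappa>)" using V z by auto
    then obtain p' where p': "p' \<in> W" "p' \<in> fst \<kappa>" "z = snd \<kappa> p'" by auto
    then have "p = p'" using p chart_facts(3)[OF \<kappa>] by metis
    then show "z \<in> snd \<kappa> ` (S \<inter> W \<inter> fst \<kappa>)" using p p' by auto
  qed
  then have "smooth_on (snd \<kappa> ` (S \<inter> fst \<kappa>) \<inter> V) g" by (rule smooth_on_subset[OF W(3)])
  moreover have "x \<in> V" using V q W(2) by auto
  ultimately show "\<exists>W. open W \<and> x \<in> W \<and> smooth_on (snd \<kappa> ` (S \<inter> fst \<kappa>) \<inter> W) g"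
    using V(1) by blast
qed

section \<open>Smooth functions, boundary points and tangent vectors in admissible charts\<close>

locale smooth_mfd =
  fixes M :: "('m::{t2_space,second_countable_topology}, 'v::euclidean_space) riem"
  assumes smooth_mfd: "smooth_manifold M"
begin

lemma atlas_adm: "\<kappa> \<in> atlas M \<Longrightarrow> adm M \<kappa>"
  using smooth_mfd by (auto simp: adm_def smooth_manifold_def)

lemma atlas_cover: obtains \<kappa> where "\<kappa> \<in> atlas M" "x \<in> fst \<kappa>"
proof -
  have "x \<in> (\<Union>\<kappa>\<in>atlas M. fst \<kappa>)" using smooth_mfd by (simp add: smooth_manifold_def)
  then show thesis using that by blast
qed

lemma chart_at: "chart_at M x \<in> atlas M" "x \<in> fst (chart_at M x)"
proof -
  have "\<exists>\<kappa>. \<kappa> \<in> atlas M \<and> x \<in> fst \<kappa>" using atlas_cover[of x] by metis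
  from someI_ex[OF this] show "chart_at M x \<in> atlas M" "x \<in> fst (chart_at M x)"
    unfolding chart_at_def by auto
qed

lemma transition_atlas:
  assumes "adm M \<kappa>" "\<kappa>' \<in> atlas M"
  shows "smooth_on (snd \<kappa> ` (fst \<kappa> \<inter> fst \<kappa>')) (snd \<kappa>' \<circ> cinv \<kappa>)"
    "smooth_on (snd \<kappa>' ` (fst \<kappa> \<inter> fst \<kappa>')) (snd \<kappa> \<circ> cinv \<kappa>')"
  using assms by (auto simp: adm_def compatible_def)

text \<open>Two collar charts are only known to be compatible with the atlas, not with each other.
  Near each point the transition factors through a chart of the atlas.\<close>

lemma transition_smooth:
  assumes 1: "adm M \<kappa>" and 2: "adm M \<kappa>'"
  shows "smooth_on (snd \<kappa> ` (fst \<kappa>' \<inter> fst \<kappa>)) (snd \<kappa>' \<circ> cinv \<kappa>)"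
proof (rule chart_smooth_local[OF adm_chart[OF 1]])
  fix q assume q: "q \<in> fst \<kappa>'" "q \<in> fst \<kappa>"
  obtain \<mu> where \<mu>: "\<mu> \<in> atlas M" "q \<in> fst \<mu>" by (rule atlas_cover)
  note a = atlas_adm[OF \<mu>(1)]
  let ?S = "snd \<kappa> ` (fst \<kappa>' \<inter> fst \<mu> \<inter> fst \<kappa>)"
  have s1: "smooth_on ?S (snd \<mu> \<circ> cinv \<kappa>)"
    by (rule smooth_on_subset[OF transition_atlas(1)[OF 1 \<mu>(1)]]) auto
  have s2: "smooth_on (snd \<mu> ` (fst \<kappa>' \<inter> fst \<mu>)) (snd \<kappa>' \<circ> cinv \<mu>)"
    by (rule transition_atlas(2)[OF 2 \<mu>(1)])
  have "smooth_on ?S ((snd \<kappa>' \<circ> cinv \<mu>) \<circ> (snd \<mu> \<circ> cinv \<kappa>))"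
    by (rule smooth_on_compose[OF s1 s2]) (auto simp: adm_facts(3)[OF 1])
  then have "smooth_on ?S (snd \<kappa>' \<circ> cinv \<kappa>)"
    by (rule smooth_on_cong) (auto simp: adm_facts(3)[OF 1] adm_facts(3)[OF a])
  then show "\<exists>W. open W \<and> q \<in> W \<and> smooth_on (snd \<kappa> ` (fst \<kappa>' \<inter> W \<inter> fst \<kappa>)) (snd \<kappa>' \<circ> cinv \<kappa>)"
    using \<mu>(2) adm_facts(1)[OF a] by blast
qed

lemma chart_change:
  assumes 1: "adm M \<kappa>" and 2: "adm M \<kappa>'"
    and s: "smooth_on (snd \<kappa> ` (S \<inter> fst \<kappa>)) (f \<circ> cinv \<kappa>)"
  shows "smooth_on (snd \<kappa>' ` (S \<inter> fst \<kappa> \<inter> fst \<kappa>')) (f \<circ> cinv \<kappa>')"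
proof -
  let ?S = "snd \<kappa>' ` (S \<inter> fst \<kappa> \<inter> fst \<kappa>')"
  have s1: "smooth_on ?S (snd \<kappa> \<circ> cinv \<kappa>')"
    by (rule smooth_on_subset[OF transition_smooth[OF 2 1]]) auto
  have "smooth_on ?S ((f \<circ> cinv \<kappa>) \<circ> (snd \<kappa> \<circ> cinv \<kappa>'))"
    by (rule smooth_on_compose[OF s1 s]) (auto simp: adm_facts(3)[OF 2])
  then show ?thesis
    by (rule smooth_on_cong) (auto simp: adm_facts(3)[OF 1] adm_facts(3)[OF 2])
qed

lemma smooth_fromI:
  assumes "\<And>q. q \<in> S \<Longrightarrow> \<exists>\<kappa> W. adm M \<kappa> \<and> q \<in> fst \<kappa> \<and> open W \<and> q \<in> W \<and>
    smooth_on (snd \<kappa> ` (S \<inter> W \<inter> fst \<kappa>)) (f \<circ> cinv \<kappa>)"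
  shows "smooth_from M S f"
  unfolding smooth_from_def
proof
  fix \<kappa>' assume k: "\<kappa>' \<in> atlas M"
  note a = atlas_adm[OF k]
  show "smooth_on (snd \<kappa>' ` (S \<inter> fst \<kappa>')) (f \<circ> cinv \<kappa>')"
  proof (rule chart_smooth_local[OF adm_chart[OF a]])
    fix q assume q: "q \<in> S" "q \<in> fst \<kappa>'"
    then obtain \<kappa> W where W: "adm M \<kappa>" "q \<in> fst \<kappa>" "open W" "q \<in> W"
      "smooth_on (snd \<kappa> ` (S \<inter> W \<inter> fst \<kappa>)) (f \<circ> cinv \<kappa>)" using assms by blast
    from chart_change[OF W(1) a W(5)]
    show "\<exists>W. open W \<and> q \<in> W \<and> smooth_on (snd \<kappa>' ` (S \<inter> W \<inter> fst \<kappa>')) (f \<circ> cinv \<kappa>')"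
      using W(2-4) adm_facts(1)[OF W(1)] by (intro exI[of _ "W \<inter> fst \<kappa>"]) (auto simp: Int_assoc)
  qed
qed

lemma smooth_fromI_chart:
  assumes "adm M \<kappa>" "S \<subseteq> fst \<kappa>" "smooth_on (snd \<kappa> ` S) (f \<circ> cinv \<kappa>)"
  shows "smooth_from M S f"
proof (rule smooth_fromI)
  fix q assume "q \<in> S"
  have "S \<inter> UNIV \<inter> fst \<kappa> = S" using assms(2) by auto
  then show "\<exists>\<kappa> W. adm M \<kappa> \<and> q \<in> fst \<kappa> \<and> open W \<and> q \<in> W \<and>
      smooth_on (snd \<kappa> ` (S \<inter> W \<inter> fst \<kappa>)) (f \<circ> cinv \<kappa>)"
    using assms \<open>q \<in> S\<close> by (intro exI[of _ \<kappa>] exI[of _ UNIV]) auto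
qed

lemma smooth_from_adm:
  assumes f: "smooth_from M S f" and 1: "adm M \<kappa>"
  shows "smooth_on (snd \<kappa> ` (S \<inter> fst \<kappa>)) (f \<circ> cinv \<kappa>)"
proof (rule chart_smooth_local[OF adm_chart[OF 1]])
  fix q assume q: "q \<in> S" "q \<in> fst \<kappa>"
  obtain \<mu> where \<mu>: "\<mu> \<in> atlas M" "q \<in> fst \<mu>" by (rule atlas_cover)
  note a = atlas_adm[OF \<mu>(1)]
  have "smooth_on (snd \<mu> ` (S \<inter> fst \<mu>)) (f \<circ> cinv \<mu>)" using f \<mu> by (simp add: smooth_from_def)
  from chart_change[OF a 1 this]
  show "\<exists>W. open W \<and> q \<in> W \<and> smooth_on (snd \<kappa> ` (S \<inter> W \<inter> fst \<kappa>)) (f \<circ> cinv \<kappa>)"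
    using \<mu>(2) adm_facts(1)[OF a] by blast
qed

lemma transition_relopen:
  assumes "adm M \<kappa>" "adm M \<kappa>'"
  shows "relopen (snd \<kappa> ` (fst \<kappa>' \<inter> fst \<kappa>))"
  by (rule chart_relopen[OF adm_chart[OF assms(1)] adm_facts(1)[OF assms(2)]])

lemma transition_inverse:
  assumes 1: "adm M \<kappa>" and 2: "adm M \<kappa>'" and q: "q \<in> fst \<kappa>" "q \<in> fst \<kappa>'"
  shows "dH (snd \<kappa> \<circ> cinv \<kappa>') (snd \<kappa>' q) (dH (snd \<kappa>' \<circ> cinv \<kappa>) (snd \<kappa> q) v) = v"
proof -
  let ?S = "snd \<kappa> ` (fst \<kappa>' \<inter> fst \<kappa>)" and ?T = "snd \<kappa>' ` (fst \<kappa> \<inter> fst \<kappa>')"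
  have x: "snd \<kappa> q \<in> ?S" using q by auto
  have "dH ((snd \<kappa> \<circ> cinv \<kappa>') \<circ> (snd \<kappa>' \<circ> cinv \<kappa>)) (snd \<kappa> q) =
      dH (snd \<kappa> \<circ> cinv \<kappa>') ((snd \<kappa>' \<circ> cinv \<kappa>) (snd \<kappa> q)) \<circ> dH (snd \<kappa>' \<circ> cinv \<kappa>) (snd \<kappa> q)"
    by (rule dH_compose[OF transition_smooth[OF 1 2] transition_relopen[OF 1 2] x _
          transition_smooth[OF 2 1] transition_relopen[OF 2 1]])
      (auto simp: adm_facts(3)[OF 1])
  moreover have "dH ((snd \<kappa> \<circ> cinv \<kappa>') \<circ> (snd \<kappa>' \<circ> cinv \<kappa>)) (snd \<kappa> q) = dH (\<lambda>x. x) (snd \<kappa> q)"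
    by (rule dH_cong[OF smooth_on_linear[OF bounded_linear_ident] transition_relopen[OF 1 2] x])
      (auto simp: adm_facts(3)[OF 1] adm_facts(3)[OF 2])
  moreover have "dH (\<lambda>x. x) (snd \<kappa> q) = (\<lambda>v. v)"
    by (rule dH_id[OF relopen_half_space[OF transition_relopen[OF 1 2] x]])
  ultimately show ?thesis
    using adm_facts(3)[OF 1 q(1)] by (simp add: fun_eq_iff)
qed

text \<open>If an interior point were sent to the boundary of the half-space, the
  \<open>bdir\<close> component of the transition map would have a local minimum there, so its
  derivative would vanish. The inverse transition shows, however, that the derivative hits
  \<open>bdir\<close>.\<close>

lemma interior_chart_change:
  assumes 1: "adm M \<kappa>" and 2: "adm M \<kappa>'" and q: "q \<in> fst \<kappa>" "q \<in> fst \<kappa>'"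
    and pos: "0 < snd \<kappa> q \<bullet> bdir"
  shows "0 < snd \<kappa>' q \<bullet> bdir"
proof (rule ccontr)
  assume neg: "\<not> ?thesis"
  let ?S = "snd \<kappa> ` (fst \<kappa>' \<inter> fst \<kappa>)"
  let ?x = "snd \<kappa> q" and ?T = "snd \<kappa>' \<circ> cinv \<kappa>"
  have x: "?x \<in> ?S" using q by auto
  obtain V where V: "open V" "?S = half_space \<inter> V"
    using transition_relopen[OF 1 2] by (auto simp: openin_open)
  define V' where "V' = V \<inter> {x. 0 < x \<bullet> bdir}"
  have V': "open V'" "?x \<in> V'"
    unfolding V'_def using V pos x by (auto intro!: open_Int open_Collect_less continuous_intros)
  have T0: "0 \<le> ?T z \<bullet> bdir" if "z \<in> ?S" for z
    using that relopen_half_space[OF adm_facts(2)[OF 2]]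
    by (auto simp: adm_facts(3)[OF 1] half_space_def)
  have VS: "V' \<subseteq> ?S" using V by (auto simp: V'_def half_space_def)
  have "snd \<kappa>' q \<in> half_space" using relopen_half_space[OF adm_facts(2)[OF 2]] q by auto
  then have "snd \<kappa>' q \<bullet> bdir = 0" using neg by (simp add: half_space_def)
  then have T1: "?T ?x \<bullet> bdir = 0" using adm_facts(3)[OF 1 q(1)] by simp
  have "(?T has_derivative dH ?T ?x) (at ?x)"
    using smooth_on_has_dH[OF transition_smooth[OF 1 2] transition_relopen[OF 1 2] x]
      at_half_space_interior[OF pos] by simp
  then have "((\<lambda>z. ?T z \<bullet> bdir) has_derivative (\<lambda>v. dH ?T ?x v \<bullet> bdir)) (at ?x)"
    by (rule has_derivative_inner_left)
  then have "(\<lambda>v. dH ?T ?x v \<bullet> bdir) = (\<lambda>v. 0)"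
    by (rule differential_zero_maxmin[OF V'(2,1)]) (use T0 T1 VS in auto)
  moreover have "dH ?T ?x (dH (snd \<kappa> \<circ> cinv \<kappa>') (snd \<kappa>' q) bdir) = bdir"
    by (rule transition_inverse[OF 2 1 q(2,1)])
  ultimately show False by (metis inner_bdir_bdir zero_neq_one)
qed

lemma chart_inner_bdir_nonneg: "adm M \<kappa> \<Longrightarrow> q \<in> fst \<kappa> \<Longrightarrow> 0 \<le> snd \<kappa> q \<bullet> bdir"
  using relopen_half_space[OF adm_facts(2), of M \<kappa> "snd \<kappa> q"] by (simp add: half_space_def)

lemma bdry_iff:
  assumes 1: "adm M \<kappa>" and q: "q \<in> fst \<kappa>"
  shows "q \<in> bdry M \<longleftrightarrow> snd \<kappa> q \<bullet> bdir = 0"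
proof
  assume "q \<in> bdry M"
  then obtain \<mu> where m: "\<mu> \<in> atlas M" "q \<in> fst \<mu>" "snd \<mu> q \<bullet> bdir = 0"
    by (auto simp: bdry_def)
  then show "snd \<kappa> q \<bullet> bdir = 0"
    using interior_chart_change[OF 1 atlas_adm[OF m(1)] q m(2)] chart_inner_bdir_nonneg[OF 1 q] by linarith
next
  assume 0: "snd \<kappa> q \<bullet> bdir = 0"
  obtain \<mu> where m: "\<mu> \<in> atlas M" "q \<in> fst \<mu>" by (rule atlas_cover)
  have "snd \<mu> q \<bullet> bdir = 0"
    using interior_chart_change[OF atlas_adm[OF m(1)] 1 m(2) q] chart_inner_bdir_nonneg[OF atlas_adm[OF m(1)] m(2)] 0
    by linarith
  then show "q \<in> bdry M" using m by (auto simp: bdry_def)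
qed

lemma closed_bdry: "closed (bdry M)"
proof -
  have "open (- bdry M)"
  proof (subst open_subopen, rule ballI)
    fix q assume q: "q \<in> - bdry M"
    obtain \<kappa> where k: "\<kappa> \<in> atlas M" "q \<in> fst \<kappa>" by (rule atlas_cover)
    note a = atlas_adm[OF k(1)]
    let ?W = "fst \<kappa> \<inter> (\<lambda>p. snd \<kappa> p \<bullet> bdir) -` {0<..}"
    have "open ?W"
      by (rule continuous_open_preimage) (auto intro!: continuous_intros adm_facts(1,6)[OF a])
    moreover have "q \<in> ?W" using k q bdry_iff[OF a k(2)] chart_inner_bdir_nonneg[OF a k(2)] by auto
    moreover have "?W \<subseteq> - bdry M" using bdry_iff[OF a] by auto
    ultimately show "\<exists>T. open T \<and> q \<in> T \<and> T \<subseteq> - bdry M" by blast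
  qed
  then show ?thesis by (simp add: closed_def)
qed

text \<open>By the chain rule the selected chart \<open>chart_at M x\<close> drops out, so
  directional derivatives can be computed in any admissible chart.\<close>

lemma tderiv_tvec:
  assumes 1: "adm M \<kappa>" and S: "open S" "x \<in> S" "x \<in> fst \<kappa>"
    and s: "smooth_on (snd \<kappa> ` (S \<inter> fst \<kappa>)) (f \<circ> cinv \<kappa>)"
  shows "tderiv M x (tvec M \<kappa> x v) f = dH (f \<circ> cinv \<kappa>) (snd \<kappa> x) v"
proof -
  define c where "c = chart_at M x"
  have c: "adm M c" "x \<in> fst c" using chart_at atlas_adm by (auto simp: c_def)
  have s': "smooth_on (snd c ` (S \<inter> fst \<kappa> \<inter> fst c)) (f \<circ> cinv c)"
    by (rule chart_change[OF 1 c(1) s])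
  let ?A = "snd \<kappa> ` (S \<inter> fst c \<inter> fst \<kappa>)"
  have A: "relopen ?A" using chart_relopen[OF adm_chart[OF 1]] S(1) adm_facts(1)[OF c(1)] by blast
  have B: "relopen (snd c ` (S \<inter> fst \<kappa> \<inter> fst c))"
    using chart_relopen[OF adm_chart[OF c(1)]] S(1) adm_facts(1)[OF 1] by blast
  have x: "snd \<kappa> x \<in> ?A" using S c by auto
  have t: "smooth_on ?A (snd c \<circ> cinv \<kappa>)"
    by (rule smooth_on_subset[OF transition_smooth[OF 1 c(1)]]) auto
  have "dH ((f \<circ> cinv c) \<circ> (snd c \<circ> cinv \<kappa>)) (snd \<kappa> x) =
      dH (f \<circ> cinv c) ((snd c \<circ> cinv \<kappa>) (snd \<kappa> x)) \<circ> dH (snd c \<circ> cinv \<kappa>) (snd \<kappa> x)"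
    by (rule dH_compose[OF t A x _ s' B]) (auto simp: adm_facts(3)[OF 1])
  moreover have "dH ((f \<circ> cinv c) \<circ> (snd c \<circ> cinv \<kappa>)) (snd \<kappa> x) = dH (f \<circ> cinv \<kappa>) (snd \<kappa> x)"
    by (rule dH_cong[OF smooth_on_subset[OF s] A x]) (auto simp: adm_facts(3)[OF 1] adm_facts(3)[OF c(1)])
  ultimately show ?thesis
    using adm_facts(3)[OF 1 S(3)] by (simp add: tderiv_def tvec_def fun_eq_iff c_def)
qed

lemma tvec_linear:
  assumes 1: "adm M \<kappa>" and x: "x \<in> fst \<kappa>"
  shows "linear (tvec M \<kappa> x)"
proof -
  note c = atlas_adm[OF chart_at(1)[of x]] 
  have "snd \<kappa> x \<in> snd \<kappa> ` (fst (chart_at M x) \<inter> fst \<kappa>)" using x chart_at by auto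
  from smooth_on_has_dH[OF transition_smooth[OF 1 c] transition_relopen[OF 1 c] this]
  have "linear (dH (snd (chart_at M x) \<circ> cinv \<kappa>) (snd \<kappa> x))" by (rule has_derivative_linear)
  then show ?thesis by (simp add: tvec_def[abs_def])
qed

lemma tvec_eq_0:
  assumes 1: "adm M \<kappa>" and x: "x \<in> fst \<kappa>" and 0: "tvec M \<kappa> x v = 0"
  shows "v = 0"
proof -
  note c = atlas_adm[OF chart_at(1)[of x]]
  let ?c = "chart_at M x"
  have "snd ?c x \<in> snd ?c ` (fst \<kappa> \<inter> fst ?c)" using x chart_at by auto
  from smooth_on_has_dH[OF transition_smooth[OF c 1] transition_relopen[OF c 1] this]
  have "linear (dH (snd \<kappa> \<circ> cinv ?c) (snd ?c x))" by (rule has_derivative_linear)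
  moreover have "dH (snd \<kappa> \<circ> cinv ?c) (snd ?c x) (tvec M \<kappa> x v) = v"
    unfolding tvec_def by (rule transition_inverse[OF 1 c x chart_at(2)])
  ultimately show ?thesis using 0 linear_0 by metis
qed

text \<open>Smoothness of the metric is postulated only when it is paired with smooth vector fields.
  Coordinate fields give access to its coefficients.\<close>

lemma smooth_vfield_tvec:
  assumes 1: "adm M \<kappa>"
  shows "smooth_vfield M (fst \<kappa>) (\<lambda>x. tvec M \<kappa> x v)"
  unfolding smooth_vfield_def
proof
  fix \<mu> assume m: "\<mu> \<in> atlas M"
  note a = atlas_adm[OF m]
  have e: "tderiv M x (tvec M \<kappa> x v) (snd \<mu>) = dH (snd \<mu> \<circ> cinv \<kappa>) (snd \<kappa> x) v"
    if "x \<in> fst \<kappa>" "x \<in> fst \<mu>" for x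
    by (rule tderiv_tvec[OF 1 adm_facts(1)[OF a] that(2,1) transition_smooth[OF 1 a]])
  have "smooth_on (snd \<kappa> ` (fst \<mu> \<inter> fst \<kappa>)) (\<lambda>z. dH (snd \<mu> \<circ> cinv \<kappa>) z v)"
    by (rule smooth_on_dH[OF transition_smooth[OF 1 a] transition_relopen[OF 1 a]])
  then have s: "smooth_on (snd \<kappa> ` (fst \<mu> \<inter> fst \<kappa>))
     ((\<lambda>x. tderiv M x (tvec M \<kappa> x v) (snd \<mu>)) \<circ> cinv \<kappa>)"
    by (rule smooth_on_cong) (auto simp: adm_facts(3)[OF 1] e)
  then show "smooth_from M (fst \<kappa> \<inter> fst \<mu>) (\<lambda>x. tderiv M x (tvec M \<kappa> x v) (snd \<mu>))"
    by (intro smooth_fromI_chart[OF 1]) (auto simp: Int_commute)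
qed

end

section \<open>The metric as a bilinear form in the coordinates of a chart\<close>

definition gm :: "('m, 'v::euclidean_space) riem \<Rightarrow> ('m, 'v) chart \<Rightarrow> 'm \<Rightarrow> 'v \<Rightarrow> 'v \<Rightarrow> real" where
  "gm M \<kappa> x v w = rmetric M x (tvec M \<kappa> x v) (tvec M \<kappa> x w)"

locale riem_mfd =
  fixes M :: "('m::{t2_space,second_countable_topology}, 'v::euclidean_space) riem"
  assumes riem: "riemannian_manifold M"

sublocale riem_mfd \<subseteq> smooth_mfd
  using riem by unfold_locales (simp add: riemannian_manifold_def)

context riem_mfd
begin

lemma gm_continuous:
  assumes 1: "adm M \<kappa>"
  shows "continuous_on (snd \<kappa> ` fst \<kappa>) (\<lambda>z. gm M \<kappa> (cinv \<kappa> z) v w)"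
proof -
  have "\<forall>U X Y. open U \<and> smooth_vfield M U X \<and> smooth_vfield M U Y \<longrightarrow>
        smooth_from M U (\<lambda>x. rmetric M x (X x) (Y x))"
    using riem by (simp add: riemannian_manifold_def)
  then have "smooth_from M (fst \<kappa>) (\<lambda>x. rmetric M x (tvec M \<kappa> x v) (tvec M \<kappa> x w))"
    using adm_facts(1)[OF 1] smooth_vfield_tvec[OF 1] by blast
  from smooth_on_continuous[OF smooth_from_adm[OF this 1]]
  show ?thesis by (simp add: gm_def o_def)
qed

lemma gm_pos:
  assumes 1: "adm M \<kappa>" "x \<in> fst \<kappa>" "v \<noteq> 0"
  shows "0 < gm M \<kappa> x v v"
proof -
  have "tvec M \<kappa> x v \<noteq> 0" using tvec_eq_0[OF 1(1,2)] 1(3) by metis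
  then show ?thesis using riem by (simp add: gm_def riemannian_manifold_def)
qed

lemma gm_bilinear:
  assumes 1: "adm M \<kappa>" and x: "x \<in> fst \<kappa>"
  shows "bilinear (gm M \<kappa> x)"
proof -
  have b: "bilinear (rmetric M x)" using riem by (simp add: riemannian_manifold_def)
  note l = tvec_linear[OF 1 x]
  show ?thesis
    unfolding bilinear_def gm_def
    using linear_compose[OF l] b unfolding bilinear_def by (auto simp: o_def)
qed

lemma gm_expand:
  assumes 1: "adm M \<kappa>" and x: "x \<in> fst \<kappa>"
  shows "gm M \<kappa> x v w = (\<Sum>(i,j)\<in>Basis \<times> Basis. (v \<bullet> i) * (w \<bullet> j) * gm M \<kappa> x i j)"
proof -
  note b = gm_bilinear[OF 1 x]
  have "gm M \<kappa> x v w = gm M \<kappa> x (\<Sum>i\<in>Basis. (v \<bullet> i) *\<^sub>R i) (\<Sum>j\<in>Basis. (w \<bullet> j) *\<^sub>R j)"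
    by (simp add: euclidean_representation)
  also have "\<dots> = (\<Sum>(i,j)\<in>Basis \<times> Basis. gm M \<kappa> x ((v \<bullet> i) *\<^sub>R i) ((w \<bullet> j) *\<^sub>R j))"
    by (rule bilinear_sum[OF b])
  also have "\<dots> = (\<Sum>(i,j)\<in>Basis \<times> Basis. (v \<bullet> i) * (w \<bullet> j) * gm M \<kappa> x i j)"
    by (intro sum.cong) (auto simp: bilinear_lmul[OF b] bilinear_rmul[OF b])
  finally show ?thesis .
qed

lemma gm_continuous_pair:
  assumes 1: "adm M \<kappa>"
  shows "continuous_on ((snd \<kappa> ` fst \<kappa>) \<times> UNIV) (\<lambda>(z,v). gm M \<kappa> (cinv \<kappa> z) v v)"
proof -
  have c: "continuous_on ((snd \<kappa> ` fst \<kappa>) \<times> UNIV) (\<lambda>p. gm M \<kappa> (cinv \<kappa> (fst p)) i j)" for i j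
    by (rule continuous_on_compose2[OF gm_continuous[OF 1]]) (auto intro: continuous_intros)
  have "continuous_on ((snd \<kappa> ` fst \<kappa>) \<times> UNIV)
     (\<lambda>p. \<Sum>q\<in>Basis \<times> Basis. (snd p \<bullet> fst q) * (snd p \<bullet> snd q) * gm M \<kappa> (cinv \<kappa> (fst p)) (fst q) (snd q))"
    by (intro continuous_intros c)
  then show ?thesis
    by (rule continuous_on_eq) (auto simp: gm_expand[OF 1 adm_facts(4)[OF 1]] split_def)
qed

text \<open>The quadratic form is continuous and positive on \<open>C\<close> times the unit sphere,
  hence bounded there on both sides by compactness; homogeneity extends the bounds to all vectors.
  Squared constants make a square root compare speeds with coordinate norms directly.\<close>

lemma gm_bounds:
  assumes 1: "adm M \<kappa>" and C: "compact C" "C \<subseteq> snd \<kappa> ` fst \<kappa>"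
  obtains c D where "0 < c" "0 < D"
    "\<And>z v. z \<in> C \<Longrightarrow> (c * norm v)\<^sup>2 \<le> gm M \<kappa> (cinv \<kappa> z) v v"
    "\<And>z v. z \<in> C \<Longrightarrow> gm M \<kappa> (cinv \<kappa> z) v v \<le> (D * norm v)\<^sup>2"
proof -
  define G where "G = (\<lambda>(z,v). gm M \<kappa> (cinv \<kappa> z) v v)"
  let ?K = "C \<times> sphere (0::'v) 1"
  have K: "compact ?K" using C by (intro compact_Times compact_sphere)
  have cont: "continuous_on ?K G"
    unfolding G_def by (rule continuous_on_subset[OF gm_continuous_pair[OF 1]]) (use C in auto)
  have pos: "0 < G p" if "p \<in> ?K" for p
  proof -
    have "fst p \<in> snd \<kappa> ` fst \<kappa>" "snd p \<noteq> 0" using that C(2) by auto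
    from gm_pos[OF 1 adm_facts(4)[OF 1 this(1)] this(2)] show ?thesis by (simp add: G_def split_def)
  qed
  have hom: "gm M \<kappa> (cinv \<kappa> z) v v = (norm v)\<^sup>2 * G (z, v /\<^sub>R norm v)" if "z \<in> C" for z v
  proof -
    have b: "bilinear (gm M \<kappa> (cinv \<kappa> z))" using that C(2) gm_bilinear[OF 1 adm_facts(4)[OF 1]] by blast
    show ?thesis
      by (cases "v = 0")
        (simp_all add: G_def bilinear_lmul[OF b] bilinear_rmul[OF b] power2_eq_square bilinear_lzero[OF b] field_simps)
  qed
  have unit: "(z, v /\<^sub>R norm v) \<in> ?K" if "z \<in> C" "v \<noteq> 0" for z v
    using that by auto
  show thesis
  proof (cases "C = {}")
    case True
    then show thesis using that[of 1 1] by auto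
  next
    case False
    then have ne: "?K \<noteq> {}" by (simp add: sphere_eq_empty not_less)
    obtain a where a: "a \<in> ?K" "\<And>p. p \<in> ?K \<Longrightarrow> G a \<le> G p"
      using continuous_attains_inf[OF K ne cont] by blast
    obtain b where b: "b \<in> ?K" "\<And>p. p \<in> ?K \<Longrightarrow> G p \<le> G b"
      using continuous_attains_sup[OF K ne cont] by blast
    show thesis
    proof (rule that[of "sqrt (G a)" "sqrt (G b)"])
      show "0 < sqrt (G a)" "0 < sqrt (G b)" using pos a(1) b(1) by auto
      fix z v assume z: "z \<in> C"
      have l: "(norm v)\<^sup>2 * G a \<le> (norm v)\<^sup>2 * G (z, v /\<^sub>R norm v)"
        using a(2)[OF unit[OF z]] by (cases "v = 0") (auto intro: mult_left_mono)
      have u: "(norm v)\<^sup>2 * G (z, v /\<^sub>R norm v) \<le> (norm v)\<^sup>2 * G b"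
        using b(2)[OF unit[OF z]] by (cases "v = 0") (auto intro: mult_left_mono)
      show "(sqrt (G a) * norm v)\<^sup>2 \<le> gm M \<kappa> (cinv \<kappa> z) v v"
        using l pos[OF a(1)] by (simp add: hom[OF z] power_mult_distrib mult.commute)
      show "gm M \<kappa> (cinv \<kappa> z) v v \<le> (sqrt (G b) * norm v)\<^sup>2"
        using u pos[OF b(1)] by (simp add: hom[OF z] power_mult_distrib mult.commute)
    qed
  qed
qed

end


section \<open>Curves and the Riemannian distance\<close>

lemma interval_derivative:
  fixes g :: "real \<Rightarrow> 'v::euclidean_space"
  assumes e: "smooth_extension A g s U F" and A: "openin (top_of_set {a..b}) A" "s \<in> A"
  shows "(g has_vector_derivative frechet_derivative F (at s) 1) (at s within {a..b})"
proof -
  note UF = smooth_extensionD[OF e]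
  obtain T where T: "open T" "A = {a..b} \<inter> T" using A(1) by (auto simp: openin_open)
  let ?D = "frechet_derivative F (at s)"
  have d: "(F has_derivative ?D) (at s)" using Ck_on_SucD(1)[OF UF(3) UF(2)] .
  have "?D h = h *\<^sub>R ?D 1" for h
    using linear_scale[OF has_derivative_linear[OF d], of h 1]
    by (metis mult.right_neutral real_scaleR_def)
  then have "?D = (\<lambda>h. h *\<^sub>R ?D 1)" by (rule ext)
  then have "(F has_derivative (\<lambda>h. h *\<^sub>R ?D 1)) (at s within A \<inter> U)"
    using has_derivative_at_withinI[OF d] by metis
  then have "(g has_derivative (\<lambda>h. h *\<^sub>R ?D 1)) (at s within A \<inter> U)"
    using UF(2,4) A(2) by (intro has_derivative_transform[of s "A \<inter> U" g F]) auto
  moreover have "at s within A \<inter> U = at s within {a..b}"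
    using T UF(1,2) A(2) by (intro at_within_nhd[of s "T \<inter> U"]) auto
  ultimately show ?thesis by (simp add: has_vector_derivative_def)
qed

definition speed :: "('m, 'v::euclidean_space) riem \<Rightarrow> (real \<Rightarrow> 'm) \<Rightarrow> real \<Rightarrow> real" where
  "speed M \<gamma> t = sqrt (rmetric M (\<gamma> t) (velocity M \<gamma> t) (velocity M \<gamma> t))"

lemma curve_length_speed: "curve_length M \<gamma> = integral {0..1} (speed M \<gamma>)"
  by (simp add: curve_length_def speed_def[abs_def])

context smooth_mfd
begin

lemma smooth_into_adm:
  assumes f: "smooth_into M S f" and 1: "adm M \<kappa>"
  shows "smooth_on (S \<inter> f -` fst \<kappa>) (snd \<kappa> \<circ> f)"
proof (rule smooth_on_local)
  fix x assume x: "x \<in> S \<inter> f -` fst \<kappa>"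
  obtain \<mu> where \<mu>: "\<mu> \<in> atlas M" "f x \<in> fst \<mu>" by (rule atlas_cover)
  note a = atlas_adm[OF \<mu>(1)]
  have "continuous_on S f" using f by (simp add: smooth_into_def)
  then obtain V where V: "open V" "S \<inter> V = S \<inter> f -` fst \<mu>"
    using adm_facts(1)[OF a] by (auto simp: continuous_on_open_invariant Int_commute)
  then have Vm: "f y \<in> fst \<mu>" if "y \<in> S" "y \<in> V" for y using that by blast
  let ?A = "S \<inter> f -` fst \<kappa> \<inter> V"
  have s1: "smooth_on ?A (snd \<mu> \<circ> f)"
    by (rule smooth_on_subset[of "S \<inter> f -` fst \<mu>"]) (use f \<mu> V in \<open>auto simp: smooth_into_def\<close>)
  have "smooth_on ?A ((snd \<kappa> \<circ> cinv \<mu>) \<circ> (snd \<mu> \<circ> f))"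
    by (rule smooth_on_compose[OF s1 transition_smooth[OF a 1]]) (use V in auto)
  then have "smooth_on ?A (snd \<kappa> \<circ> f)"
    by (rule smooth_on_cong) (use Vm adm_facts(3)[OF a] in auto)
  moreover have "x \<in> V" using V \<mu> x by auto
  ultimately show "\<exists>W. open W \<and> x \<in> W \<and> smooth_on (S \<inter> f -` fst \<kappa> \<inter> W) (snd \<kappa> \<circ> f)"
    using V(1) by blast
qed

lemma smooth_intoI:
  assumes c: "continuous_on S f"
    and s: "\<And>x. x \<in> S \<Longrightarrow> \<exists>\<kappa> W. adm M \<kappa> \<and> open W \<and> x \<in> W \<and> f ` (S \<inter> W) \<subseteq> fst \<kappa> \<and>
      smooth_on (S \<inter> W) (snd \<kappa> \<circ> f)"
  shows "smooth_into M S f"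
  unfolding smooth_into_def
proof (intro conjI c ballI)
  fix \<mu> assume m: "\<mu> \<in> atlas M"
  note a = atlas_adm[OF m]
  show "smooth_on (S \<inter> f -` fst \<mu>) (snd \<mu> \<circ> f)"
  proof (rule smooth_on_local)
    fix x assume x: "x \<in> S \<inter> f -` fst \<mu>"
    then obtain \<kappa> W where W: "adm M \<kappa>" "open W" "x \<in> W" "f ` (S \<inter> W) \<subseteq> fst \<kappa>"
      "smooth_on (S \<inter> W) (snd \<kappa> \<circ> f)" using s by blast
    let ?A = "S \<inter> f -` fst \<mu> \<inter> W"
    have s1: "smooth_on ?A (snd \<kappa> \<circ> f)" by (rule smooth_on_subset[OF W(5)]) auto
    have "smooth_on ?A ((snd \<mu> \<circ> cinv \<kappa>) \<circ> (snd \<kappa> \<circ> f))"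
      by (rule smooth_on_compose[OF s1 transition_smooth[OF W(1) a]]) (use W in auto)
    then have "smooth_on ?A (snd \<mu> \<circ> f)"
      by (rule smooth_on_cong) (use W adm_facts(3)[OF W(1)] in auto)
    then show "\<exists>W. open W \<and> x \<in> W \<and> smooth_on (S \<inter> f -` fst \<mu> \<inter> W) (snd \<mu> \<circ> f)"
      using W by blast
  qed
qed

lemma smooth_intoI_chart:
  assumes "adm M \<kappa>" "continuous_on S f" "f ` S \<subseteq> fst \<kappa>" "smooth_on S (snd \<kappa> \<circ> f)"
  shows "smooth_into M S f"
  by (rule smooth_intoI[OF assms(2)], rule exI[of _ \<kappa>], rule exI[of _ UNIV]) (use assms in auto)

lemma curve_chart_change:
  assumes 1: "adm M \<kappa>" and 2: "adm M \<mu>" and s: "s \<in> {a..b}" "\<gamma> s \<in> fst \<kappa>" "\<gamma> s \<in> fst \<mu>"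
    and c: "continuous_on {a..b} \<gamma>"
    and d: "((snd \<kappa> \<circ> \<gamma>) has_vector_derivative w) (at s within {a..b})"
  shows "((snd \<mu> \<circ> \<gamma>) has_vector_derivative dH (snd \<mu> \<circ> cinv \<kappa>) (snd \<kappa> (\<gamma> s)) w) (at s within {a..b})"
proof -
  let ?U = "fst \<mu> \<inter> fst \<kappa>" and ?T = "snd \<mu> \<circ> cinv \<kappa>"
  have "open ?U" using adm_facts(1)[OF 1] adm_facts(1)[OF 2] by auto
  then obtain V where V: "open V" "{a..b} \<inter> V = {a..b} \<inter> \<gamma> -` ?U"
    using c by (auto simp: continuous_on_open_invariant Int_commute)
  let ?I = "{a..b} \<inter> V"
  have sI: "s \<in> ?I" using V s by auto
  have at: "at s within ?I = at s within {a..b}"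
    using V(1) sI by (intro at_within_nhd[of s V]) auto
  have x: "snd \<kappa> (\<gamma> s) \<in> snd \<kappa> ` ?U" using s by auto
  let ?D = "dH ?T (snd \<kappa> (\<gamma> s))"
  have T: "(?T has_derivative ?D) (at (snd \<kappa> (\<gamma> s)) within half_space)"
    by (rule smooth_on_has_dH[OF transition_smooth[OF 1 2] transition_relopen[OF 1 2] x])
  have im: "(snd \<kappa> \<circ> \<gamma>) ` ?I \<subseteq> half_space"
    using relopen_half_space[OF adm_facts(2)[OF 1]] V(2) by auto
  have "((snd \<kappa> \<circ> \<gamma>) has_derivative (\<lambda>h. h *\<^sub>R w)) (at s within ?I)"
    using d by (simp add: has_vector_derivative_def at)
  from diff_chain_within[OF this, of ?T ?D] has_derivative_subset[OF T im]
  have "(?T \<circ> (snd \<kappa> \<circ> \<gamma>) has_derivative ?D \<circ> (\<lambda>h. h *\<^sub>R w)) (at s within ?I)"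
    by simp
  then have "((snd \<mu> \<circ> \<gamma>) has_derivative ?D \<circ> (\<lambda>h. h *\<^sub>R w)) (at s within ?I)"
    by (rule has_derivative_transform[OF sI, rotated]) (use V adm_facts(3)[OF 1] in auto)
  moreover have "?D \<circ> (\<lambda>h. h *\<^sub>R w) = (\<lambda>h. h *\<^sub>R ?D w)"
    using linear_scale[OF has_derivative_linear[OF T]] by auto
  ultimately show ?thesis by (simp add: has_vector_derivative_def at)
qed

lemma vector_derivative_tvec:
  assumes 1: "adm M \<kappa>" and ab: "a < b" and s: "s \<in> {a..b}" "\<gamma> s \<in> fst \<kappa>"
    and c: "continuous_on {a..b} \<gamma>"
    and d: "((snd \<kappa> \<circ> \<gamma>) has_vector_derivative w) (at s within {a..b})"
  shows "vector_derivative (snd (chart_at M (\<gamma> s)) \<circ> \<gamma>) (at s within {a..b}) = tvec M \<kappa> (\<gamma> s) w"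
  using vector_derivative_within_cbox[OF ab, of s, unfolded box_real(2), OF s(1)
      curve_chart_change[OF 1 atlas_adm[OF chart_at(1)] s chart_at(2) c d]]
  by (simp add: tvec_def)

lemma speed_chart:
  assumes 1: "adm M \<kappa>" and s: "s \<in> {0..1}" "\<gamma> s \<in> fst \<kappa>"
    and c: "continuous_on {0..1} \<gamma>"
    and d: "((snd \<kappa> \<circ> \<gamma>) has_vector_derivative w) (at s within {0..1})"
  shows "speed M \<gamma> s = sqrt (gm M \<kappa> (\<gamma> s) w w)"
  using vector_derivative_tvec[OF 1 _ s c d] by (simp add: speed_def velocity_def gm_def)

end

context riem_mfd
begin

lemma rmetric_nonneg: "0 \<le> rmetric M x v v"
proof (cases "v = 0")
  case True
  have "bilinear (rmetric M x)" using riem by (simp add: riemannian_manifold_def)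
  then show ?thesis using True by (simp add: bilinear_lzero)
next
  case False
  then show ?thesis using riem by (simp add: riemannian_manifold_def less_imp_le)
qed

lemma speed_nonneg: "0 \<le> speed M \<gamma> t"
  by (simp add: speed_def rmetric_nonneg)

text \<open>\<open>velocity\<close> differentiates within \<open>[0, 1]\<close>, so at the ends of a
  smooth piece its value may be meaningless. Differentiating within \<open>[a, b]\<close> instead
  gives a continuous function \<open>w\<close>, which differs from the speed at most at the two end
  points. Continuity of \<open>w\<close> is checked in a fixed chart near each time, because
  \<open>chart_at\<close> jumps.\<close>

lemma smooth_speed_integrable:
  assumes ab: "0 \<le> a" "a < b" "b \<le> 1" and g: "smooth_into M {a..b} \<gamma>"
  shows "speed M \<gamma> integrable_on {a..b}"
proof -
  define V where "V s = vector_derivative (snd (chart_at M (\<gamma> s)) \<circ> \<gamma>) (at s within {a..b})" for s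
  define w where "w s = sqrt (rmetric M (\<gamma> s) (V s) (V s))" for s
  have c: "continuous_on {a..b} \<gamma>" using g by (simp add: smooth_into_def)
  have "continuous (at s within {a..b}) w" if s: "s \<in> {a..b}" for s
  proof -
    let ?k = "chart_at M (\<gamma> s)"
    note k = atlas_adm[OF chart_at(1)[of "\<gamma> s"]]
    let ?A = "{a..b} \<inter> \<gamma> -` fst ?k"
    have A: "openin (top_of_set {a..b}) ?A"
      using c adm_facts(1)[OF k] by (simp add: continuous_on_open_gen continuous_openin_preimage_gen)
    have sA: "s \<in> ?A" using s chart_at by auto
    obtain U F where e: "smooth_extension ?A (snd ?k \<circ> \<gamma>) s U F"
      by (rule smooth_on_extension[OF smooth_into_adm[OF g k] sA])
    note UF = smooth_extensionD[OF e]
    let ?F = "\<lambda>t. frechet_derivative F (at t) 1"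
    have weq: "w t = sqrt (gm M ?k (cinv ?k (snd ?k (\<gamma> t))) (?F t) (?F t))" if t: "t \<in> ?A \<inter> U" for t
    proof -
      have "smooth_extension ?A (snd ?k \<circ> \<gamma>) t U F" using e t by (simp add: smooth_extension_def)
      from interval_derivative[OF this A]
      have "((snd ?k \<circ> \<gamma>) has_vector_derivative ?F t) (at t within {a..b})" using t by auto
      from vector_derivative_tvec[OF k ab(2) _ _ c this] have "V t = tvec M ?k (\<gamma> t) (?F t)"
        using t by (auto simp: V_def)
      then show ?thesis using t adm_facts(3)[OF k] by (auto simp: w_def gm_def)
    qed
    have cF: "continuous_on U ?F" using Ck_on_continuous[OF Ck_on_SucD(2)[OF UF(3)]] .
    have cg: "continuous_on (?A \<inter> U) (\<lambda>t. snd ?k (\<gamma> t))"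
      by (rule continuous_on_compose2[OF adm_facts(6)[OF k] continuous_on_subset[OF c]]) auto
    have "continuous_on (?A \<inter> U) (\<lambda>t. gm M ?k (cinv ?k (snd ?k (\<gamma> t))) (?F t) (?F t))"
      using continuous_on_compose2[OF gm_continuous_pair[OF k]
          continuous_on_Pair[OF cg continuous_on_subset[OF cF]]]
      by (simp add: image_subset_iff)
    then have "continuous_on (?A \<inter> U) (\<lambda>t. sqrt (gm M ?k (cinv ?k (snd ?k (\<gamma> t))) (?F t) (?F t)))"
      by (rule continuous_on_real_sqrt)
    then have "continuous_on (?A \<inter> U) w" by (rule continuous_on_eq) (use weq in auto)
    then have "continuous (at s within ?A \<inter> U) w"
      using sA UF(2) by (auto simp: continuous_on_eq_continuous_within)
    moreover obtain T where T: "open T" "?A = {a..b} \<inter> T" using A by (auto simp: openin_open)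
    moreover have "at s within ?A \<inter> U = at s within {a..b}"
      using T UF(1,2) sA by (intro at_within_nhd[of s "T \<inter> U"]) auto
    ultimately show ?thesis by simp
  qed
  then have "continuous_on {a..b} w" by (simp add: continuous_on_eq_continuous_within)
  then have w: "w integrable_on {a..b}" by (rule integrable_continuous_interval)
  have "speed M \<gamma> s = w s" if "s \<in> {a..b} - {a, b}" for s
  proof -
    have "at s within {a..b} = at s" "at s within {0..1} = at s"
      using that ab by (auto intro!: at_within_Icc_at)
    then show ?thesis by (simp add: speed_def velocity_def w_def V_def)
  qed
  then show ?thesis
    using integrable_spike_finite[of "{a,b}" "{a..b}" "speed M \<gamma>" w] w by auto
qed

text \<open>A speed that is not integrable would have the default integral 0 as its length, which
  would ruin lower bounds for lengths. The induction runs over the number of break points inside the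
  interval.\<close>

lemma speed_integrable:
  assumes g: "piecewise_smooth_curve M \<gamma>" and ab: "0 \<le> a" "a \<le> b" "b \<le> 1"
  shows "speed M \<gamma> integrable_on {a..b}"
proof -
  obtain F where F: "finite F"
    "\<And>a b. 0 \<le> a \<Longrightarrow> a < b \<Longrightarrow> b \<le> 1 \<Longrightarrow> {a<..<b} \<inter> F = {} \<Longrightarrow> smooth_into M {a..b} \<gamma>"
    using g unfolding piecewise_smooth_curve_def by blast
  show ?thesis using ab
  proof (induction "card (F \<inter> {a<..<b})" arbitrary: a b rule: less_induct)
    case less
    consider "a = b" | "a < b" "{a<..<b} \<inter> F = {}" | c where "a < b" "c \<in> {a<..<b} \<inter> F"
      using less.prems by fastforce
    then show ?case
    proof cases
      case 1
      have "speed M \<gamma> integrable_on cbox b b" by (rule integrable_on_refl)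
      then show ?thesis using 1 by simp
    next
      case 2
      then show ?thesis using smooth_speed_integrable F(2) less.prems by auto
    next
      case 3
      have l: "card (F \<inter> {a<..<c}) < card (F \<inter> {a<..<b})"
        "card (F \<inter> {c<..<b}) < card (F \<inter> {a<..<b})"
        using 3 F(1) by (auto intro!: psubset_card_mono)
      have "speed M \<gamma> integrable_on {a..c}" "speed M \<gamma> integrable_on {c..b}"
        using less.hyps[OF l(1)] less.hyps[OF l(2)] 3 less.prems by auto
      then show ?thesis
        using 3 Henstock_Kurzweil_Integration.integrable_combine[of a c b "speed M \<gamma>"] by auto
    qed
  qed
qed

text \<open>After its last time outside the open coordinate ball the curve stays in the chart. Its
  coordinates still have to travel at least \<open>\<rho>\<close> to reach the centre, and
  \<open>c\<close> converts coordinate speed into Riemannian speed.\<close>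

lemma curve_length_lower_bound:
  assumes k: "adm M \<kappa>" and l: "l \<in> fst \<kappa>" and \<rho>: "0 < \<rho>"
    and C: "cball (snd \<kappa> l) \<rho> \<inter> half_space \<subseteq> snd \<kappa> ` fst \<kappa>"
    and c: "0 < c" "\<And>z v. z \<in> cball (snd \<kappa> l) \<rho> \<inter> half_space \<Longrightarrow>
      (c * norm v)\<^sup>2 \<le> gm M \<kappa> (cinv \<kappa> z) v v"
    and g: "piecewise_smooth_curve M \<gamma>" "\<gamma> 1 = l"
    and out: "\<gamma> 0 \<notin> cinv \<kappa> ` (ball (snd \<kappa> l) \<rho> \<inter> half_space)"
  shows "c * \<rho> \<le> curve_length M \<gamma>"
proof -
  let ?x = "snd \<kappa> l"
  let ?N = "cinv \<kappa> ` (ball ?x \<rho> \<inter> half_space)" and ?C = "cinv \<kappa> ` (cball ?x \<rho> \<inter> half_space)"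
  have cg: "continuous_on {0..1} \<gamma>" using g by (simp add: piecewise_smooth_curve_def)
  have sub: "ball ?x \<rho> \<inter> half_space \<subseteq> cball ?x \<rho> \<inter> half_space" by auto
  have xb: "?x \<in> half_space" using relopen_half_space[OF adm_facts(2)[OF k]] l by auto
  have N: "open ?N"
    by (rule chart_cinv_open[OF adm_chart[OF k]])
      (use C sub in \<open>auto simp: openin_open Int_commute\<close>)
  have Ccl: "closed ?C"
    by (intro compact_imp_closed compact_continuous_image continuous_on_subset[OF adm_facts(7)[OF k] C]
        compact_Int_closed closed_half_space compact_cball)
  have lN: "l \<in> ?N" using l \<rho> xb adm_facts(3)[OF k l] by (intro image_eqI[of _ _ ?x]) auto
  \<comment> \<open>The times spent outside the ball. This set is closed because the ball is open in
    \<open>M\<close>, so the last such time \<open>s0\<close> is attained and the curve is then at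
    coordinate distance exactly or more than \<open>\<rho>\<close>.\<close>
  define S where "S = {0..1} \<inter> \<gamma> -` (- ?N)"
  have Scl: "closed S" unfolding S_def
    by (rule continuous_closed_preimage[OF cg]) (use N in auto)
  have S0: "0 \<in> S" using out by (simp add: S_def)
  have Sb: "bdd_above S" by (auto simp: S_def)
  define s0 where "s0 = Sup S"
  have s0: "s0 \<in> S" unfolding s0_def using closed_contains_Sup[OF _ Sb Scl] S0 by auto
  have s01: "0 \<le> s0" "s0 < 1"
    using s0 lN g(2) by (auto simp: S_def order_less_le)
  have inN: "\<gamma> s \<in> ?N" if "s0 < s" "s \<le> 1" for s
    using that cSup_upper[OF _ Sb, of s] s01 by (fastforce simp: S_def s0_def)
  have "\<gamma> s0 \<in> ?C"
  proof -
    have "s0 \<in> closure {s0<..1}" using s01 by simp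
    moreover have "continuous_on (closure {s0<..1}) \<gamma>"
      by (rule continuous_on_subset[OF cg]) (use s01 in simp)
    moreover have "\<gamma> ` {s0<..1} \<subseteq> ?C" using inN sub by fastforce
    ultimately show ?thesis using image_closure_subset[of "{s0<..1}" \<gamma> ?C] Ccl by blast
  qed
  then have inC: "\<gamma> s \<in> ?C" if "s0 \<le> s" "s \<le> 1" for s
    using subsetD[OF image_mono[OF sub] inN[OF _ that(2)]] that(1) by (cases "s = s0") auto
  have inUC: "\<gamma> s \<in> fst \<kappa> \<and> snd \<kappa> (\<gamma> s) \<in> cball ?x \<rho> \<inter> half_space" if s: "s0 \<le> s" "s \<le> 1" for s
  proof -
    obtain z where z: "z \<in> cball ?x \<rho> \<inter> half_space" "\<gamma> s = cinv \<kappa> z" using inC[OF s] by (rule imageE)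
    then show ?thesis using adm_facts(4,5)[OF k subsetD[OF C z(1)]] by metis
  qed
  note inU = inUC[THEN conjunct1] and coordC = inUC[THEN conjunct2]
  define h where "h = snd \<kappa> \<circ> \<gamma>"
  have ch: "continuous_on {s0..1} h"
    unfolding h_def o_def
    by (rule continuous_on_compose2[OF adm_facts(6)[OF k] continuous_on_subset[OF cg]]) (use s01 inU in auto)
  have far: "\<rho> \<le> norm (h 1 - h s0)"
  proof -
    have "\<gamma> s0 \<notin> ?N" using s0 by (simp add: S_def)
    then have "snd \<kappa> (\<gamma> s0) \<notin> ball ?x \<rho>"
      using coordC[of s0] s01 inU[of s0] adm_facts(3)[OF k] by (metis IntD2 IntI imageI less_imp_le order_refl)
    then show ?thesis using g(2) by (simp add: h_def dist_norm)
  qed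
  obtain F where F: "finite F"
    "\<And>a b. 0 \<le> a \<Longrightarrow> a < b \<Longrightarrow> b \<le> 1 \<Longrightarrow> {a<..<b} \<inter> F = {} \<Longrightarrow> smooth_into M {a..b} \<gamma>"
    using g(1) unfolding piecewise_smooth_curve_def by blast
  have der: "(h has_vector_derivative vector_derivative h (at s)) (at s) \<and>
      c * norm (vector_derivative h (at s)) \<le> speed M \<gamma> s" if s: "s \<in> {s0<..<1} - F" for s
  proof -
    have "open ({s0<..<1} - F)" using F(1) by (simp add: finite_imp_closed open_Diff)
    then obtain e where e: "0 < e" "cball s e \<subseteq> {s0<..<1} - F"
      using s open_contains_cball_eq by blast
    define a b where "a = s - e" and "b = s + e"
    have ab: "{a..b} \<subseteq> {s0<..<1} - F" "a < s" "s < b"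
      using e by (auto simp: a_def b_def cball_def dist_real_def subset_iff)
    have "a \<in> {a..b}" "b \<in> {a..b}" using ab(2,3) by auto
    then have "a \<in> {s0<..<1}" "b \<in> {s0<..<1}" using ab(1) by blast+
    then have ab': "0 \<le> a" "b \<le> 1" using s01 by auto
    have disj: "{a<..<b} \<inter> F = {}" using ab(1) greaterThanLessThan_subseteq_atLeastAtMost_iff[of a b a b] by auto
    have "a < b" using ab by simp
    note sm = smooth_into_adm[OF F(2)[OF ab'(1) this ab'(2) disj] k]
    have ABU: "{a..b} \<inter> \<gamma> -` fst \<kappa> = {a..b}" using ab inU by (force simp: subset_iff)
    have "s \<in> {a..b}" using ab by auto
    then obtain U G where e: "smooth_extension {a..b} (snd \<kappa> \<circ> \<gamma>) s U G"
      using smooth_on_extension[OF sm[unfolded ABU]] by metis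
    from interval_derivative[OF e openin_subtopology_self \<open>s \<in> {a..b}\<close>] obtain w where
      "((snd \<kappa> \<circ> \<gamma>) has_vector_derivative w) (at s within {a..b})" by blast
    then have w: "(h has_vector_derivative w) (at s)"
      using ab by (simp add: h_def at_within_Icc_at)
    have "s0 \<le> s" "s \<le> 1" "s \<in> {0..1}" using s s01 by auto
    note sU = inU[OF this(1,2)]
    have "speed M \<gamma> s = sqrt (gm M \<kappa> (\<gamma> s) w w)"
      by (rule speed_chart[OF k \<open>s \<in> {0..1}\<close> sU cg has_vector_derivative_at_within[OF w[unfolded h_def]]])
    moreover have "(c * norm w)\<^sup>2 \<le> gm M \<kappa> (\<gamma> s) w w"
      using c(2)[OF coordC[OF \<open>s0 \<le> s\<close> \<open>s \<le> 1\<close>], of w] adm_facts(3)[OF k sU] by simp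
    ultimately have "c * norm w \<le> speed M \<gamma> s" by (simp add: real_le_rsqrt)
    then show ?thesis using w vector_derivative_at[OF w] by simp
  qed
  \<comment> \<open>At break points and end points \<open>vector_derivative\<close> has no
    controlled value. Setting it to 0 there makes the pointwise estimate hold everywhere without
    changing the integral.\<close>
  define h' where "h' s = (if s \<in> F \<union> {s0, 1} then 0 else vector_derivative h (at s))" for s
  have "((\<lambda>s. vector_derivative h (at s)) has_integral (h 1 - h s0)) {s0..1}"
    by (rule fundamental_theorem_of_calculus_interior_strong[OF F(1)]) (use s01 der ch in auto)
  then have hI: "(h' has_integral (h 1 - h s0)) {s0..1}"
    by (rule has_integral_spike_finite[where S = "F \<union> {s0,1}", rotated 2])
      (use F(1) in \<open>auto simp: h'_def\<close>)
  have si: "speed M \<gamma> integrable_on {s0..1}" "speed M \<gamma> integrable_on {0..s0}" "speed M \<gamma> integrable_on {0..1}"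
    using speed_integrable[OF g(1)] s01 by auto
  have "norm (integral {s0..1} h') \<le> integral {s0..1} (\<lambda>s. speed M \<gamma> s / c)"
  proof (rule integral_norm_bound_integral)
    show "h' integrable_on {s0..1}" using hI by blast
    show "(\<lambda>s. speed M \<gamma> s / c) integrable_on {s0..1}"
      using integrable_cmul[OF si(1), of "1 / c"] by (simp add: divide_inverse mult.commute)
    fix s assume "s \<in> {s0..1}"
    then show "norm (h' s) \<le> speed M \<gamma> s / c"
      using der[of s] c(1) speed_nonneg[of \<gamma> s] by (auto simp: h'_def field_simps)
  qed
  then have "\<rho> \<le> integral {s0..1} (\<lambda>s. speed M \<gamma> s / c)"
    using far integral_unique[OF hI] by simp
  also have "\<dots> = integral {s0..1} (speed M \<gamma>) / c" by simp
  finally have "c * \<rho> \<le> integral {s0..1} (speed M \<gamma>)" using c(1) by (simp add: field_simps)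
  also have "\<dots> \<le> integral {0..s0} (speed M \<gamma>) + integral {s0..1} (speed M \<gamma>)"
    using integral_nonneg[OF si(2)] speed_nonneg by simp
  also have "\<dots> = curve_length M \<gamma>"
    unfolding curve_length_speed using s01 si(3) by (intro Henstock_Kurzweil_Integration.integral_combine) auto
  finally show ?thesis .
qed

text \<open>This links the limits provided by \<open>complete_manifold\<close> with the topology. A
  curve to \<open>l\<close> shorter than \<open>c * \<rho>\<close> cannot start outside the
  coordinate ball of radius \<open>\<rho>\<close>, and \<open>\<rho>\<close> is chosen so small that
  this ball lies in \<open>W\<close>.\<close>

lemma rdist_tendsto_imp_tendsto:
  assumes "(\<lambda>n. rdist M (X n) l) \<longlonglongrightarrow> 0"
  shows "X \<longlonglongrightarrow> l"
proof (rule topological_tendstoI)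
  fix W assume W: "open W" "l \<in> W"
  obtain \<kappa> where k0: "\<kappa> \<in> atlas M" "l \<in> fst \<kappa>" by (rule atlas_cover)
  note k = atlas_adm[OF k0(1)] and l = k0(2)
  obtain V where V: "open V" "snd \<kappa> ` (W \<inter> fst \<kappa>) = half_space \<inter> V"
    using chart_relopen[OF adm_chart[OF k] W(1)] by (auto simp: openin_open)
  have "snd \<kappa> l \<in> V" using V l W by blast
  then obtain \<rho> where \<rho>: "0 < \<rho>" "cball (snd \<kappa> l) \<rho> \<subseteq> V"
    using V(1) open_contains_cball_eq by blast
  let ?C = "cball (snd \<kappa> l) \<rho> \<inter> half_space"
  have C1: "?C \<subseteq> snd \<kappa> ` (W \<inter> fst \<kappa>)" using V \<rho> by auto
  then have C: "?C \<subseteq> snd \<kappa> ` fst \<kappa>" by auto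
  have cC: "compact ?C" by (intro compact_Int_closed compact_cball closed_half_space)
  obtain c D where c: "0 < c" "\<And>z v. z \<in> ?C \<Longrightarrow> (c * norm v)\<^sup>2 \<le> gm M \<kappa> (cinv \<kappa> z) v v"
    using gm_bounds[OF k cC C] by metis
  have NW: "cinv \<kappa> ` (ball (snd \<kappa> l) \<rho> \<inter> half_space) \<subseteq> W"
    using C1 adm_facts(3)[OF k] by (force simp: subset_iff)
  have "eventually (\<lambda>n. rdist M (X n) l < ereal (c * \<rho>)) sequentially"
    using order_tendstoD(2)[OF assms, of "ereal (c * \<rho>)"] c(1) \<rho>(1) by (simp add: zero_ereal_def)
  then show "eventually (\<lambda>n. X n \<in> W) sequentially"
  proof eventually_elim
    case (elim n)
    then obtain \<gamma> where g: "piecewise_smooth_curve M \<gamma>" "\<gamma> 0 = X n" "\<gamma> 1 = l" "curve_length M \<gamma> < c * \<rho>"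
      by (auto simp: rdist_def INF_less_iff)
    show ?case
    proof (rule ccontr)
      assume "X n \<notin> W"
      then have "\<gamma> 0 \<notin> cinv \<kappa> ` (ball (snd \<kappa> l) \<rho> \<inter> half_space)" using NW g(2) by auto
      from curve_length_lower_bound[OF k l \<rho>(1) C c g(1,3) this] g(4) show False by simp
    qed
  qed
qed

end


section \<open>Collars of complete manifolds\<close>

lemma convex_half_space: "convex (half_space :: 'v::euclidean_space set)"
  using convex_halfspace_ge[of 0 "bdir :: 'v"]
  by (simp add: half_space_def inner_commute)

lemma smooth_into_subset:
  assumes f: "smooth_into M S f" and T: "T \<subseteq> S"
  shows "smooth_into M T f"
  unfolding smooth_into_def
proof (intro conjI ballI)
  show "continuous_on T f" using f T continuous_on_subset by (auto simp: smooth_into_def)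
  fix \<kappa> assume "\<kappa> \<in> atlas M"
  then have "smooth_on (S \<inter> f -` fst \<kappa>) (snd \<kappa> \<circ> f)" using f by (simp add: smooth_into_def)
  then show "smooth_on (T \<inter> f -` fst \<kappa>) (snd \<kappa> \<circ> f)"
    by (rule smooth_on_subset) (use T in auto)
qed

section \<open>Collar coordinates and collar charts\<close>

locale collar = riem_mfd M
  for M :: "('m::{t2_space,second_countable_topology}, 'v::euclidean_space) riem" +
  fixes r :: real and \<iota> :: "real \<Rightarrow> 'm \<Rightarrow> 'm"
  assumes complete: "complete_manifold M"
    and isometric: "isometric_collar M r \<iota>"
begin

definition Z :: "'m set" where
  "Z = (\<lambda>(t, y). \<iota> t y) ` ({0..<r} \<times> bdry M)"

text \<open>With \<open>yc\<close> below, the coordinates \<open>(t, y)\<close> of a point of the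
  collar. Outside \<open>Z\<close> both values are arbitrary.\<close>

definition tc :: "'m \<Rightarrow> real" where "tc p = fst (collar_coords M r \<iota> p)"

definition yc :: "'m \<Rightarrow> 'm" where "yc p = snd (collar_coords M r \<iota> p)"

abbreviation coll :: "real \<times> 'm \<Rightarrow> 'm" where
  "coll \<equiv> \<lambda>(t, y). \<iota> t y"

abbreviation cc :: "('m, 'v) chart \<Rightarrow> ('m, 'v) chart" where
  "cc \<equiv> collar_chart M r \<iota>"

lemma r_pos: "0 < r"
  using isometric by (simp add: isometric_collar_def)

lemma collar_inj: "inj_on coll ({0..<r} \<times> bdry M)"
  using isometric by (simp add: isometric_collar_def)

lemma iota_0: "y \<in> bdry M \<Longrightarrow> \<iota> 0 y = y"
  using isometric by (simp add: isometric_collar_def)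

lemma coords_iota:
  assumes "0 \<le> t" "t < r" "y \<in> bdry M"
  shows "tc (\<iota> t y) = t" "yc (\<iota> t y) = y" "\<iota> t y \<in> Z"
proof -
  have "(t, y) \<in> {0..<r} \<times> bdry M" using assms by auto
  from inv_into_f_f[OF collar_inj this]
  show "tc (\<iota> t y) = t" "yc (\<iota> t y) = y" by (auto simp: tc_def yc_def collar_coords_def)
  show "\<iota> t y \<in> Z" using assms by (auto simp: Z_def)
qed

lemma Z_coords:
  assumes "p \<in> Z"
  shows "0 \<le> tc p" "tc p < r" "yc p \<in> bdry M" "\<iota> (tc p) (yc p) = p"
proof -
  obtain t y where "0 \<le> t" "t < r" "y \<in> bdry M" "p = \<iota> t y" using assms by (auto simp: Z_def)
  then show "0 \<le> tc p" "tc p < r" "yc p \<in> bdry M" "\<iota> (tc p) (yc p) = p"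
    using coords_iota[of t y] by auto
qed

lemma bdry_Z: "y \<in> bdry M \<Longrightarrow> y \<in> Z" "y \<in> bdry M \<Longrightarrow> tc y = 0" "y \<in> bdry M \<Longrightarrow> yc y = y"
  using coords_iota[of 0 y] r_pos iota_0 by auto

lemma fst_cc: "p \<in> fst (cc \<kappa>) \<longleftrightarrow> p \<in> Z \<and> yc p \<in> fst \<kappa>"
proof
  assume "p \<in> fst (cc \<kappa>)"
  then obtain t y where "0 \<le> t" "t < r" "y \<in> bdry M" "y \<in> fst \<kappa>" "p = \<iota> t y"
    by (auto simp: collar_chart_def collar_over_def)
  then show "p \<in> Z \<and> yc p \<in> fst \<kappa>" using coords_iota[of t y] by auto
next
  assume p: "p \<in> Z \<and> yc p \<in> fst \<kappa>"
  have "coll (tc p, yc p) \<in> fst (cc \<kappa>)"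
    unfolding collar_chart_def collar_over_def fst_conv
    by (rule imageI) (use p Z_coords in auto)
  then show "p \<in> fst (cc \<kappa>)" using p Z_coords(4) by simp
qed

lemma snd_cc: "snd (cc \<kappa>) p = snd \<kappa> (yc p) + tc p *\<^sub>R bdir"
  by (simp add: collar_chart_def tc_def yc_def split_def Let_def)

lemma adm_cc: "\<kappa> \<in> atlas M \<Longrightarrow> adm M (cc \<kappa>)"
  using isometric by (simp add: isometric_collar_def adm_def)

text \<open>Charts send boundary points to vectors orthogonal to \<open>bdir\<close>, so the two
  summands of a collar chart can be separated. This reduces continuity and smoothness of
  \<open>tc\<close> and \<open>yc\<close> to linear maps of coordinates.\<close>

lemma cc_inner_tang:
  assumes k: "\<kappa> \<in> atlas M" and p: "p \<in> fst (cc \<kappa>)"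
  shows "snd (cc \<kappa>) p \<bullet> bdir = tc p" "tang (snd (cc \<kappa>) p) = snd \<kappa> (yc p)"
proof -
  have "yc p \<in> fst \<kappa>" "yc p \<in> bdry M" using p fst_cc Z_coords(3) by auto
  then have "snd \<kappa> (yc p) \<bullet> bdir = 0" using bdry_iff[OF atlas_adm[OF k]] by blast
  then show "snd (cc \<kappa>) p \<bullet> bdir = tc p" "tang (snd (cc \<kappa>) p) = snd \<kappa> (yc p)"
    by (auto simp: snd_cc inner_add_left tang_add_bdir tang_id)
qed

lemma cc_cover:
  assumes "p \<in> Z"
  obtains \<kappa> where "\<kappa> \<in> atlas M" "p \<in> fst (cc \<kappa>)" "yc p \<in> fst \<kappa>"
proof -
  obtain \<kappa> where "\<kappa> \<in> atlas M" "yc p \<in> fst \<kappa>" by (rule atlas_cover)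
  then show thesis using that fst_cc assms by blast
qed

lemma open_Z: "open Z"
proof (subst open_subopen, rule ballI)
  fix p assume p: "p \<in> Z"
  then obtain \<kappa> where k: "\<kappa> \<in> atlas M" "p \<in> fst (cc \<kappa>)" using cc_cover by metis
  have "fst (cc \<kappa>) \<subseteq> Z" using fst_cc by blast
  then show "\<exists>T. open T \<and> p \<in> T \<and> T \<subseteq> Z"
    using adm_facts(1)[OF adm_cc[OF k(1)]] k(2) by blast
qed

lemma continuous_tc_yc: "continuous_on Z tc" "continuous_on Z yc"
proof -
  have "isCont tc p \<and> isCont yc p" if p: "p \<in> Z" for p
  proof -
    obtain \<kappa> where k: "\<kappa> \<in> atlas M" "p \<in> fst (cc \<kappa>)" "yc p \<in> fst \<kappa>" using cc_cover[OF p] .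
    note a = adm_cc[OF k(1)] and b = atlas_adm[OF k(1)]
    note o = adm_facts(1)[OF a] and c = adm_facts(6)[OF a]
    have "continuous_on (fst (cc \<kappa>)) (\<lambda>q. snd (cc \<kappa>) q \<bullet> bdir)"
      by (intro continuous_intros c)
    then have "continuous_on (fst (cc \<kappa>)) tc"
      by (rule continuous_on_eq) (use cc_inner_tang[OF k(1)] in auto)
    moreover have "continuous_on (fst (cc \<kappa>)) (\<lambda>q. cinv \<kappa> (tang (snd (cc \<kappa>) q)))"
      by (rule continuous_on_compose2[OF adm_facts(7)[OF b] bounded_linear.continuous_on[OF bounded_linear_tang c]])
        (auto simp: cc_inner_tang(2)[OF k(1)] fst_cc)
    then have "continuous_on (fst (cc \<kappa>)) yc"
      by (rule continuous_on_eq) (auto simp: cc_inner_tang(2)[OF k(1)] fst_cc adm_facts(3)[OF b])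
    ultimately show ?thesis using o k(2) by (auto simp: continuous_on_eq_continuous_at)
  qed
  then show "continuous_on Z tc" "continuous_on Z yc"
    by (auto intro: continuous_at_imp_continuous_on)
qed

text \<open>Nothing is postulated about continuity of \<open>\<iota>\<close> itself. Locally it is
  the inverse of a collar chart applied to \<open>snd \<kappa> y + t *\<^sub>R bdir\<close>.\<close>

lemma continuous_iota: "continuous_on ({0..<r} \<times> bdry M) coll"
  unfolding continuous_on_eq_continuous_within
proof
  fix x assume x: "x \<in> {0..<r} \<times> bdry M"
  obtain t y where ty: "x = (t, y)" "0 \<le> t" "t < r" "y \<in> bdry M" using x by auto
  obtain \<kappa> where k: "\<kappa> \<in> atlas M" "y \<in> fst \<kappa>" by (rule atlas_cover)
  note a = adm_cc[OF k(1)] and b = atlas_adm[OF k(1)]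
  let ?S = "{0..<r} \<times> (fst \<kappa> \<inter> bdry M)"
  have e: "\<iota> s q \<in> fst (cc \<kappa>)" "snd (cc \<kappa>) (\<iota> s q) = snd \<kappa> q + s *\<^sub>R bdir"
    if "(s, q) \<in> ?S" for s q
    using that coords_iota[of s q] by (auto simp: fst_cc snd_cc)
  have im: "snd \<kappa> q + s *\<^sub>R bdir \<in> snd (cc \<kappa>) ` fst (cc \<kappa>)" if "(s, q) \<in> ?S" for s q
    using e[OF that] by (metis imageI)
  have "continuous_on ?S (\<lambda>p. snd \<kappa> (snd p) + fst p *\<^sub>R bdir)"
    by (intro continuous_intros continuous_on_compose2[OF adm_facts(6)[OF b]]) auto
  from continuous_on_compose2[OF adm_facts(7)[OF a] this]
  have "continuous_on ?S (\<lambda>p. cinv (cc \<kappa>) (snd \<kappa> (snd p) + fst p *\<^sub>R bdir))"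
    using im by (auto simp: image_subset_iff)
  then have "continuous_on ?S coll"
    by (rule continuous_on_eq) (use e adm_facts(3)[OF a] in \<open>fastforce simp: split_def\<close>)
  moreover have "x \<in> ?S" using ty k by auto
  ultimately have "continuous (at x within ?S) coll"
    by (auto simp: continuous_on_eq_continuous_within)
  moreover have "at x within ?S = at x within ({0..<r} \<times> bdry M)"
    using adm_facts(1)[OF b] \<open>x \<in> ?S\<close> by (intro at_within_nhd[of x "UNIV \<times> fst \<kappa>"] open_Times) auto
  ultimately show "continuous (at x within ({0..<r} \<times> bdry M)) coll" by simp
qed

lemma gm_collar:
  assumes k: "\<kappa> \<in> atlas M" and p: "p \<in> fst (cc \<kappa>)"
  shows "gm M (cc \<kappa>) p w w = (w \<bullet> bdir)\<^sup>2 + gm M \<kappa> (yc p) (tang w) (tang w)"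
proof -
  have y: "yc p \<in> bdry M \<inter> fst \<kappa>" "tc p \<in> {0..<r}" "\<iota> (tc p) (yc p) = p"
    using p fst_cc Z_coords[of p] by auto
  have "\<forall>y\<in>bdry M \<inter> fst \<kappa>. \<forall>t\<in>{0..<r}. \<forall>v w.
      rmetric M (\<iota> t y) (tvec M (cc \<kappa>) (\<iota> t y) v) (tvec M (cc \<kappa>) (\<iota> t y) w) =
      (v \<bullet> bdir) * (w \<bullet> bdir) + rmetric M y (tvec M \<kappa> y (tang v)) (tvec M \<kappa> y (tang w))"
    using isometric k by (simp add: isometric_collar_def)
  from this[rule_format, OF y(1,2), of w w] show ?thesis
    by (simp add: y(3) gm_def power2_eq_square)
qed

text \<open>Since the metric on the collar is a product, neither coordinate moves faster than the curve.\<close>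

lemma collar_curve_derivatives:
  assumes s: "smooth_into M {0..1} \<delta>" and Z: "\<delta> ` {0..1} \<subseteq> Z" and u: "u \<in> {0..1}"
  shows "speed M (yc \<circ> \<delta>) u \<le> speed M \<delta> u"
    and "\<exists>w. ((tc \<circ> \<delta>) has_field_derivative w) (at u within {0..1}) \<and> \<bar>w\<bar> \<le> speed M \<delta> u"
proof -
  have c: "continuous_on {0..1} \<delta>" using s by (simp add: smooth_into_def)
  have uZ: "\<delta> u \<in> Z" using Z u by auto
  obtain \<kappa> where k: "\<kappa> \<in> atlas M" "\<delta> u \<in> fst (cc \<kappa>)" "yc (\<delta> u) \<in> fst \<kappa>" using cc_cover[OF uZ] .
  note a = adm_cc[OF k(1)] and b = atlas_adm[OF k(1)]
  let ?A = "{0..1} \<inter> \<delta> -` fst (cc \<kappa>)"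
  have A: "openin (top_of_set {0..1}) ?A"
    using c adm_facts(1)[OF a] by (simp add: continuous_openin_preimage_gen)
  have uA: "u \<in> ?A" using u k by auto
  obtain T where T: "open T" "?A = {0..1} \<inter> T" using A by (auto simp: openin_open)
  have at: "at u within ?A = at u within {0..1}"
    using T uA by (intro at_within_nhd[of u T]) auto
  obtain U F where "smooth_extension ?A (snd (cc \<kappa>) \<circ> \<delta>) u U F"
    by (rule smooth_on_extension[OF smooth_into_adm[OF s a] uA])
  from interval_derivative[OF this A uA] obtain w where
    w: "((snd (cc \<kappa>) \<circ> \<delta>) has_vector_derivative w) (at u within {0..1})" by blast
  have sp: "speed M \<delta> u = sqrt (gm M (cc \<kappa>) (\<delta> u) w w)"
    by (rule speed_chart[OF a u k(2) c w])
  have g: "gm M (cc \<kappa>) (\<delta> u) w w = (w \<bullet> bdir)\<^sup>2 + gm M \<kappa> (yc (\<delta> u)) (tang w) (tang w)"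
    by (rule gm_collar[OF k(1,2)])
  have yc: "continuous_on {0..1} (yc \<circ> \<delta>)"
    unfolding o_def by (rule continuous_on_compose2[OF continuous_tc_yc(2) c Z])
  have wA: "((snd (cc \<kappa>) \<circ> \<delta>) has_vector_derivative w) (at u within ?A)" using w by (simp add: at)
  have "((\<lambda>x. tang ((snd (cc \<kappa>) \<circ> \<delta>) x)) has_vector_derivative tang w) (at u within ?A)"
    by (rule bounded_linear.has_vector_derivative[OF bounded_linear_tang wA])
  then have "((snd \<kappa> \<circ> (yc \<circ> \<delta>)) has_vector_derivative tang w) (at u within ?A)"
    unfolding has_vector_derivative_def
    by (rule has_derivative_transform[OF uA, rotated]) (auto simp: cc_inner_tang(2)[OF k(1)])
  then have "speed M (yc \<circ> \<delta>) u = sqrt (gm M \<kappa> ((yc \<circ> \<delta>) u) (tang w) (tang w))"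
    unfolding at using k(3) by (intro speed_chart[OF b u _ yc]) auto
  then show "speed M (yc \<circ> \<delta>) u \<le> speed M \<delta> u" by (simp add: sp g)
  have "((\<lambda>x. (snd (cc \<kappa>) \<circ> \<delta>) x \<bullet> bdir) has_vector_derivative w \<bullet> bdir) (at u within ?A)"
    by (rule bounded_linear.has_vector_derivative[OF bounded_linear_inner_left wA])
  then have "((tc \<circ> \<delta>) has_vector_derivative w \<bullet> bdir) (at u within ?A)"
    unfolding has_vector_derivative_def
    by (rule has_derivative_transform[OF uA, rotated]) (auto simp: cc_inner_tang(1)[OF k(1)])
  moreover have "0 \<le> gm M \<kappa> (yc (\<delta> u)) (tang w) (tang w)" by (simp add: gm_def rmetric_nonneg)
  then have "\<bar>w \<bullet> bdir\<bar> \<le> speed M \<delta> u"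
    unfolding sp g by (intro real_le_rsqrt) simp
  ultimately show "\<exists>w. ((tc \<circ> \<delta>) has_field_derivative w) (at u within {0..1}) \<and> \<bar>w\<bar> \<le> speed M \<delta> u"
    by (auto simp: has_real_derivative_iff_has_vector_derivative at)
qed

lemma smooth_into_yc:
  assumes s: "smooth_into M S \<delta>" and Z: "\<delta> ` S \<subseteq> Z"
  shows "smooth_into M S (yc \<circ> \<delta>)"
proof (rule smooth_intoI)
  have c: "continuous_on S \<delta>" using s by (simp add: smooth_into_def)
  show "continuous_on S (yc \<circ> \<delta>)"
    unfolding o_def by (rule continuous_on_compose2[OF continuous_tc_yc(2) c Z])
  fix x assume x: "x \<in> S"
  then have "\<delta> x \<in> Z" using Z by auto
  then obtain \<kappa> where k: "\<kappa> \<in> atlas M" "\<delta> x \<in> fst (cc \<kappa>)" using cc_cover by metis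
  note a = adm_cc[OF k(1)] and b = atlas_adm[OF k(1)]
  obtain W where W: "open W" "S \<inter> W = S \<inter> \<delta> -` fst (cc \<kappa>)"
    using c adm_facts(1)[OF a] by (auto simp: continuous_on_open_invariant Int_commute)
  have "smooth_on (S \<inter> W) (tang \<circ> (snd (cc \<kappa>) \<circ> \<delta>))"
    unfolding W(2)
    by (rule smooth_on_compose[OF smooth_into_adm[OF s a] smooth_on_linear[OF bounded_linear_tang, of UNIV]]) auto
  then have "smooth_on (S \<inter> W) (snd \<kappa> \<circ> (yc \<circ> \<delta>))"
    unfolding W(2) by (rule smooth_on_cong) (auto simp: cc_inner_tang(2)[OF k(1)])
  moreover have "x \<in> W" using W(2) x k by blast
  moreover have "(yc \<circ> \<delta>) ` (S \<inter> W) \<subseteq> fst \<kappa>" unfolding W(2) using fst_cc[of _ \<kappa>] by auto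
  ultimately show "\<exists>\<kappa> W. adm M \<kappa> \<and> open W \<and> x \<in> W \<and> (yc \<circ> \<delta>) ` (S \<inter> W) \<subseteq> fst \<kappa> \<and>
      smooth_on (S \<inter> W) (snd \<kappa> \<circ> (yc \<circ> \<delta>))"
    using b W(1) by blast
qed

text \<open>A uniform bound on the speed replaces the length. It gives the bound for the projection
  by integration and the one for the collar coordinate by the mean value inequality.\<close>

lemma collar_curve_bounds:
  assumes s: "smooth_into M {0..1} \<delta>" and Z: "\<delta> ` {0..1} \<subseteq> Z"
    and B: "\<And>u. u \<in> {0..1} \<Longrightarrow> speed M \<delta> u \<le> B" "0 \<le> B"
  shows "rdist M (yc (\<delta> 0)) (yc (\<delta> 1)) \<le> ereal B"
    and "\<bar>tc (\<delta> 1) - tc (\<delta> 0)\<bar> \<le> B"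
proof -
  have y: "smooth_into M {0..1} (yc \<circ> \<delta>)" by (rule smooth_into_yc[OF s Z])
  have "smooth_into M {a..b} (yc \<circ> \<delta>)" if "0 \<le> a" "b \<le> 1" for a b :: real
    by (rule smooth_into_subset[OF y]) (use that in auto)
  then have p: "piecewise_smooth_curve M (yc \<circ> \<delta>)"
    using y by (auto simp: piecewise_smooth_curve_def smooth_into_def)
  have "curve_length M (yc \<circ> \<delta>) \<le> integral {0..1} (\<lambda>u::real. B)"
    unfolding curve_length_speed
    by (rule integral_le[OF speed_integrable[OF p]])
      (use collar_curve_derivatives(1)[OF s Z] B(1) in \<open>auto intro: order_trans\<close>)
  then have "curve_length M (yc \<circ> \<delta>) \<le> B" by simp
  then show "rdist M (yc (\<delta> 0)) (yc (\<delta> 1)) \<le> ereal B"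
    unfolding rdist_def by (intro INF_lower2[of "yc \<circ> \<delta>"]) (use p in auto)
  have "\<forall>u\<in>{0..1}. \<exists>w. ((tc \<circ> \<delta>) has_field_derivative w) (at u within {0..1}) \<and> \<bar>w\<bar> \<le> B"
    using collar_curve_derivatives(2)[OF s Z] B(1) by (meson order_trans)
  then obtain w where w: "\<And>u. u \<in> {0..1} \<Longrightarrow> ((tc \<circ> \<delta>) has_field_derivative w u) (at u within {0..1})"
    "\<And>u. u \<in> {0..1} \<Longrightarrow> \<bar>w u\<bar> \<le> B" by metis
  have "norm ((tc \<circ> \<delta>) 1 - (tc \<circ> \<delta>) 0) \<le> B * norm (1 - 0 :: real)"
    unfolding o_def
    by (rule field_differentiable_bound[of "{0..1::real}"]) (use w[unfolded o_def] in auto)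
  then show "\<bar>tc (\<delta> 1) - tc (\<delta> 0)\<bar> \<le> B" by simp
qed

text \<open>A coordinate segment has the constant coordinate velocity \<open>b - a\<close>, and
  convexity keeps it in \<open>C\<close>. Hence \<open>D * norm (b - a)\<close> bounds its
  Riemannian speed.\<close>

lemma chart_segment_bounds:
  assumes k: "adm M \<kappa>" and C: "convex C" "C \<subseteq> snd \<kappa> ` fst \<kappa>"
    and D: "0 < D" "\<And>z v. z \<in> C \<Longrightarrow> gm M \<kappa> (cinv \<kappa> z) v v \<le> (D * norm v)\<^sup>2"
    and ab: "a \<in> C" "b \<in> C" and Z: "cinv \<kappa> ` closed_segment a b \<subseteq> Z"
  shows "rdist M (yc (cinv \<kappa> a)) (yc (cinv \<kappa> b)) \<le> ereal (D * norm (b - a))"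
    and "\<bar>tc (cinv \<kappa> b) - tc (cinv \<kappa> a)\<bar> \<le> D * norm (b - a)"
proof -
  define \<sigma> where "\<sigma> u = a + u *\<^sub>R (b - a)" for u :: real
  have seg: "\<sigma> u \<in> closed_segment a b" if "u \<in> {0..1}" for u
    using that unfolding \<sigma>_def closed_segment_def
    by (intro CollectI exI[of _ u]) (auto simp: algebra_simps)
  have sC: "\<sigma> u \<in> C" if "u \<in> {0..1}" for u
    using seg[OF that] closed_segment_subset[OF ab C(1)] by auto
  have im: "\<sigma> u \<in> snd \<kappa> ` fst \<kappa>" if "u \<in> {0..1}" for u using sC[OF that] C by auto
  define \<delta> where "\<delta> = cinv \<kappa> \<circ> \<sigma>"
  have s\<sigma>: "smooth_on S \<sigma>" for S
    unfolding \<sigma>_def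
    by (intro smooth_on_add smooth_on_const smooth_on_linear bounded_linear_scaleR_left)
  have c: "continuous_on {0..1} \<delta>"
    unfolding \<delta>_def o_def
    by (rule continuous_on_compose2[OF adm_facts(7)[OF k] smooth_on_continuous[OF s\<sigma>]]) (use im in auto)
  have e: "snd \<kappa> (\<delta> u) = \<sigma> u" "\<delta> u \<in> fst \<kappa>" if "u \<in> {0..1}" for u
    using adm_facts(4,5)[OF k im[OF that]] by (auto simp: \<delta>_def)
  have s: "smooth_into M {0..1} \<delta>"
  proof (rule smooth_intoI_chart[OF k c])
    show "smooth_on {0..1} (snd \<kappa> \<circ> \<delta>)" by (rule smooth_on_cong[OF s\<sigma>]) (use e in auto)
  qed (use e in auto)
  have sp: "speed M \<delta> u \<le> D * norm (b - a)" if u: "u \<in> {0..1}" for u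
  proof -
    have "(\<sigma> has_vector_derivative (b - a)) (at u within {0..1})"
      unfolding \<sigma>_def by (auto intro!: derivative_eq_intros)
    then have "((snd \<kappa> \<circ> \<delta>) has_vector_derivative (b - a)) (at u within {0..1})"
      unfolding has_vector_derivative_def
      by (rule has_derivative_transform[OF u, rotated]) (use e in auto)
    from speed_chart[OF k u e(2)[OF u] c this]
    have "speed M \<delta> u = sqrt (gm M \<kappa> (\<delta> u) (b - a) (b - a))" .
    also have "\<dots> \<le> sqrt ((D * norm (b - a))\<^sup>2)"
      using D(2)[OF sC[OF u], of "b - a"] by (intro real_sqrt_le_mono) (simp add: \<delta>_def)
    finally show ?thesis using D(1) by simp
  qed
  have "\<delta> ` {0..1} \<subseteq> Z" using Z seg by (auto simp: \<delta>_def)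
  note bd = collar_curve_bounds[OF s this sp]
  have "\<delta> 0 = cinv \<kappa> a" "\<delta> 1 = cinv \<kappa> b" by (auto simp: \<delta>_def \<sigma>_def)
  then show "rdist M (yc (cinv \<kappa> a)) (yc (cinv \<kappa> b)) \<le> ereal (D * norm (b - a))"
    "\<bar>tc (cinv \<kappa> b) - tc (cinv \<kappa> a)\<bar> \<le> D * norm (b - a)"
    using bd D(1) by auto
qed

text \<open>The completeness of \<open>M\<close> enters here: a short segment that starts in the lower part of the
  collar cannot leave the collar, because its projection to the boundary would be a curve of finite
  length without an end point.\<close>

lemma closure_collar_part:
  assumes a: "a < r" and p: "p \<in> closure {q \<in> Z. tc q \<le> a}"
  shows "p \<in> Z"
proof (rule ccontr)
  assume pZ: "p \<notin> Z"
  have a0: "0 \<le> a"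
  proof (rule ccontr)
    assume "\<not> 0 \<le> a"
    then have "{q \<in> Z. tc q \<le> a} = {}" using Z_coords(1) by force
    from p[unfolded this] show False by simp
  qed
  obtain \<kappa> where k0: "\<kappa> \<in> atlas M" "p \<in> fst \<kappa>" by (rule atlas_cover)
  note k = atlas_adm[OF k0(1)]
  let ?x = "snd \<kappa> p"
  obtain V where V: "open V" "snd \<kappa> ` fst \<kappa> = half_space \<inter> V"
    using adm_facts(2)[OF k] by (auto simp: openin_open)
  have xV: "?x \<in> V" "?x \<in> half_space" using V k0 by auto
  then obtain \<rho> where \<rho>: "0 < \<rho>" "cball ?x \<rho> \<subseteq> V" using V(1) open_contains_cball_eq by blast
  let ?C = "cball ?x \<rho> \<inter> half_space"
  have C: "?C \<subseteq> snd \<kappa> ` fst \<kappa>" using V \<rho> by auto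
  have cC: "compact ?C" "convex ?C"
    by (auto intro!: compact_Int_closed closed_half_space convex_Int convex_half_space)
  obtain c D where D: "0 < D" "\<And>z v. z \<in> ?C \<Longrightarrow> gm M \<kappa> (cinv \<kappa> z) v v \<le> (D * norm v)\<^sup>2"
    using gm_bounds[OF k cC(1) C] by metis
  \<comment> \<open>Coordinate segments shorter than \<open>\<eta>\<close> change the collar
    coordinate by at most \<open>(r - a) / 2\<close>. Starting from a value at most
    \<open>a\<close>, it then stays below \<open>(r + a) / 2\<close>, away from the open end
    \<open>r\<close>.\<close>
  define \<eta> where "\<eta> = min \<rho> ((r - a) / (2 * D))"
  have \<eta>: "0 < \<eta>" "\<eta> \<le> \<rho>" "D * \<eta> \<le> (r - a) / 2"
    using \<rho>(1) D(1) a by (auto simp: \<eta>_def min_def field_simps)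
  let ?N = "cinv \<kappa> ` (ball ?x \<eta> \<inter> half_space)"
  have NC: "ball ?x \<eta> \<inter> half_space \<subseteq> ?C" using \<eta>(2) by auto
  have N: "open ?N"
    by (rule chart_cinv_open[OF adm_chart[OF k]])
      (use C NC in \<open>auto simp: openin_open Int_commute\<close>)
  have pN: "p \<in> ?N" using adm_facts(3)[OF k k0(2)] \<eta>(1) xV by (intro image_eqI[of _ _ ?x]) auto
  have "?N \<inter> {q \<in> Z. tc q \<le> a} \<noteq> {}"
    using open_Int_closure_eq_empty[OF N] p pN by blast
  then obtain q where q: "q \<in> Z" "tc q \<le> a" "q \<in> ?N" by blast
  obtain z where z: "z \<in> ball ?x \<eta> \<inter> half_space" "q = cinv \<kappa> z" using q(3) by (rule imageE)
  have zC: "z \<in> ?C" and xC: "?x \<in> ?C" using z NC xV \<rho>(1) by auto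
  define \<sigma> where "\<sigma> s = z + s *\<^sub>R (?x - z)" for s :: real
  have \<sigma>C: "\<sigma> s \<in> ?C" if "s \<in> {0..1}" for s
  proof -
    have "\<sigma> s \<in> closed_segment z ?x"
      using that unfolding \<sigma>_def closed_segment_def
      by (intro CollectI exI[of _ s]) (auto simp: algebra_simps)
    then show ?thesis using closed_segment_subset[OF zC xC cC(2)] by blast
  qed
  define \<gamma> where "\<gamma> s = cinv \<kappa> (\<sigma> s)" for s
  have c\<sigma>: "continuous_on S \<sigma>" for S unfolding \<sigma>_def by (intro continuous_intros)
  have c\<gamma>: "continuous_on {0..1} \<gamma>"
    unfolding \<gamma>_def by (rule continuous_on_compose2[OF adm_facts(7)[OF k] c\<sigma>]) (use \<sigma>C C in blast)
  \<comment> \<open>The segment runs from \<open>q\<close> in the collar to \<open>p\<close>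
    outside. Since \<open>Z\<close> is open, the first time \<open>s\<close> outside
    \<open>Z\<close> exists, and all earlier times lie in the collar.\<close>
  define S where "S = {0..1} \<inter> \<gamma> -` (- Z)"
  have Scl: "closed S" unfolding S_def
    by (rule continuous_closed_preimage[OF c\<gamma>]) (use open_Z in auto)
  have "\<gamma> 1 = p" using adm_facts(3)[OF k k0(2)] by (simp add: \<gamma>_def \<sigma>_def)
  then have S1: "1 \<in> S" using pZ by (simp add: S_def)
  have Sb: "bdd_below S" by (auto simp: S_def)
  define s where "s = Inf S"
  have sS: "s \<in> S" unfolding s_def using closed_contains_Inf[OF _ Sb Scl] S1 by auto
  have "\<gamma> 0 = q" by (simp add: \<gamma>_def \<sigma>_def z)
  then have "s \<noteq> 0" using sS q(1) by (auto simp: S_def)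
  then have s: "0 < s" "s \<le> 1" "\<gamma> s \<notin> Z" using sS by (auto simp: S_def)
  have inZ: "\<gamma> u \<in> Z" if "0 \<le> u" "u < s" for u
    using cInf_lower[OF _ Sb, of u] that s(2) by (fastforce simp: S_def s_def)
  define L where "L = norm (?x - z)"
  have L: "0 \<le> L" "L < \<eta>" using z by (auto simp: L_def dist_norm)
  have diff: "norm (\<sigma> v - \<sigma> u) = \<bar>v - u\<bar> * L" for u v
  proof -
    have "\<sigma> v - \<sigma> u = (v - u) *\<^sub>R (?x - z)" by (simp add: \<sigma>_def algebra_simps)
    then show ?thesis by (simp add: L_def)
  qed
  \<comment> \<open>Pieces of the segment before time \<open>s\<close> stay in \<open>Z\<close>, so
    the projection and the collar coordinate are Lipschitz in the parameter on
    \<open>[0, s)\<close>.\<close>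
  have bounds: "rdist M (yc (\<gamma> u)) (yc (\<gamma> v)) \<le> ereal (D * L * \<bar>v - u\<bar>)"
    "\<bar>tc (\<gamma> v) - tc (\<gamma> u)\<bar> \<le> D * L * \<bar>v - u\<bar>" if uv: "0 \<le> u" "u < s" "0 \<le> v" "v < s" for u v
  proof -
    have "cinv \<kappa> ` closed_segment (\<sigma> u) (\<sigma> v) \<subseteq> Z"
    proof
      fix y assume "y \<in> cinv \<kappa> ` closed_segment (\<sigma> u) (\<sigma> v)"
      then obtain t where t: "0 \<le> t" "t \<le> 1" "y = cinv \<kappa> ((1 - t) *\<^sub>R \<sigma> u + t *\<^sub>R \<sigma> v)"
        by (auto simp: closed_segment_def)
      have "(1 - t) *\<^sub>R \<sigma> u + t *\<^sub>R \<sigma> v = \<sigma> ((1 - t) * u + t * v)"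
        by (simp add: \<sigma>_def algebra_simps)
      moreover have "0 \<le> (1 - t) * u + t * v" using t uv by simp
      moreover have "(1 - t) * u + t * v < s" using t uv convex_bound_lt[of u s v "1 - t" t] by simp
      ultimately show "y \<in> Z" using inZ t(3) by (simp add: \<gamma>_def)
    qed
    moreover have "\<sigma> u \<in> ?C" "\<sigma> v \<in> ?C" using \<sigma>C uv s(2) by auto
    ultimately show "rdist M (yc (\<gamma> u)) (yc (\<gamma> v)) \<le> ereal (D * L * \<bar>v - u\<bar>)"
      "\<bar>tc (\<gamma> v) - tc (\<gamma> u)\<bar> \<le> D * L * \<bar>v - u\<bar>"
      using chart_segment_bounds[OF k cC(2) C D, of "\<sigma> u" "\<sigma> v"] diff[of v u]
      by (simp_all add: \<gamma>_def mult_ac)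
  qed
  \<comment> \<open>Times converging to \<open>s\<close> from strictly below, where the Lipschitz
    bounds are valid.\<close>
  define \<tau> where "\<tau> n = s * (1 - 1 / (real n + 2))" for n
  have \<tau>: "0 \<le> \<tau> n" "\<tau> n < s" for n
    using s(1) by (auto simp: \<tau>_def field_simps)
  have \<tau>lim: "\<tau> \<longlonglongrightarrow> s"
  proof -
    have "(\<lambda>n. 1 / real (n + 2)) \<longlonglongrightarrow> 0" using LIMSEQ_ignore_initial_segment[OF lim_1_over_n, of 2] .
    then have "(\<lambda>n. s * (1 - 1 / real (n + 2))) \<longlonglongrightarrow> s * (1 - 0)" by (intro tendsto_intros)
    then show ?thesis by (simp add: \<tau>_def[abs_def] add.commute)
  qed
  define X where "X n = yc (\<gamma> (\<tau> n))" for n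
  have "\<exists>N. \<forall>m\<ge>N. \<forall>n\<ge>N. rdist M (X m) (X n) < ereal \<epsilon>" if "\<epsilon> > 0" for \<epsilon>
  proof -
    \<comment> \<open>Adding 1 keeps the divisor positive without proving \<open>L\<close>
      nonzero.\<close>
    have "0 < \<epsilon> / (D * L + 1)" using that D(1) L(1) by (simp add: add_nonneg_pos)
    then obtain N where N: "\<forall>m\<ge>N. \<forall>n\<ge>N. dist (\<tau> m) (\<tau> n) < \<epsilon> / (D * L + 1)"
      using metric_CauchyD[OF LIMSEQ_imp_Cauchy[OF \<tau>lim]] by blast
    have "rdist M (X m) (X n) < ereal \<epsilon>" if "m \<ge> N" "n \<ge> N" for m n
    proof -
      have "\<bar>\<tau> n - \<tau> m\<bar> < \<epsilon> / (D * L + 1)" using N that by (auto simp: dist_real_def abs_minus_commute)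
      then have "(D * L + 1) * \<bar>\<tau> n - \<tau> m\<bar> < \<epsilon>"
        using D(1) L(1) by (simp add: pos_less_divide_eq add_nonneg_pos mult.commute)
      then have "D * L * \<bar>\<tau> n - \<tau> m\<bar> < \<epsilon>"
        by (rule le_less_trans[rotated]) (simp add: algebra_simps)
      then show ?thesis
        using bounds(1)[OF \<tau>[of m] \<tau>[of n]] by (simp add: X_def le_less_trans)
    qed
    then show ?thesis by blast
  qed
  \<comment> \<open>The projections form a Cauchy sequence, so completeness gives a limit
    \<open>l\<close>. It lies on the boundary because the boundary is closed and
    \<open>rdist\<close> limits are topological limits.\<close>
  then obtain l where l: "(\<lambda>n. rdist M (X n) l) \<longlonglongrightarrow> 0"
    using complete unfolding complete_manifold_def by blast
  then have Xl: "X \<longlonglongrightarrow> l" by (rule rdist_tendsto_imp_tendsto)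
  have Xb: "X n \<in> bdry M" for n using Z_coords(3)[OF inZ[OF \<tau>]] by (simp add: X_def)
  then have lb: "l \<in> bdry M" by (rule closed_sequentially[OF closed_bdry _ Xl])
  define T where "T n = tc (\<gamma> (\<tau> n))" for n
  \<comment> \<open>The collar coordinates stay in a compact subinterval of \<open>[0, r)\<close>,
    so a subsequence converges to some \<open>t < r\<close>.\<close>
  have Tb: "T n \<in> {0..(r + a) / 2}" for n
  proof -
    have "\<bar>T n - tc q\<bar> \<le> D * L * \<tau> n"
      using bounds(2)[OF _ s(1) \<tau>[of n]] \<tau>[of n] \<open>\<gamma> 0 = q\<close> by (simp add: T_def)
    also have "\<dots> \<le> D * \<eta> * 1"
      using D(1) L \<tau>[of n] s(2) \<eta>(1) by (intro mult_mono) auto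
    finally have "T n \<le> (r + a) / 2" using \<eta>(3) q(2) by (simp add: field_simps)
    then show ?thesis using Z_coords(1)[OF inZ[OF \<tau>]] by (simp add: T_def)
  qed
  obtain t h where t: "t \<in> {0..(r + a) / 2}" "strict_mono h" "(T \<circ> h) \<longlonglongrightarrow> t"
    using seq_compactE[OF compact_imp_seq_compact[OF compact_Icc]] Tb by metis
  have tr: "(t, l) \<in> {0..<r} \<times> bdry M" using t(1) a lb by auto
  have "((\<lambda>n. ((T \<circ> h) n, (X \<circ> h) n)) \<longlongrightarrow> (t, l)) sequentially"
    by (intro tendsto_Pair t(3) LIMSEQ_subseq_LIMSEQ[OF Xl t(2)])
  moreover have "T n < r" for n using Tb[of n] a by auto
  then have "\<forall>\<^sub>F n in sequentially. ((T \<circ> h) n, (X \<circ> h) n) \<in> {0..<r} \<times> bdry M"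
    using Tb Xb by (intro always_eventually) auto
  ultimately have "(\<lambda>n. \<iota> (T (h n)) (X (h n))) \<longlonglongrightarrow> \<iota> t l"
    using continuous_on_tendsto_compose[OF continuous_iota _ tr] by fastforce
  moreover have "\<iota> (T n) (X n) = \<gamma> (\<tau> n)" for n
    using Z_coords(4)[OF inZ[OF \<tau>]] by (simp add: T_def X_def)
  ultimately have lim1: "(\<lambda>n. \<gamma> (\<tau> (h n))) \<longlonglongrightarrow> \<iota> t l" by simp
  have "(\<tau> \<circ> h) \<longlonglongrightarrow> s" by (rule LIMSEQ_subseq_LIMSEQ[OF \<tau>lim t(2)])
  moreover have "\<tau> n \<in> {0..1}" for n using \<tau>[of n] s(2) by simp
  then have "\<forall>\<^sub>F n in sequentially. (\<tau> \<circ> h) n \<in> {0..1}" by (intro always_eventually) auto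
  ultimately have "(\<lambda>n. \<gamma> (\<tau> (h n))) \<longlonglongrightarrow> \<gamma> s"
    using continuous_on_tendsto_compose[OF c\<gamma>, of "\<tau> \<circ> h" s] s by (simp add: o_def)
  \<comment> \<open>Along the subsequence the curve tends both to its value at \<open>s\<close> and
    to the collar point over \<open>(t, l)\<close>. Uniqueness of limits puts the exit point inside
    the collar, a contradiction.\<close>
  from LIMSEQ_unique[OF this lim1] have "\<gamma> s = \<iota> t l" .
  then show False using coords_iota(3)[of t l] tr s(3) by auto
qed

text \<open>Limit points outside \<open>Z\<close> are excluded by
  \<open>closure_collar_part\<close>; inside \<open>Z\<close> continuity of \<open>tc\<close>
  suffices.\<close>

lemma closed_collar_part:
  assumes a: "a < r"
  shows "closed {q \<in> Z. tc q \<le> a}"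
proof -
  have "closure {q \<in> Z. tc q \<le> a} \<subseteq> {q \<in> Z. tc q \<le> a}"
  proof
    fix p assume p: "p \<in> closure {q \<in> Z. tc q \<le> a}"
    then have pZ: "p \<in> Z" by (rule closure_collar_part[OF a])
    have "open (Z \<inter> tc -` {a<..})"
      by (rule continuous_open_preimage[OF continuous_tc_yc(1) open_Z]) auto
    then have "(Z \<inter> tc -` {a<..}) \<inter> closure {q \<in> Z. tc q \<le> a} = {}"
      by (subst open_Int_closure_eq_empty) auto
    then have "\<not> a < tc p" using p pZ by auto
    then show "p \<in> {q \<in> Z. tc q \<le> a}" using pZ by simp
  qed
  then show ?thesis using closure_subset_eq by blast
qed

end


section \<open>Bump functions\<close>

text \<open>The powers of \<open>1 / t\<close> are included because the derivative of
  \<open>exp (- 1 / t)\<close> and all later derivatives are combinations of these functions.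
  Smoothness then follows by one induction over the whole family.\<close>

definition flat :: "nat \<Rightarrow> real \<Rightarrow> real" where
  "flat n t = (if 0 < t then (1 / t) ^ n / exp (1 / t) else 0)"

lemma flat_tendsto_0: "(flat n \<longlongrightarrow> 0) (at 0)"
proof (rule filterlim_split_at)
  have "(flat n \<longlongrightarrow> 0) (at_left 0) \<longleftrightarrow> ((\<lambda>t::real. 0::real) \<longlongrightarrow> 0) (at_left 0)"
    by (rule tendsto_cong) (auto simp: eventually_at_topological flat_def intro!: exI[of _ UNIV])
  then show "(flat n \<longlongrightarrow> 0) (at_left 0)" by simp
  have "((\<lambda>x::real. x ^ n / exp x) \<longlongrightarrow> 0) at_top" by (rule tendsto_power_div_exp_0)
  then have "((\<lambda>t::real. (inverse t) ^ n / exp (inverse t)) \<longlongrightarrow> 0) (at_right 0)"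
    by (rule filterlim_compose[OF _ filterlim_inverse_at_top_right])
  moreover have "(flat n \<longlongrightarrow> 0) (at_right 0) \<longleftrightarrow>
      ((\<lambda>t::real. (inverse t) ^ n / exp (inverse t)) \<longlongrightarrow> 0) (at_right 0)"
    by (rule tendsto_cong) (auto simp: eventually_at_topological flat_def divide_inverse intro!: exI[of _ UNIV])
  ultimately show "(flat n \<longlongrightarrow> 0) (at_right 0)" by simp
qed

lemma flat_derivative: "(flat n has_real_derivative (flat (n + 2) t - n * flat (n + 1) t)) (at t)"
proof -
  consider "t < 0" | "t = 0" | "0 < t" by linarith
  then show ?thesis
  proof cases
    case 1
    have "((\<lambda>t::real. 0::real) has_real_derivative 0) (at t)" by simp
    then have "(flat n has_real_derivative 0) (at t)"
      by (rule has_field_derivative_transform_within_open[of _ _ _ "{..<0}"])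
        (use 1 in \<open>auto simp: flat_def\<close>)
    then show ?thesis using 1 by (simp add: flat_def)
  next
    case 2
    \<comment> \<open>The difference quotient of \<open>flat n\<close> at 0 is exactly
      \<open>flat (n + 1)\<close>.\<close>
    have "((\<lambda>h. flat (n + 1) h) \<longlongrightarrow> 0) (at 0)" by (rule flat_tendsto_0)
    moreover have "\<forall>\<^sub>F h in at (0::real). flat (n + 1) h = (flat n (0 + h) - flat n 0) / h"
      by (auto simp: eventually_at flat_def divide_simps intro!: exI[of _ 1])
    ultimately have "((\<lambda>h. (flat n (0 + h) - flat n 0) / h) \<longlongrightarrow> 0) (at 0)"
      by (rule Lim_transform_eventually)
    then show ?thesis using 2 by (simp add: DERIV_def flat_def)
  next
    case 3
    define u where "u = inverse t"
    have 1: "((\<lambda>t. inverse t) has_real_derivative - (u * u)) (at t)"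
      using 3 by (auto intro!: derivative_eq_intros simp: u_def)
    have 2: "((\<lambda>t. inverse t ^ n) has_real_derivative n * u ^ (n - 1) * - (u * u)) (at t)"
      using DERIV_power[OF 1, of n] by (simp add: u_def mult_ac)
    have "((\<lambda>t. exp (- inverse t)) has_real_derivative exp (- u) * (u * u)) (at t)"
      using DERIV_fun_exp[OF DERIV_minus[OF 1]] by (simp add: u_def)
    from DERIV_mult[OF 2 this] have "((\<lambda>t. inverse t ^ n * exp (- inverse t)) has_real_derivative
        u ^ (n + 2) * exp (- u) - n * (u ^ (n + 1) * exp (- u))) (at t)"
      by (rule DERIV_cong) (cases n; simp add: u_def[symmetric] algebra_simps)
    moreover have "(\<lambda>t. inverse t ^ n * exp (- inverse t)) = (\<lambda>t::real. (1 / t) ^ n / exp (1 / t))"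
      by (simp add: exp_minus divide_inverse)
    ultimately have "((\<lambda>t. (1 / t) ^ n / exp (1 / t)) has_real_derivative
        (1 / t) ^ (n + 2) / exp (1 / t) - n * ((1 / t) ^ (n + 1) / exp (1 / t))) (at t)"
      by (simp add: u_def exp_minus divide_inverse)
    then have "(flat n has_real_derivative
        (1 / t) ^ (n + 2) / exp (1 / t) - n * ((1 / t) ^ (n + 1) / exp (1 / t))) (at t)"
      by (rule has_field_derivative_transform_within_open[of _ _ _ "{0<..}"])
        (use 3 in \<open>auto simp: flat_def\<close>)
    then show ?thesis using 3 by (simp add: flat_def)
  qed
qed

lemma Ck_on_flat: "Ck_on k UNIV (flat n)"
proof (induction k arbitrary: n)
  case 0
  show ?case
    using flat_derivative by (auto intro!: continuous_at_imp_continuous_on DERIV_isCont)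
next
  case (Suc k)
  have d: "(flat n has_derivative (\<lambda>v. (flat (n + 2) t + - n * flat (n + 1) t) * v)) (at t)" for t
    using flat_derivative[of n t] by (simp add: has_field_derivative_def)
  show ?case
    by (rule Ck_on_SucI[OF open_UNIV d])
      (intro Ck_on_mult Ck_on_add Ck_on_const open_UNIV Suc.IH)
qed

lemma flat_0_pos: "0 < flat 0 t \<longleftrightarrow> 0 < t" "0 \<le> flat 0 t"
  by (auto simp: flat_def)

definition step :: "real \<Rightarrow> real" where
  "step t = flat 0 t * inverse (flat 0 t + flat 0 (1 - t))"

lemma step_denominator: "0 < flat 0 t + flat 0 (1 - t)"
  using flat_0_pos[of t] flat_0_pos[of "1 - t"] by (cases "0 < t") (auto intro: add_pos_nonneg add_nonneg_pos)

lemma step_props: "0 \<le> step t" "step t \<le> 1" "t \<le> 0 \<Longrightarrow> step t = 0" "1 \<le> t \<Longrightarrow> step t = 1"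
proof -
  show "0 \<le> step t" using step_denominator[of t] flat_0_pos(2) by (simp add: step_def)
  show "step t \<le> 1"
    using step_denominator[of t] flat_0_pos(2)[of "1 - t"] by (simp add: step_def field_simps)
  show "t \<le> 0 \<Longrightarrow> step t = 0" by (simp add: step_def flat_def)
  show "1 \<le> t \<Longrightarrow> step t = 1" by (simp add: step_def flat_def)
qed

lemma Ck_on_step: "Ck_on k UNIV step"
proof -
  have a: "Ck_on k UNIV (\<lambda>t::real. 1 + - t)"
    by (intro Ck_on_add Ck_on_const Ck_on_linear bounded_linear_minus bounded_linear_ident open_UNIV)
  have "Ck_on k UNIV (\<lambda>t. flat 0 (1 + - t))"
    by (rule Ck_on_compose[OF open_UNIV open_UNIV _ a Ck_on_flat]) auto
  then have "Ck_on k UNIV (\<lambda>t. flat 0 t * inverse (flat 0 t + flat 0 (1 + - t)))"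
    using step_denominator
    by (intro Ck_on_mult Ck_on_inverse Ck_on_add Ck_on_flat open_UNIV) (simp add: less_imp_neq[symmetric])
  then show ?thesis by (simp add: step_def[abs_def])
qed

text \<open>With \<open>d\<close> the distance from \<open>p\<close>, the argument of
  \<open>step\<close> is \<open>3 - 4 * d ^ 2 / R ^ 2\<close>. It is at least 1 for
  \<open>d ^ 2 \<le> R ^ 2 / 2\<close> and at most 0 for \<open>d ^ 2 \<ge> 3 * R ^ 2 / 4\<close>.
  So the function is constant on a neighbourhood of the closed half ball, and squaring the distance
  avoids a singularity at the centre.\<close>

definition bump :: "'v::euclidean_space \<Rightarrow> real \<Rightarrow> 'v \<Rightarrow> real" where
  "bump p R x = step (3 + (- 4 / R\<^sup>2) * ((x + - p) \<bullet> (x + - p)))"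

lemma Ck_on_bump: "Ck_on k UNIV (bump p R)"
  unfolding bump_def
  by (rule Ck_on_compose[OF open_UNIV open_UNIV _ _ Ck_on_step])
    (intro subset_UNIV Ck_on_add Ck_on_mult Ck_on_inner Ck_on_const Ck_on_id open_UNIV)+

lemma bump_arg: "(x + - p) \<bullet> (x + - p) = (dist p x)\<^sup>2"
  by (simp add: dist_norm norm_minus_commute power2_norm_eq_inner[symmetric])

lemma bump_props:
  assumes "0 < R"
  shows "0 \<le> bump p R x" "bump p R x \<le> 1" "x \<notin> cball p R \<Longrightarrow> bump p R x = 0"
    "(dist p x)\<^sup>2 < R\<^sup>2 / 2 \<Longrightarrow> bump p R x = 1" "x \<in> cball p (R / 2) \<Longrightarrow> bump p R x = 1"
proof -
  show "0 \<le> bump p R x" "bump p R x \<le> 1" by (auto simp: bump_def step_props)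
  show "bump p R x = 0" if "x \<notin> cball p R"
  proof -
    have "R\<^sup>2 \<le> (dist p x)\<^sup>2" using that assms by (intro power_mono) auto
    then have "3 * R\<^sup>2 \<le> 4 * (dist p x)\<^sup>2" using zero_le_power2[of R] by linarith
    then have "3 + (- 4 / R\<^sup>2) * (dist p x)\<^sup>2 \<le> 0" using assms by (simp add: field_simps)
    then show ?thesis unfolding bump_def bump_arg by (rule step_props(3))
  qed
  have one: "bump p R x = 1" if "(dist p x)\<^sup>2 \<le> R\<^sup>2 / 2"
  proof -
    have "1 \<le> 3 + (- 4 / R\<^sup>2) * (dist p x)\<^sup>2" using that assms by (simp add: field_simps)
    then show ?thesis unfolding bump_def bump_arg by (rule step_props(4))
  qed
  show "(dist p x)\<^sup>2 < R\<^sup>2 / 2 \<Longrightarrow> bump p R x = 1" using one by simp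
  show "bump p R x = 1" if "x \<in> cball p (R / 2)"
  proof -
    have "(dist p x)\<^sup>2 \<le> (R / 2)\<^sup>2" using that assms by (intro power_mono) auto
    also have "\<dots> \<le> R\<^sup>2 / 2" by (simp add: power_divide)
    finally show ?thesis by (rule one)
  qed
qed


section \<open>Generic perturbations in Euclidean space\<close>

definition grad :: "('v::euclidean_space \<Rightarrow> real) \<Rightarrow> 'v \<Rightarrow> 'v" where
  "grad F x = (\<Sum>i\<in>Basis. frechet_derivative F (at x) i *\<^sub>R i)"

lemma grad_derivative:
  assumes "F differentiable (at x)"
  shows "(F has_derivative (\<lambda>v. grad F x \<bullet> v)) (at x)"
proof -
  have d: "(F has_derivative frechet_derivative F (at x)) (at x)"
    using assms by (simp add: frechet_derivative_works)
  have "frechet_derivative F (at x) v = grad F x \<bullet> v" for v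
  proof -
    have "frechet_derivative F (at x) v = frechet_derivative F (at x) (\<Sum>i\<in>Basis. (v \<bullet> i) *\<^sub>R i)"
      by (simp add: euclidean_representation)
    also have "\<dots> = (\<Sum>i\<in>Basis. (v \<bullet> i) * frechet_derivative F (at x) i)"
      using has_derivative_linear[OF d] by (simp add: linear_sum linear_scale)
    also have "\<dots> = grad F x \<bullet> v"
      by (simp add: grad_def inner_sum_right inner_commute[of _ v] mult.commute)
    finally show ?thesis .
  qed
  then have "frechet_derivative F (at x) = (\<lambda>v. grad F x \<bullet> v)" by (rule ext)
  then show ?thesis using d by simp
qed

lemma grad_eq: "(F has_derivative (\<lambda>v. g \<bullet> v)) (at x) \<Longrightarrow> grad F x = g"
  by (simp add: grad_def frechet_derivative_at[symmetric] euclidean_representation)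

lemma Ck_on_grad: "open U \<Longrightarrow> Ck_on (Suc k) U F \<Longrightarrow> Ck_on k U (grad F)"
  unfolding grad_def
  by (intro Ck_on_sum Ck_on_scaleR Ck_on_const Ck_on_SucD(2)) auto

lemma Ck_on_diff: "Ck_on (Suc k) U F \<Longrightarrow> x \<in> U \<Longrightarrow> F differentiable (at x)"
  by simp

text \<open>For all affine functions outside the image of an \<open>n\<close>-dimensional set in the
  \<open>(n + 1)\<close>-dimensional space of affine functions, \<open>0\<close> is a regular value after adding the affine
  function; so Sard's theorem is not needed.\<close>

lemma affine_perturbations:
  fixes F :: "'v::euclidean_space \<Rightarrow> real"
  assumes O: "open O'" and F: "\<And>k. Ck_on k O' F"
  shows "negligible {(a, b). \<exists>x\<in>O'. F x + (a \<bullet> x + b) = 0 \<and> grad F x + a = 0}"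
proof -
  \<comment> \<open>The two equations determine \<open>(a, b)\<close> from \<open>x\<close>, so the
    bad parameters are contained in the image of \<open>m\<close>. Its domain has one dimension less
    than its target.\<close>
  define m where "m x = (- grad F x, - F x + grad F x \<bullet> x)" for x
  have "m differentiable_on O'"
  proof (rule differentiable_at_imp_differentiable_on)
    fix x assume x: "x \<in> O'"
    have g: "grad F differentiable (at x)"
      using Ck_on_diff[OF Ck_on_grad[OF O F] x] .
    have f: "F differentiable (at x)" using Ck_on_diff[OF F x] .
    have "(\<lambda>x. grad F x \<bullet> x) differentiable (at x)"
      by (intro differentiable_inner g differentiable_ident)
    then show "m differentiable (at x)"
      unfolding m_def using f g
      by (auto simp: differentiable_def intro!: has_derivative_Pair derivative_eq_intros)
  qed
  then have "negligible (m ` O')"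
    by (intro negligible_differentiable_image_lowdim) auto
  moreover have "{(a, b). \<exists>x\<in>O'. F x + (a \<bullet> x + b) = 0 \<and> grad F x + a = 0} \<subseteq> m ` O'"
  proof clarify
    fix a b x assume x: "x \<in> O'" "F x + (a \<bullet> x + b) = 0" "grad F x + a = 0"
    have a: "a = - grad F x" using x(3) by (simp add: eq_neg_iff_add_eq_0 add.commute)
    then have "b = - F x + grad F x \<bullet> x" using x(2) by simp
    then show "(a, b) \<in> m ` O'" using a x(1) by (auto simp: m_def)
  qed
  ultimately show ?thesis by (rule negligible_subset)
qed

lemma small_uniformly:
  fixes \<Psi> :: "'v::euclidean_space \<Rightarrow> 'w::euclidean_space \<Rightarrow> real"
  assumes A: "compact A" and c: "continuous_on (A \<times> UNIV) (\<lambda>(x, w). \<Psi> x w)" and e: "0 < e"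
  shows "\<exists>d>0. \<forall>x\<in>A. \<forall>w. norm w < d \<longrightarrow> \<bar>\<Psi> x w - \<Psi> x 0\<bar> < e"
proof -
  have "compact (A \<times> cball (0::'w) 1)" by (intro compact_Times A compact_cball)
  then have "uniformly_continuous_on (A \<times> cball (0::'w) 1) (\<lambda>(x, w). \<Psi> x w)"
    by (intro compact_uniformly_continuous continuous_on_subset[OF c]) auto
  then obtain d where d: "0 < d"
    "\<forall>p\<in>A \<times> cball (0::'w) 1. \<forall>p'\<in>A \<times> cball (0::'w) 1. dist p' p < d \<longrightarrow>
      dist (case p' of (x, w) \<Rightarrow> \<Psi> x w) (case p of (x, w) \<Rightarrow> \<Psi> x w) < e"
    using e unfolding uniformly_continuous_on_def by blast
  have "\<bar>\<Psi> x w - \<Psi> x 0\<bar> < e" if "x \<in> A" "norm w < min d 1" for x w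
  proof -
    have "(x, 0) \<in> A \<times> cball (0::'w) 1" "(x, w) \<in> A \<times> cball (0::'w) 1" "dist (x, w) (x, 0) < d"
      using that by (auto simp: dist_Pair_Pair)
    from d(2)[rule_format, OF this] show ?thesis by (simp add: dist_real_def)
  qed
  then show ?thesis using d(1) by (intro exI[of _ "min d 1"]) auto
qed

text \<open>The perturbation is an affine function times a bump. On the half ball the bump is 1, so
  almost every parameter gives a regular zero set; on the compact set \<open>A\<close> regularity is
  stable under perturbations small together with their gradients.\<close>

lemma perturb_ball:
  fixes F :: "'v::euclidean_space \<Rightarrow> real"
  assumes O: "open O'" and F: "\<And>k. Ck_on k O' F" and R: "0 < R" "cball p R \<subseteq> O'"
    and A: "compact A" "A \<subseteq> cball p R" "\<And>x. x \<in> A \<Longrightarrow> F x \<noteq> 0 \<or> grad F x \<noteq> 0"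
    and \<eta>: "0 < \<eta>"
  shows "\<exists>H. (\<forall>k. Ck_on k UNIV H) \<and> (\<forall>x. \<bar>H x\<bar> \<le> \<eta>) \<and> (\<forall>x. x \<notin> cball p R \<longrightarrow> H x = 0) \<and>
    (\<forall>x\<in>A \<union> cball p (R / 2). F x + H x \<noteq> 0 \<or> grad (\<lambda>y. F y + H y) x \<noteq> 0)"
proof -
  define \<rho> where "\<rho> = bump p R"
  define H where "H w x = \<rho> x * (fst w \<bullet> x + snd w)" for w :: "'v \<times> real" and x
  \<comment> \<open>By the product rule this is the gradient of \<open>F + H w\<close>, written so
    that it is jointly continuous in the point and the parameter.\<close>
  define K where "K w x = grad F x + (\<rho> x *\<^sub>R fst w + (fst w \<bullet> x + snd w) *\<^sub>R grad \<rho> x)"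
    for w :: "'v \<times> real" and x
  have C\<rho>: "Ck_on k UNIV \<rho>" for k unfolding \<rho>_def by (rule Ck_on_bump)
  have CH: "Ck_on k UNIV (H w)" for w k
    unfolding H_def
    by (intro Ck_on_mult C\<rho> Ck_on_add Ck_on_inner Ck_on_const Ck_on_id open_UNIV)
  have d: "((\<lambda>y. F y + H w y) has_derivative (\<lambda>v. K w x \<bullet> v)) (at x)" if "x \<in> O'" for w x
  proof -
    have 1: "(F has_derivative (\<lambda>v. grad F x \<bullet> v)) (at x)"
      by (rule grad_derivative[OF Ck_on_diff[OF F that]])
    have 2: "(\<rho> has_derivative (\<lambda>v. grad \<rho> x \<bullet> v)) (at x)"
      by (rule grad_derivative[OF Ck_on_diff[OF C\<rho>]]) simp
    have 3: "((\<lambda>y. fst w \<bullet> y + snd w) has_derivative (\<lambda>v. fst w \<bullet> v)) (at x)"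
      by (auto intro!: derivative_eq_intros)
    have "((\<lambda>y. F y + H w y) has_derivative (\<lambda>v. grad F x \<bullet> v + (\<rho> x * (fst w \<bullet> v) + (grad \<rho> x \<bullet> v) * (fst w \<bullet> x + snd w)))) (at x)"
      unfolding H_def by (intro has_derivative_add 1 has_derivative_mult 2 3)
    moreover have "(\<lambda>v. grad F x \<bullet> v + (\<rho> x * (fst w \<bullet> v) + (grad \<rho> x \<bullet> v) * (fst w \<bullet> x + snd w))) = (\<lambda>v. K w x \<bullet> v)"
      by (auto simp: K_def inner_add_left mult.commute)
    ultimately show ?thesis by simp
  qed
  have cF: "continuous_on O' F" "continuous_on O' (grad F)"
    using Ck_on_continuous[OF F] Ck_on_continuous[OF Ck_on_grad[OF O F]] by auto
  have c\<rho>: "continuous_on UNIV \<rho>" "continuous_on UNIV (grad \<rho>)"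
    using Ck_on_continuous[OF C\<rho>] Ck_on_continuous[OF Ck_on_grad[OF open_UNIV C\<rho>]] by auto
  have AO: "A \<subseteq> O'" using A R by auto
  have comp: "continuous_on (S \<times> UNIV) (\<lambda>q. f (fst q))" if "continuous_on S f"
    for S :: "'v set" and f :: "'v \<Rightarrow> 'z::topological_space"
    by (rule continuous_on_compose2[OF that]) (auto intro: continuous_intros)
  have cH: "continuous_on (S \<times> UNIV) (\<lambda>(x, w). H w x)" for S
    unfolding H_def split_def
    by (intro continuous_intros comp continuous_on_subset[OF c\<rho>(1)]) auto
  have cK: "continuous_on (A \<times> UNIV) (\<lambda>(x, w). K w x)"
    unfolding K_def split_def
    by (intro continuous_intros comp continuous_on_subset[OF c\<rho>(1)] continuous_on_subset[OF c\<rho>(2)]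
        continuous_on_subset[OF cF(2)] AO) auto
  have c\<Psi>: "continuous_on (A \<times> UNIV) (\<lambda>(x, w). \<bar>F x + H w x\<bar> + norm (K w x))"
    using cH[of A] cK unfolding split_def
    by (intro continuous_intros comp continuous_on_subset[OF cF(1) AO]) auto
  have K0: "K 0 x = grad F x" "H 0 x = 0" for x by (simp_all add: K_def H_def)
  \<comment> \<open>The quantitative form of regularity on \<open>A\<close>; \<open>d1\<close> is
    then chosen so that the sum of the value and gradient norms changes by less than
    \<open>c\<close>.\<close>
  obtain c where c: "0 < c" "\<And>x. x \<in> A \<Longrightarrow> c \<le> \<bar>F x\<bar> + norm (grad F x)"
  proof (cases "A = {}")
    case True
    then show thesis using that[of 1] by simp
  next
    case False
    have "continuous_on A (\<lambda>x. \<bar>F x\<bar> + norm (grad F x))"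
      by (intro continuous_intros continuous_on_subset[OF cF(1) AO] continuous_on_subset[OF cF(2) AO])
    from continuous_attains_inf[OF A(1) False this] obtain x0 where
      x0: "x0 \<in> A" "\<forall>y\<in>A. \<bar>F x0\<bar> + norm (grad F x0) \<le> \<bar>F y\<bar> + norm (grad F y)" by blast
    have "0 < \<bar>F x0\<bar> + norm (grad F x0)"
      using A(3)[OF x0(1)] by (auto intro: add_pos_nonneg add_nonneg_pos)
    then show thesis using that x0(2) by blast
  qed
  obtain d1 where d1: "0 < d1" "\<And>x w. x \<in> A \<Longrightarrow> norm w < d1 \<Longrightarrow>
      \<bar>(\<bar>F x + H w x\<bar> + norm (K w x)) - (\<bar>F x + H 0 x\<bar> + norm (K 0 x))\<bar> < c"
    using small_uniformly[OF A(1) c\<Psi> c(1)] by blast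
  obtain d2 where d2: "0 < d2" "\<And>x w. x \<in> cball p R \<Longrightarrow> norm w < d2 \<Longrightarrow> \<bar>H w x - H 0 x\<bar> < \<eta>"
    using small_uniformly[OF compact_cball[of p R] cH \<eta>] by blast
  define Bad where "Bad = {(a, b). \<exists>x\<in>O'. F x + (a \<bullet> x + b) = 0 \<and> grad F x + a = 0}"
  \<comment> \<open>A null set cannot contain a ball, so there are parameters outside
    \<open>Bad\<close> that are as small as required.\<close>
  have "negligible Bad" unfolding Bad_def by (rule affine_perturbations[OF O F])
  moreover have "\<not> negligible (ball (0 :: 'v \<times> real) (min d1 d2))"
    by (rule open_not_negligible) (use d1(1) d2(1) in \<open>auto simp: ball_eq_empty\<close>)
  ultimately have "\<not> ball 0 (min d1 d2) \<subseteq> Bad" using negligible_subset by blast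
  then obtain w where w: "norm w < d1" "norm w < d2" "w \<notin> Bad" by (auto simp: subset_iff)
  have grad_sum: "grad (\<lambda>y. F y + H w y) x = K w x" if "x \<in> O'" for x
    by (rule grad_eq[OF d[OF that]])
  show ?thesis
  proof (intro exI[of _ "H w"] conjI allI impI ballI CH)
    show H0: "H w x = 0" if "x \<notin> cball p R" for x
      using bump_props(3)[OF R(1) that] by (simp add: H_def \<rho>_def)
    show "\<bar>H w x\<bar> \<le> \<eta>" for x
      using H0[of x] d2(2)[of x w] w(2) \<eta> by (cases "x \<in> cball p R") (auto simp: K0)
    fix x assume "x \<in> A \<union> cball p (R / 2)"
    then consider "x \<in> A" | "x \<in> cball p (R / 2)" by blast
    then show "F x + H w x \<noteq> 0 \<or> grad (\<lambda>y. F y + H w y) x \<noteq> 0"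
    proof cases
      case 1
      have "0 < \<bar>F x + H w x\<bar> + norm (K w x)"
        using d1(2)[OF 1 w(1)] c(2)[OF 1] by (simp add: K0)
      then show ?thesis using grad_sum 1 AO by auto
    next
      case 2
      then have xO: "x \<in> O'" using R by (auto simp: subset_iff)
      have r1: "\<rho> x = 1" using bump_props(5)[OF R(1) 2] by (simp add: \<rho>_def)
      have "dist p x \<le> R / 2" using 2 by simp
      then have "(dist p x)\<^sup>2 \<le> (R / 2)\<^sup>2" by (intro power_mono) auto
      then have "(dist p x)\<^sup>2 \<le> R\<^sup>2 / 4" by (simp add: power_divide)
      moreover have "0 < R\<^sup>2" using R(1) by simp
      ultimately have "(dist p x)\<^sup>2 < R\<^sup>2 / 2" by linarith
      \<comment> \<open>The bump is 1 on this larger open set, so its gradient vanishes also at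
        boundary points of the closed half ball.\<close>
      then have near: "x \<in> {y. (dist p y)\<^sup>2 < R\<^sup>2 / 2}" by simp
      have op: "open {y. (dist p y)\<^sup>2 < R\<^sup>2 / 2}" by (intro open_Collect_less continuous_intros)
      have "((\<lambda>y. 1) has_derivative (\<lambda>v. 0)) (at x)" by simp
      then have "(\<rho> has_derivative (\<lambda>v. 0)) (at x)"
        by (rule has_derivative_transform_within_open[OF _ op near])
          (use bump_props(4)[OF R(1)] in \<open>simp add: \<rho>_def\<close>)
      then have "(\<rho> has_derivative (\<lambda>v. 0 \<bullet> v)) (at x)" by simp
      then have "grad \<rho> x = 0" by (rule grad_eq)
      then have "K w x = grad F x + fst w" "H w x = fst w \<bullet> x + snd w"
        by (simp_all add: K_def H_def r1)
      then show ?thesis using w(3) xO grad_sum[OF xO] by (auto simp: Bad_def split_def)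
    qed
  qed
qed


section \<open>Generic functions on manifolds\<close>

lemma grad_cong:
  assumes "open U" "x \<in> U" "f differentiable (at x)" "\<And>y. y \<in> U \<Longrightarrow> g y = f y"
  shows "grad g x = grad f x"
proof (rule grad_eq)
  show "(g has_derivative (\<lambda>v. grad f x \<bullet> v)) (at x)"
    by (rule has_derivative_transform_within_open[OF grad_derivative[OF assms(3)] assms(1,2)])
      (simp add: assms(4))
qed

context smooth_mfd
begin

lemma smooth_from_add: "smooth_from M S f \<Longrightarrow> smooth_from M S g \<Longrightarrow> smooth_from M S (\<lambda>q. f q + g q)"
  unfolding smooth_from_def o_def
  by (intro ballI, rule smooth_on_add) auto

lemma smooth_from_const: "smooth_from M S (\<lambda>q. c)"
  unfolding smooth_from_def o_def by (simp add: smooth_on_const)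

lemma smooth_from_continuous:
  assumes f: "smooth_from M UNIV f"
  shows "continuous_on UNIV f"
proof -
  have "isCont f q" for q
  proof -
    obtain \<kappa> where k: "\<kappa> \<in> atlas M" "q \<in> fst \<kappa>" by (rule atlas_cover)
    note a = atlas_adm[OF k(1)]
    have "continuous_on (snd \<kappa> ` fst \<kappa>) (f \<circ> cinv \<kappa>)"
      using smooth_on_continuous[OF smooth_from_adm[OF f a]] by simp
    then have "continuous_on (fst \<kappa>) (\<lambda>p. (f \<circ> cinv \<kappa>) (snd \<kappa> p))"
      by (rule continuous_on_compose2[OF _ adm_facts(6)[OF a]]) auto
    then have "continuous_on (fst \<kappa>) f"
      by (rule continuous_on_eq) (simp add: adm_facts(3)[OF a])
    then show ?thesis
      using k(2) adm_facts(1)[OF a] by (auto simp: continuous_on_eq_continuous_at)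
  qed
  then show ?thesis by (simp add: continuous_at_imp_continuous_on)
qed

lemma tderiv_cong:
  assumes f: "smooth_from M UNIV f" and W: "open W" "q \<in> W" "\<And>p. p \<in> W \<Longrightarrow> g p = f p"
  shows "tderiv M q v g = tderiv M q v f"
proof -
  let ?c = "chart_at M q"
  note a = atlas_adm[OF chart_at(1)[of q]]
  have "dH (g \<circ> cinv ?c) (snd ?c q) = dH (f \<circ> cinv ?c) (snd ?c q)"
  proof (rule dH_cong[of "snd ?c ` (W \<inter> fst ?c)"])
    show "smooth_on (snd ?c ` (W \<inter> fst ?c)) (f \<circ> cinv ?c)"
      by (rule smooth_on_subset[OF smooth_from_adm[OF f a]]) auto
    show "relopen (snd ?c ` (W \<inter> fst ?c))" by (rule chart_relopen[OF adm_chart[OF a] W(1)])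
    show "snd ?c q \<in> snd ?c ` (W \<inter> fst ?c)" using W(2) chart_at(2) by auto
  qed (use W(3) adm_facts(3)[OF a] in auto)
  then show ?thesis by (simp add: tderiv_def)
qed

lemma tvec_surj:
  assumes "adm M \<kappa>" "x \<in> fst \<kappa>"
  obtains v where "tvec M \<kappa> x v = w"
proof -
  note l = tvec_linear[OF assms]
  have "inj (tvec M \<kappa> x)" using tvec_eq_0[OF assms] by (simp add: linear_injective_0[OF l])
  then have "surj (tvec M \<kappa> x)" by (rule linear_inj_imp_surj[OF l])
  then show thesis using that by (metis surjD)
qed

definition interior_part :: "('m, 'v) chart \<Rightarrow> 'v set" where
  "interior_part \<kappa> = snd \<kappa> ` fst \<kappa> \<inter> {x. 0 < x \<bullet> bdir}"

lemma open_interior_part: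
  assumes "adm M \<kappa>"
  shows "open (interior_part \<kappa>)"
proof -
  obtain T where T: "open T" "snd \<kappa> ` fst \<kappa> = half_space \<inter> T"
    using adm_facts(2)[OF assms] by (auto simp: openin_open)
  have "interior_part \<kappa> = T \<inter> {x. 0 < x \<bullet> bdir}"
    unfolding interior_part_def T(2) by (auto simp: half_space_def)
  then show ?thesis using T(1) by (auto intro!: open_Int open_Collect_less continuous_intros)
qed

lemma interior_part_Ck:
  assumes "adm M \<kappa>" "smooth_from M UNIV f"
  shows "Ck_on k (interior_part \<kappa>) (f \<circ> cinv \<kappa>)"
  by (rule smooth_on_Ck[OF open_interior_part[OF assms(1)]
        smooth_on_subset[OF smooth_from_adm[OF assms(2,1)]]]) (auto simp: interior_part_def)

lemma tderiv_grad:
  assumes k: "adm M \<kappa>" and f: "smooth_from M UNIV f" and q: "q \<in> fst \<kappa>" "0 < snd \<kappa> q \<bullet> bdir"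
  shows "tderiv M q (tvec M \<kappa> q v) f = grad (f \<circ> cinv \<kappa>) (snd \<kappa> q) \<bullet> v"
proof -
  have "snd \<kappa> q \<in> interior_part \<kappa>" using q by (simp add: interior_part_def)
  note d = grad_derivative[OF Ck_on_diff[OF interior_part_Ck[OF k f] this]]
  have "tderiv M q (tvec M \<kappa> q v) f = dH (f \<circ> cinv \<kappa>) (snd \<kappa> q) v"
    by (rule tderiv_tvec[OF k open_UNIV UNIV_I q(1) smooth_from_adm[OF f k]])
  also have "dH (f \<circ> cinv \<kappa>) (snd \<kappa> q) = (\<lambda>v. grad (f \<circ> cinv \<kappa>) (snd \<kappa> q) \<bullet> v)"
    unfolding at_half_space_interior[OF q(2)] by (rule frechet_derivative_at[OF d, symmetric])
  finally show ?thesis .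
qed

text \<open>Pointwise form of 0 being a regular value, together with the requirement that zeros lie
  in the interior of \<open>M\<close>. It keeps the boundary of the sublevel set away from that of
  \<open>M\<close> and prevents corners.\<close>

definition good :: "('m \<Rightarrow> real) \<Rightarrow> 'm \<Rightarrow> bool" where
  "good f q \<longleftrightarrow> f q \<noteq> 0 \<or> (q \<notin> bdry M \<and> (\<exists>v. tderiv M q v f \<noteq> 0))"

lemma good_chart:
  assumes k: "adm M \<kappa>" and f: "smooth_from M UNIV f" and q: "q \<in> fst \<kappa>" "0 < snd \<kappa> q \<bullet> bdir"
  shows "good f q \<longleftrightarrow> f q \<noteq> 0 \<or> grad (f \<circ> cinv \<kappa>) (snd \<kappa> q) \<noteq> 0"
proof -
  have "(\<exists>v. tderiv M q v f \<noteq> 0) \<longleftrightarrow> (\<exists>v. grad (f \<circ> cinv \<kappa>) (snd \<kappa> q) \<bullet> v \<noteq> 0)"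
    using tvec_surj[OF k q(1)] tderiv_grad[OF k f q] by metis
  also have "\<dots> \<longleftrightarrow> grad (f \<circ> cinv \<kappa>) (snd \<kappa> q) \<noteq> 0"
    by (metis inner_eq_zero_iff inner_zero_left)
  finally show ?thesis using bdry_iff[OF k q(1)] q(2) by (auto simp: good_def)
qed

lemma good_cong:
  assumes f: "smooth_from M UNIV f" and W: "open W" "q \<in> W" "\<And>p. p \<in> W \<Longrightarrow> g p = f p"
  shows "good g q \<longleftrightarrow> good f q"
  using tderiv_cong[OF f W] W by (simp add: good_def)

definition iball :: "('m, 'v) chart \<Rightarrow> 'v \<Rightarrow> real \<Rightarrow> bool" where
  "iball \<kappa> p R \<longleftrightarrow> adm M \<kappa> \<and> 0 < R \<and> cball p R \<subseteq> interior_part \<kappa>"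

lemma iball_facts:
  assumes "iball \<kappa> p R"
  shows "adm M \<kappa>" "0 < R" "cball p R \<subseteq> interior_part \<kappa>"
    "compact (cinv \<kappa> ` cball p R)" "closed (cinv \<kappa> ` cball p R)"
    "open (cinv \<kappa> ` ball p (R / 2))" "compact (cinv \<kappa> ` cball p (R / 2))"
    "\<And>x. x \<in> cball p R \<Longrightarrow> cinv \<kappa> x \<in> fst \<kappa>" "\<And>x. x \<in> cball p R \<Longrightarrow> snd \<kappa> (cinv \<kappa> x) = x"
    "\<And>x. x \<in> cball p R \<Longrightarrow> cinv \<kappa> x \<notin> bdry M"
    "cball p (R / 2) \<subseteq> cball p R"
proof -
  show a: "adm M \<kappa>" and R: "0 < R" and sub: "cball p R \<subseteq> interior_part \<kappa>"
    using assms by (auto simp: iball_def)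
  show h: "cball p (R / 2) \<subseteq> cball p R" using R by auto
  have im: "cball p R \<subseteq> snd \<kappa> ` fst \<kappa>" using sub by (auto simp: interior_part_def)
  note cont = continuous_on_subset[OF adm_facts(7)[OF a]]
  show "compact (cinv \<kappa> ` cball p R)" using compact_continuous_image[OF cont[OF im] compact_cball] .
  then show "closed (cinv \<kappa> ` cball p R)" by (rule compact_imp_closed)
  show "compact (cinv \<kappa> ` cball p (R / 2))"
    using compact_continuous_image[OF cont compact_cball] im h by blast
  have "ball p (R / 2) \<subseteq> cball p R" using R by auto
  then have b: "ball p (R / 2) \<subseteq> interior_part \<kappa>" using sub by auto
  then have "ball p (R / 2) = half_space \<inter> ball p (R / 2)" by (auto simp: interior_part_def half_space_def)
  then have "relopen (ball p (R / 2))" by (metis openin_open open_ball)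
  then show "open (cinv \<kappa> ` ball p (R / 2))"
    by (rule chart_cinv_open[OF adm_chart[OF a]]) (use b in \<open>auto simp: interior_part_def\<close>)
  fix x assume x: "x \<in> cball p R"
  show f: "cinv \<kappa> x \<in> fst \<kappa>" and s: "snd \<kappa> (cinv \<kappa> x) = x"
    using adm_facts(4,5)[OF a] x im by auto
  show "cinv \<kappa> x \<notin> bdry M"
    using bdry_iff[OF a f] s x sub by (auto simp: interior_part_def)
qed

lemma iball_exists:
  assumes "q \<notin> bdry M"
  obtains \<kappa> p R where "iball \<kappa> p R" "q \<in> cinv \<kappa> ` ball p (R / 2)"
proof -
  obtain \<kappa> where k: "\<kappa> \<in> atlas M" "q \<in> fst \<kappa>" by (rule atlas_cover)
  note a = atlas_adm[OF k(1)]
  have "0 < snd \<kappa> q \<bullet> bdir"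
    using bdry_iff[OF a k(2)] chart_inner_bdir_nonneg[OF a k(2)] assms by linarith
  then have "snd \<kappa> q \<in> interior_part \<kappa>" using k by (simp add: interior_part_def)
  then obtain R where R: "0 < R" "cball (snd \<kappa> q) R \<subseteq> interior_part \<kappa>"
    using open_interior_part[OF a] open_contains_cball_eq by blast
  show thesis
  proof (rule that)
    show "iball \<kappa> (snd \<kappa> q) R" using R a by (simp add: iball_def)
    show "q \<in> cinv \<kappa> ` ball (snd \<kappa> q) (R / 2)"
      using R(1) adm_facts(3)[OF a k(2)] by (intro image_eqI[of _ _ "snd \<kappa> q"]) auto
  qed
qed

definition ext :: "('m, 'v) chart \<Rightarrow> ('v \<Rightarrow> real) \<Rightarrow> 'm \<Rightarrow> real" where
  "ext \<kappa> H q = (if q \<in> fst \<kappa> then H (snd \<kappa> q) else 0)"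

lemma ext_outside:
  assumes "iball \<kappa> p R" "\<And>x. x \<notin> cball p R \<Longrightarrow> H x = 0" "q \<notin> cinv \<kappa> ` cball p R"
  shows "ext \<kappa> H q = 0"
  using assms adm_facts(3)[OF iball_facts(1)[OF assms(1)], of q] unfolding ext_def
  by (metis image_eqI)

text \<open>The compact image of the closed ball is closed in the Hausdorff space \<open>M\<close>.
  A point outside the chart domain therefore has a neighbourhood on which the extension is
  zero.\<close>

lemma ext_smooth:
  assumes b: "iball \<kappa> p R" and H: "\<And>k. Ck_on k UNIV H" "\<And>x. x \<notin> cball p R \<Longrightarrow> H x = 0"
  shows "smooth_from M UNIV (ext \<kappa> H)"
proof (rule smooth_fromI)
  fix q :: 'm
  note a = iball_facts(1)[OF b]
  show "\<exists>\<kappa>' W. adm M \<kappa>' \<and> q \<in> fst \<kappa>' \<and> open W \<and> q \<in> W \<and>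
      smooth_on (snd \<kappa>' ` (UNIV \<inter> W \<inter> fst \<kappa>')) (ext \<kappa> H \<circ> cinv \<kappa>')"
  proof (cases "q \<in> fst \<kappa>")
    case True
    have "smooth_on (snd \<kappa> ` (UNIV \<inter> UNIV \<inter> fst \<kappa>)) H"
      by (rule smooth_on_subset[OF smooth_onI_open[OF open_UNIV H(1)]]) auto
    then have "smooth_on (snd \<kappa> ` (UNIV \<inter> UNIV \<inter> fst \<kappa>)) (ext \<kappa> H \<circ> cinv \<kappa>)"
      by (rule smooth_on_cong) (auto simp: ext_def adm_facts(3)[OF a])
    then show ?thesis using a True by (intro exI[of _ \<kappa>] exI[of _ UNIV]) auto
  next
    case False
    obtain \<mu> where m: "\<mu> \<in> atlas M" "q \<in> fst \<mu>" by (rule atlas_cover)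
    note a' = atlas_adm[OF m(1)]
    let ?W = "- (cinv \<kappa> ` cball p R)"
    have "q \<in> ?W" using False iball_facts(8)[OF b] by auto
    moreover have "open ?W" using iball_facts(5)[OF b] by (rule open_Compl)
    moreover have z: "ext \<kappa> H x = 0" if "x \<in> ?W" for x
      using ext_outside[where H = H, OF b H(2)] that by blast
    moreover have "smooth_on (snd \<mu> ` (UNIV \<inter> ?W \<inter> fst \<mu>)) (ext \<kappa> H \<circ> cinv \<mu>)"
      by (rule smooth_on_cong[OF smooth_on_const[of _ 0]])
        (use z adm_facts(3)[OF a'] in auto)
    ultimately show ?thesis using a' m(2) by blast
  qed
qed

definition good_perturbation ::
  "('m \<Rightarrow> real) \<Rightarrow> real \<Rightarrow> 'm set \<Rightarrow> 'm set \<Rightarrow> ('m \<Rightarrow> real) \<Rightarrow> bool" where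
  "good_perturbation f \<eta> B A g \<longleftrightarrow> smooth_from M UNIV g \<and> (\<forall>q. \<bar>g q - f q\<bar> \<le> \<eta>) \<and>
    (\<forall>q. q \<notin> B \<longrightarrow> g q = f q) \<and> (\<forall>q\<in>A. good g q)"

lemma good_perturbationD:
  assumes "good_perturbation f \<eta> B A g"
  shows "smooth_from M UNIV g" "\<And>q. \<bar>g q - f q\<bar> \<le> \<eta>" "\<And>q. q \<notin> B \<Longrightarrow> g q = f q"
    "\<And>q. q \<in> A \<Longrightarrow> good g q"
  using assms by (auto simp: good_perturbation_def)

text \<open>On \<open>A\<close> inside the coordinate ball goodness survives by the stability in
  \<open>perturb_ball\<close>. Off the closed ball the function is unchanged on an open set, so
  goodness carries over.\<close>

lemma perturb_iball:
  assumes b: "iball \<kappa> p R" and f: "smooth_from M UNIV f"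
    and A: "compact A" "\<And>q. q \<in> A \<Longrightarrow> good f q" and \<eta>: "0 < \<eta>"
  shows "\<exists>g. good_perturbation f \<eta> (cinv \<kappa> ` cball p R) (A \<union> cinv \<kappa> ` cball p (R / 2)) g"
proof -
  note a = iball_facts(1)[OF b] and bf = iball_facts[OF b]
  let ?F = "f \<circ> cinv \<kappa>" and ?B = "cinv \<kappa> ` cball p R"
  let ?A = "snd \<kappa> ` (A \<inter> ?B)"
  have AU: "A \<inter> ?B \<subseteq> fst \<kappa>" using bf(8) by auto
  have cA: "compact ?A"
    by (rule compact_continuous_image[OF continuous_on_subset[OF adm_facts(6)[OF a] AU]])
      (rule compact_Int_closed[OF A(1) bf(5)])
  have A2: "?A \<subseteq> cball p R" using bf(9) by auto
  have pos: "0 < snd \<kappa> q \<bullet> bdir \<and> q \<in> fst \<kappa> \<and> snd \<kappa> q \<in> cball p R" if "q \<in> ?B" for q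
    using that bf(3,8,9) by (auto simp: interior_part_def)
  have A3: "?F x \<noteq> 0 \<or> grad ?F x \<noteq> 0" if "x \<in> ?A" for x
  proof -
    obtain q where q: "q \<in> A" "q \<in> ?B" "x = snd \<kappa> q" using \<open>x \<in> ?A\<close> by blast
    then show ?thesis
      using good_chart[OF a f] A(2)[OF q(1)] pos[OF q(2)] adm_facts(3)[OF a, of q] by auto
  qed
  obtain H where H0: "(\<forall>k. Ck_on k UNIV H) \<and> (\<forall>x. \<bar>H x\<bar> \<le> \<eta>) \<and> (\<forall>x. x \<notin> cball p R \<longrightarrow> H x = 0) \<and>
    (\<forall>x\<in>?A \<union> cball p (R / 2). ?F x + H x \<noteq> 0 \<or> grad (\<lambda>y. ?F y + H y) x \<noteq> 0)"
    using perturb_ball[OF open_interior_part[OF a] interior_part_Ck[OF a f] bf(2,3) cA A2 A3 \<eta>]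
    by (rule exE)
  have H: "\<And>k. Ck_on k UNIV H" "\<And>x. \<bar>H x\<bar> \<le> \<eta>" "\<And>x. x \<notin> cball p R \<Longrightarrow> H x = 0"
    "\<And>x. x \<in> ?A \<union> cball p (R / 2) \<Longrightarrow> ?F x + H x \<noteq> 0 \<or> grad (\<lambda>y. ?F y + H y) x \<noteq> 0"
    using H0 by simp_all
  define g where "g q = f q + ext \<kappa> H q" for q
  have g: "smooth_from M UNIV g"
    unfolding g_def by (rule smooth_from_add[OF f ext_smooth[OF b H(1,3)]])
  have out: "g q = f q" if "q \<notin> ?B" for q
    using ext_outside[where H = H, OF b H(3) that] by (simp add: g_def)
  have gB: "good g q" if q: "q \<in> ?B" "snd \<kappa> q \<in> ?A \<union> cball p (R / 2)" for q
  proof -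
    note qp = pos[OF q(1)]
    have x: "snd \<kappa> q \<in> interior_part \<kappa>" using qp by (simp add: interior_part_def)
    have e: "(g \<circ> cinv \<kappa>) y = ?F y + H y" if "y \<in> interior_part \<kappa>" for y
      using that adm_facts(4,5)[OF a, of y] by (auto simp: g_def ext_def interior_part_def)
    have "(\<lambda>y. ?F y + H y) differentiable (at (snd \<kappa> q))"
      by (intro differentiable_add Ck_on_diff[OF interior_part_Ck[OF a f] x] Ck_on_diff[OF H(1)] UNIV_I)
    from grad_cong[OF open_interior_part[OF a] x this e]
    have "grad (g \<circ> cinv \<kappa>) (snd \<kappa> q) = grad (\<lambda>y. ?F y + H y) (snd \<kappa> q)" .
    moreover have "g q = ?F (snd \<kappa> q) + H (snd \<kappa> q)"
      using e[OF x] adm_facts(3)[OF a, of q] qp by simp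
    ultimately show ?thesis using good_chart[OF a g, of q] qp H(4)[OF q(2)] by auto
  qed
  show ?thesis
    unfolding good_perturbation_def
  proof (intro exI[of _ g] conjI allI impI ballI g)
    show "\<bar>g q - f q\<bar> \<le> \<eta>" for q using H(2) \<eta> by (simp add: g_def ext_def)
    show "g q = f q" if "q \<notin> ?B" for q using out[OF that] .
    fix q assume "q \<in> A \<union> cinv \<kappa> ` cball p (R / 2)"
    then consider "q \<in> A \<inter> ?B" | "q \<in> A" "q \<notin> ?B" | "q \<in> cinv \<kappa> ` cball p (R / 2)" by blast
    then show "good g q"
    proof cases
      case 1
      then show ?thesis using gB by blast
    next
      case 2
      have "open (- ?B)" using bf(5) by (rule open_Compl)
      then show ?thesis using good_cong[OF f, of "- ?B" q g] 2 out A(2) by auto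
    next
      case 3
      then obtain x where x: "x \<in> cball p (R / 2)" "q = cinv \<kappa> x" by blast
      then have "x \<in> cball p R" using bf(11) by blast
      then show ?thesis using gB[of q] x bf(9) by auto
    qed
  qed
qed

abbreviation outer :: "(('m, 'v) chart \<times> 'v \<times> real) set \<Rightarrow> 'm set" where
  "outer I \<equiv> \<Union>(\<kappa>, p, R)\<in>I. cinv \<kappa> ` cball p R"

abbreviation half_closed :: "(('m, 'v) chart \<times> 'v \<times> real) set \<Rightarrow> 'm set" where
  "half_closed I \<equiv> \<Union>(\<kappa>, p, R)\<in>I. cinv \<kappa> ` cball p (R / 2)"

abbreviation half_open :: "(('m, 'v) chart \<times> 'v \<times> real) set \<Rightarrow> 'm set" where
  "half_open I \<equiv> \<Union>(\<kappa>, p, R)\<in>I. cinv \<kappa> ` ball p (R / 2)"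

text \<open>Balls are treated one at a time. The set already made good is compact, hence protected
  in the next step, and each induction step splits the allowed size into two halves.\<close>

lemma perturb_finite:
  assumes I: "finite I" "\<And>\<kappa> p R. (\<kappa>, p, R) \<in> I \<Longrightarrow> iball \<kappa> p R"
    and f: "smooth_from M UNIV f" and A: "compact A" "\<And>q. q \<in> A \<Longrightarrow> good f q" and \<eta>: "0 < \<eta>"
  shows "\<exists>g. good_perturbation f \<eta> (outer I)
    (A \<union> half_closed I) g"
  using I \<eta>
proof (induction I arbitrary: \<eta> rule: finite_induct)
  case empty
  then show ?case using f A by (intro exI[of _ f]) (auto simp: good_perturbation_def)
next
  case (insert i I)
  obtain \<kappa> p R where i: "i = (\<kappa>, p, R)" by (cases i) auto
  have b: "iball \<kappa> p R" using insert.prems i by blast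
  let ?A = "A \<union> half_closed I"
  have "\<exists>g. good_perturbation f (\<eta> / 2) (outer I) ?A g"
    by (rule insert.IH) (use insert.prems in auto)
  then obtain g where "good_perturbation f (\<eta> / 2) (outer I) ?A g" ..
  note g = good_perturbationD[OF this]
  have "compact (case j of (\<kappa>, p, R) \<Rightarrow> cinv \<kappa> ` cball p (R / 2))" if "j \<in> I" for j
    using that insert.prems(1) iball_facts(7) by (cases j) auto
  then have cA: "compact ?A" using A(1) insert.hyps(1) by (intro compact_Un compact_UN) auto
  have \<eta>2: "0 < \<eta> / 2" using insert.prems by simp
  obtain h where
    "good_perturbation g (\<eta> / 2) (cinv \<kappa> ` cball p R) (?A \<union> cinv \<kappa> ` cball p (R / 2)) h"
    using perturb_iball[OF b g(1) cA g(4) \<eta>2] by (rule exE)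
  note h = good_perturbationD[OF this]
  show ?case
    unfolding good_perturbation_def
  proof (intro exI[of _ h] conjI allI impI ballI)
    show "smooth_from M UNIV h" by (rule h(1))
    show "\<bar>h q - f q\<bar> \<le> \<eta>" for q using h(2)[of q] g(2)[of q] by linarith
    show "h q = f q" if "q \<notin> outer (insert i I)" for q
      using that h(3)[of q] g(3)[of q] by (auto simp: i)
    show "good h q" if "q \<in> A \<union> half_closed (insert i I)" for q
      using that h(4)[of q] by (auto simp: i)
  qed
qed

end


section \<open>Sublevel sets\<close>

text \<open>The definition of submanifold insists on \<open>inv_into\<close> as the inverse. Any
  explicit left inverse \<open>g\<close> agrees with it on the image and can be used to verify
  smoothness.\<close>

lemma local_chart:
  fixes \<psi> :: "'m::topological_space \<Rightarrow> 'v::euclidean_space"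
  assumes "open V" "p \<in> V" "relopen (\<psi> ` (S \<inter> V))"
    and c: "continuous_on (S \<inter> V) \<psi>" and inv: "\<And>q. q \<in> S \<inter> V \<Longrightarrow> g (\<psi> q) = q"
    and s: "smooth_from M (S \<inter> V) \<psi>" and g: "smooth_into M (\<psi> ` (S \<inter> V)) g"
  shows "\<exists>V (\<psi> :: 'm \<Rightarrow> 'v). open V \<and> p \<in> V \<and> relopen (\<psi> ` (S \<inter> V)) \<and>
        homeomorphism (S \<inter> V) (\<psi> ` (S \<inter> V)) \<psi> (inv_into (S \<inter> V) \<psi>) \<and>
        smooth_from M (S \<inter> V) \<psi> \<and> smooth_into M (\<psi> ` (S \<inter> V)) (inv_into (S \<inter> V) \<psi>)"
proof -
  let ?A = "\<psi> ` (S \<inter> V)"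
  have inj: "inj_on \<psi> (S \<inter> V)" using inv by (rule inj_on_inverseI)
  have e: "inv_into (S \<inter> V) \<psi> z = g z" if "z \<in> ?A" for z
    using that inv inv_into_f_f[OF inj] by fastforce
  have cg: "continuous_on ?A g" using g by (simp add: smooth_into_def)
  have "continuous_on ?A (inv_into (S \<inter> V) \<psi>)" by (rule continuous_on_eq[OF cg]) (simp add: e)
  moreover have "g ` ?A = S \<inter> V" using inv by force
  then have "inv_into (S \<inter> V) \<psi> ` ?A = S \<inter> V" using e by force
  ultimately have "homeomorphism (S \<inter> V) ?A \<psi> (inv_into (S \<inter> V) \<psi>)"
    unfolding homeomorphism_def using c e inv by auto
  moreover have "smooth_into M ?A (inv_into (S \<inter> V) \<psi>)"
    unfolding smooth_into_def
  proof (intro conjI ballI)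
    show "continuous_on ?A (inv_into (S \<inter> V) \<psi>)" by fact
    fix \<kappa> assume "\<kappa> \<in> atlas M"
    then have "smooth_on (?A \<inter> g -` fst \<kappa>) (snd \<kappa> \<circ> g)" using g by (simp add: smooth_into_def)
    moreover have "?A \<inter> g -` fst \<kappa> = ?A \<inter> inv_into (S \<inter> V) \<psi> -` fst \<kappa>" using e by auto
    ultimately have "smooth_on (?A \<inter> inv_into (S \<inter> V) \<psi> -` fst \<kappa>) (snd \<kappa> \<circ> g)" by simp
    then show "smooth_on (?A \<inter> inv_into (S \<inter> V) \<psi> -` fst \<kappa>) (snd \<kappa> \<circ> inv_into (S \<inter> V) \<psi>)"
      by (rule smooth_on_cong) (simp add: e)
  qed
  ultimately show ?thesis using assms by blast
qed

text \<open>The function \<open>- F\<close> can be used as the coordinate along \<open>bdir\<close>, after shearing by a vector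
  \<open>u\<close> tangent to the boundary of the half-space such that \<open>F\<close> has nonzero derivative in the
  direction of \<open>bdir - u\<close>.\<close>

lemma straighten:
  fixes F :: "'v::euclidean_space \<Rightarrow> real"
  assumes O: "open O'" and F: "\<And>k. Ck_on k O' F" and x0: "x0 \<in> O'" "grad F x0 \<noteq> 0"
  shows "\<exists>U (V :: 'v set) \<Psi> G. open U \<and> U \<subseteq> O' \<and> x0 \<in> U \<and> open V \<and> homeomorphism U V \<Psi> G \<and>
    (\<forall>k. Ck_on k U \<Psi>) \<and> (\<forall>k. Ck_on k V G) \<and> (\<forall>x. \<Psi> x \<bullet> bdir = - F x)"
proof -
  \<comment> \<open>If the derivative along \<open>bdir\<close> vanishes, then
    \<open>grad F x0\<close> is itself tangential, and taking it as \<open>u\<close> gives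
    \<open>grad F x0 \<bullet> e = - (norm (grad F x0)) ^ 2\<close>, which is nonzero.\<close>
  define u where "u = (if grad F x0 \<bullet> bdir \<noteq> 0 then 0 else grad F x0)"
  define e where "e = bdir - u"
  have ub: "u \<bullet> bdir = 0" by (simp add: u_def)
  have e0: "grad F x0 \<bullet> e \<noteq> 0" using x0(2) by (auto simp: e_def u_def inner_diff_right)
  define d where "d x = grad F x \<bullet> e" for x
  note Cg = Ck_on_grad[OF O F]
  have Cd: "Ck_on k O' d" for k unfolding d_def by (intro Ck_on_inner Ck_on_const O Cg)
  define O1 where "O1 = O' \<inter> d -` (- {0})"
  have O1: "open O1" unfolding O1_def
    by (rule continuous_open_preimage[OF Ck_on_continuous[OF Cd] O]) auto
  have x1: "x0 \<in> O1" using x0 e0 by (simp add: O1_def d_def)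
  have sub1: "O1 \<subseteq> O'" by (auto simp: O1_def)
  define \<Psi> where "\<Psi> x = tang x + (x \<bullet> bdir) *\<^sub>R u + (- F x) *\<^sub>R bdir" for x
  define L where "L x v = tang v + (v \<bullet> bdir) *\<^sub>R u + (- (grad F x \<bullet> v)) *\<^sub>R bdir" for x v
  \<comment> \<open>The inverse of \<open>L x\<close>, found by solving for the \<open>bdir\<close>
    component \<open>s\<close> of \<open>v\<close>: the tangential part of the image is
    \<open>tang v + s *\<^sub>R u\<close>, so \<open>v\<close> is that part plus
    \<open>s *\<^sub>R e\<close>, and the remaining equation gives \<open>s\<close> after division
    by \<open>d x\<close>.\<close>
  define N where "N x z = tang z + (- (z \<bullet> bdir + grad F x \<bullet> tang z) * inverse (d x)) *\<^sub>R e" for x z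
  have blL: "bounded_linear (L x)" for x
    unfolding L_def
    by (intro bounded_linear_add bounded_linear_tang bounded_linear_scaleR_const bounded_linear_minus
        bounded_linear_inner_left bounded_linear_inner_right)
  have blN: "bounded_linear (N x)" for x
    unfolding N_def
    by (intro bounded_linear_add bounded_linear_tang bounded_linear_scaleR_const bounded_linear_minus
        bounded_linear_mult_const bounded_linear_inner_left
        bounded_linear_compose[OF bounded_linear_inner_right bounded_linear_tang])
  have NL: "N x (L x v) = v" if "d x \<noteq> 0" for x v
  proof -
    let ?s = "v \<bullet> bdir"
    have t: "tang (L x v) = tang v + ?s *\<^sub>R u" "L x v \<bullet> bdir = - (grad F x \<bullet> v)"
      using ub by (simp_all add: L_def tang_def inner_add_left inner_diff_left algebra_simps)
    have "grad F x \<bullet> v = grad F x \<bullet> (tang v + ?s *\<^sub>R bdir)" by (simp add: tang_decomp)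
    then have "- (L x v \<bullet> bdir + grad F x \<bullet> tang (L x v)) = ?s * d x"
      unfolding t d_def e_def by (simp add: inner_add_right inner_diff_right algebra_simps)
    then have "N x (L x v) = tang v + ?s *\<^sub>R u + ?s *\<^sub>R e"
      using that by (simp add: N_def t mult.assoc)
    also have "\<dots> = v" using tang_decomp[of v] by (simp add: e_def algebra_simps)
    finally show ?thesis .
  qed
  have der: "(\<Psi> has_derivative L x) (at x)" if "x \<in> O'" for x
    unfolding \<Psi>_def L_def
    by (intro has_derivative_add has_derivative_scaleR_left has_derivative_minus
        bounded_linear_imp_has_derivative[OF bounded_linear_tang]
        bounded_linear_imp_has_derivative[OF bounded_linear_inner_left]
        grad_derivative Ck_on_diff[OF F that])
  define f' where "f' x = Blinfun (L x)" for x
  have f': "blinfun_apply (f' x) = L x" for x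
    by (simp add: f'_def bounded_linear_Blinfun_apply blL)
  have der': "(\<Psi> has_derivative blinfun_apply (f' x)) (at x)" if "x \<in> O1" for x
    using der sub1 that by (auto simp: f')
  have contf': "continuous_on O1 f'"
  proof (rule continuous_on_blinfun_componentwise)
    fix i :: 'v
    show "continuous_on O1 (\<lambda>x. blinfun_apply (f' x) i)"
      unfolding f' L_def
      by (intro continuous_intros continuous_on_subset[OF Ck_on_continuous[OF Cg] sub1])
  qed
  have invf: "Blinfun (N x0) o\<^sub>L f' x0 = id_blinfun"
    using NL[of x0] e0
    by (intro blinfun_eqI) (simp add: f' bounded_linear_Blinfun_apply blN d_def)
  obtain U V G g' where
    UV: "open U" "U \<subseteq> O1" "x0 \<in> U" "open V" "\<Psi> x0 \<in> V" "homeomorphism U V \<Psi> G"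
    and G: "\<And>y. y \<in> V \<Longrightarrow> (G has_derivative (g' y)) (at y)"
      "\<And>y. y \<in> V \<Longrightarrow> g' y = inv (blinfun_apply (f' (G y)))"
      "\<And>y. y \<in> V \<Longrightarrow> bij (blinfun_apply (f' (G y)))"
    using inverse_function_theorem[OF O1 der' contf' x1 invf] by metis
  have GV: "G y \<in> U" if "y \<in> V" for y using UV(6) that by (auto simp: homeomorphism_def)
  have g': "g' y = N (G y)" if y: "y \<in> V" for y
  proof
    fix z
    have "d (G y) \<noteq> 0" using GV[OF y] UV(2) by (auto simp: O1_def)
    moreover have b: "bij (L (G y))" using G(3)[OF y] by (simp add: f')
    moreover obtain v where "z = L (G y) v" using b by (metis bij_pointE)
    ultimately show "g' y z = N (G y) z"
      using G(2)[OF y] by (simp add: f' NL bij_is_inj)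
  qed
  have CG: "Ck_on k V G" for k
  \<comment> \<open>The derivative of \<open>G\<close> is \<open>N\<close> evaluated along
    \<open>G\<close>, built from \<open>grad F\<close> and \<open>1 / d\<close>. Each order of
    smoothness of \<open>G\<close> hence yields the next.\<close>
  proof (rule Ck_on_bootstrap[OF UV(4) G(1)])
    fix k v assume k: "Ck_on k V G"
    have GO: "G ` V \<subseteq> O'" "G ` V \<subseteq> O1" using GV UV(2) sub1 by auto
    have 1: "Ck_on k V (\<lambda>y. grad F (G y))" by (rule Ck_on_compose[OF UV(4) O GO(1) k Cg])
    have 2: "Ck_on k V (\<lambda>y. d (G y))" by (rule Ck_on_compose[OF UV(4) O GO(1) k Cd])
    have "Ck_on k V (\<lambda>y. N (G y) v)"
      unfolding N_def
      by (intro Ck_on_add Ck_on_scaleR Ck_on_mult Ck_on_const Ck_on_inverse Ck_on_inner 1 2 UV(4)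
          Ck_on_bounded_linear[OF bounded_linear_minus[OF bounded_linear_ident]])
        (use GO(2) in \<open>auto simp: O1_def\<close>)
    then show "Ck_on k V (\<lambda>y. g' y v)" by (rule Ck_on_cong[OF UV(4), rotated]) (simp add: g')
  qed
  have C\<Psi>: "Ck_on k U \<Psi>" for k
    unfolding \<Psi>_def
    by (intro Ck_on_add Ck_on_scaleR Ck_on_const Ck_on_linear bounded_linear_tang bounded_linear_inner_left
        Ck_on_bounded_linear[OF bounded_linear_minus[OF bounded_linear_ident]] UV(1)
        Ck_on_subset[OF F]) (use UV(2) sub1 in auto)
  have "\<Psi> x \<bullet> bdir = - F x" for x using ub by (simp add: \<Psi>_def inner_add_left inner_diff_left)
  then show ?thesis
    using UV sub1
    by (rule_tac exI[of _ U], rule_tac exI[of _ V], rule_tac exI[of _ \<Psi>], rule_tac exI[of _ G])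
      (intro conjI allI C\<Psi> CG, auto)
qed

context smooth_mfd
begin

text \<open>Where \<open>f\<close> is negative the sublevel set is a neighbourhood in
  \<open>M\<close>, and charts of \<open>M\<close> serve, at boundary points of \<open>M\<close>
  too. A zero lies in the interior with nonzero gradient, so \<open>straighten\<close> makes
  \<open>- f\<close> the coordinate along \<open>bdir\<close> and the sublevel set becomes the
  half-space.\<close>

lemma sublevel_submanifold:
  assumes f: "smooth_from M UNIV f" and good: "\<And>q. good f q"
  shows "full_submanifold M {q. f q \<le> 0}"
  unfolding full_submanifold_def
proof (intro conjI ballI)
  let ?S = "{q. f q \<le> 0}"
  note cf = smooth_from_continuous[OF f]
  show "closed ?S" using cf by (intro closed_Collect_le continuous_intros)
  fix p assume "p \<in> ?S"
  then consider "f p < 0" | "f p = 0" by fastforce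
  then show "\<exists>V (\<psi> :: 'm \<Rightarrow> 'v). open V \<and> p \<in> V \<and> relopen (\<psi> ` (?S \<inter> V)) \<and>
        homeomorphism (?S \<inter> V) (\<psi> ` (?S \<inter> V)) \<psi> (inv_into (?S \<inter> V) \<psi>) \<and>
        smooth_from M (?S \<inter> V) \<psi> \<and> smooth_into M (\<psi> ` (?S \<inter> V)) (inv_into (?S \<inter> V) \<psi>)"
  proof cases
    case 1
    obtain \<kappa> where k: "\<kappa> \<in> atlas M" "p \<in> fst \<kappa>" by (rule atlas_cover)
    note a = atlas_adm[OF k(1)]
    define W where "W = {q. f q < 0}"
    have W: "open W" unfolding W_def using cf by (intro open_Collect_less continuous_intros)
    have SV: "?S \<inter> (W \<inter> fst \<kappa>) = W \<inter> fst \<kappa>" by (auto simp: W_def)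
    have sid: "smooth_on T (\<lambda>x::'v. x)" for T by (rule smooth_on_linear[OF bounded_linear_ident])
    show ?thesis
    proof (rule local_chart[of "W \<inter> fst \<kappa>" p "snd \<kappa>" ?S "cinv \<kappa>"], unfold SV)
      show "open (W \<inter> fst \<kappa>)" using W adm_facts(1)[OF a] by auto
      show "p \<in> W \<inter> fst \<kappa>" using 1 k by (simp add: W_def)
      show "relopen (snd \<kappa> ` (W \<inter> fst \<kappa>))" by (rule chart_relopen[OF adm_chart[OF a] W])
      show "continuous_on (W \<inter> fst \<kappa>) (snd \<kappa>)" by (rule continuous_on_subset[OF adm_facts(6)[OF a]]) auto
      show "cinv \<kappa> (snd \<kappa> q) = q" if "q \<in> W \<inter> fst \<kappa>" for q using that adm_facts(3)[OF a] by auto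
      show "smooth_from M (W \<inter> fst \<kappa>) (snd \<kappa>)"
      proof (rule smooth_fromI_chart[OF a])
        show "smooth_on (snd \<kappa> ` (W \<inter> fst \<kappa>)) (snd \<kappa> \<circ> cinv \<kappa>)"
          by (rule smooth_on_cong[OF sid]) (auto simp: adm_facts(3)[OF a])
      qed auto
      show "smooth_into M (snd \<kappa> ` (W \<inter> fst \<kappa>)) (cinv \<kappa>)"
      proof (rule smooth_intoI_chart[OF a])
        show "continuous_on (snd \<kappa> ` (W \<inter> fst \<kappa>)) (cinv \<kappa>)"
          by (rule continuous_on_subset[OF adm_facts(7)[OF a]]) auto
        show "smooth_on (snd \<kappa> ` (W \<inter> fst \<kappa>)) (snd \<kappa> \<circ> cinv \<kappa>)"
          by (rule smooth_on_cong[OF sid]) (auto simp: adm_facts(3)[OF a])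
      qed (use adm_facts(4)[OF a] in auto)
    qed
  next
    case 2
    then have pb: "p \<notin> bdry M" using good[of p] by (simp add: good_def)
    obtain \<kappa> where k: "\<kappa> \<in> atlas M" "p \<in> fst \<kappa>" by (rule atlas_cover)
    note a = atlas_adm[OF k(1)]
    have pos: "0 < snd \<kappa> p \<bullet> bdir"
      using bdry_iff[OF a k(2)] chart_inner_bdir_nonneg[OF a k(2)] pb by linarith
    let ?F = "f \<circ> cinv \<kappa>" and ?x = "snd \<kappa> p"
    have x: "?x \<in> interior_part \<kappa>" using k pos by (simp add: interior_part_def)
    have g0: "grad ?F ?x \<noteq> 0" using good[of p] good_chart[OF a f k(2) pos] 2 by simp
    obtain U V and \<Psi> :: "'v \<Rightarrow> 'v" and G where
      st: "open U \<and> U \<subseteq> interior_part \<kappa> \<and> ?x \<in> U \<and> open V \<and> homeomorphism U V \<Psi> G \<and>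
        (\<forall>k. Ck_on k U \<Psi>) \<and> (\<forall>k. Ck_on k V G) \<and> (\<forall>x. \<Psi> x \<bullet> bdir = - ?F x)"
      using straighten[OF open_interior_part[OF a] interior_part_Ck[OF a f] x g0]
      by (elim exE)
    have UV: "open U" "U \<subseteq> interior_part \<kappa>" "?x \<in> U" "open V" "homeomorphism U V \<Psi> G"
      and C: "\<And>k. Ck_on k U \<Psi>" "\<And>k. Ck_on k V G" and \<Psi>: "\<And>x. \<Psi> x \<bullet> bdir = - ?F x"
      using st by simp_all
    have im: "U \<subseteq> snd \<kappa> ` fst \<kappa>" using UV(2) by (auto simp: interior_part_def)
    have h: "G (\<Psi> z) = z" "\<Psi> z \<in> V" if "z \<in> U" for z using UV(5) that by (auto simp: homeomorphism_def)
    have h': "\<Psi> (G y) = y" "G y \<in> U" if "y \<in> V" for y using UV(5) that by (auto simp: homeomorphism_def)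
    define W where "W = cinv \<kappa> ` U"
    have "U = half_space \<inter> U" using UV(2) by (auto simp: interior_part_def half_space_def)
    then have "relopen U" using UV(1) by (metis openin_open)
    then have W: "open W" unfolding W_def by (rule chart_cinv_open[OF adm_chart[OF a] _ im])
    have Wk: "q \<in> fst \<kappa>" "snd \<kappa> q \<in> U" if "q \<in> W" for q
      using that im adm_facts(4,5)[OF a] by (auto simp: W_def)
    have WU: "cinv \<kappa> z \<in> W" "snd \<kappa> (cinv \<kappa> z) = z" if "z \<in> U" for z
      using that im adm_facts(5)[OF a] by (auto simp: W_def)
    have image: "(\<Psi> \<circ> snd \<kappa>) ` (?S \<inter> W) = half_space \<inter> V"
    proof (intro equalityI subsetI)
      fix y assume "y \<in> (\<Psi> \<circ> snd \<kappa>) ` (?S \<inter> W)"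
      then obtain q where q: "f q \<le> 0" "q \<in> W" "y = \<Psi> (snd \<kappa> q)" by auto
      then show "y \<in> half_space \<inter> V"
        using h(2)[OF Wk(2)[OF q(2)]] adm_facts(3)[OF a Wk(1)[OF q(2)]] by (simp add: half_space_def \<Psi>)
    next
      fix y assume y: "y \<in> half_space \<inter> V"
      let ?q = "cinv \<kappa> (G y)"
      have "f ?q = - (y \<bullet> bdir)" using \<Psi>[of "G y"] h'(1)[of y] y by simp
      then have "?q \<in> ?S \<inter> W" using y WU(1)[OF h'(2)[of y]] by (auto simp: half_space_def)
      moreover have "(\<Psi> \<circ> snd \<kappa>) ?q = y" using y WU(2)[OF h'(2)[of y]] h'(1)[of y] by simp
      ultimately show "y \<in> (\<Psi> \<circ> snd \<kappa>) ` (?S \<inter> W)" by (metis imageI)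
    qed
    show ?thesis
    proof (rule local_chart[of W p "\<Psi> \<circ> snd \<kappa>" ?S "cinv \<kappa> \<circ> G"], unfold image)
      show "open W" by (rule W)
      show "p \<in> W" using UV(3) adm_facts(3)[OF a k(2)] unfolding W_def by (metis imageI)
      show "relopen (half_space \<inter> V)" using UV(4) by (auto simp: openin_open)
      have 1: "continuous_on (?S \<inter> W) (snd \<kappa>)"
        by (rule continuous_on_subset[OF adm_facts(6)[OF a]]) (use Wk in auto)
      show "continuous_on (?S \<inter> W) (\<Psi> \<circ> snd \<kappa>)"
        unfolding o_def
        by (rule continuous_on_compose2[OF Ck_on_continuous[OF C(1)] 1]) (use Wk in auto)
      show "(cinv \<kappa> \<circ> G) ((\<Psi> \<circ> snd \<kappa>) q) = q" if "q \<in> ?S \<inter> W" for q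
        using that h(1)[OF Wk(2)] adm_facts(3)[OF a Wk(1)] by simp
      show "smooth_from M (?S \<inter> W) (\<Psi> \<circ> snd \<kappa>)"
      proof (rule smooth_fromI_chart[OF a])
        have "smooth_on (snd \<kappa> ` (?S \<inter> W)) \<Psi>"
          by (rule smooth_on_subset[OF smooth_onI_open[OF UV(1) C(1)]]) (use Wk in auto)
        then show "smooth_on (snd \<kappa> ` (?S \<inter> W)) ((\<Psi> \<circ> snd \<kappa>) \<circ> cinv \<kappa>)"
          by (rule smooth_on_cong) (auto simp: adm_facts(3)[OF a] Wk)
      qed (use Wk in auto)
      have GU: "G ` (half_space \<inter> V) \<subseteq> U" using h'(2) by auto
      have sG: "smooth_on (half_space \<inter> V) G"
        by (rule smooth_on_subset[OF smooth_onI_open[OF UV(4) C(2)]]) auto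
      show "smooth_into M (half_space \<inter> V) (cinv \<kappa> \<circ> G)"
      proof (rule smooth_intoI_chart[OF a])
        show "continuous_on (half_space \<inter> V) (cinv \<kappa> \<circ> G)"
          unfolding o_def
          by (rule continuous_on_compose2[OF adm_facts(7)[OF a] smooth_on_continuous[OF sG]]) (use GU im in auto)
        show "smooth_on (half_space \<inter> V) (snd \<kappa> \<circ> (cinv \<kappa> \<circ> G))"
          by (rule smooth_on_cong[OF sG]) (use WU(2) h'(2) in auto)
      qed (use WU(1) Wk(1) h'(2) in auto)
    qed
  qed
qed

end


section \<open>Construction of the almost compact essential support\<close>

context smooth_mfd
begin

lemma iball_cover:
  assumes Y: "compact Y" "Y \<inter> bdry M = {}"
  obtains I where "finite I" "\<And>\<kappa> p R. (\<kappa>, p, R) \<in> I \<Longrightarrow> iball \<kappa> p R"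
    "Y \<subseteq> half_open I"
proof -
  let ?B = "\<lambda>(\<kappa>, p, R). cinv \<kappa> ` ball p (R / 2)"
  let ?J = "{(\<kappa>, p, R). iball \<kappa> p R}"
  have op: "open (?B j)" if "j \<in> ?J" for j using that iball_facts(6) by (cases j) auto
  have "Y \<subseteq> (\<Union>j\<in>?J. ?B j)"
  proof
    fix q assume "q \<in> Y"
    then have "q \<notin> bdry M" using Y(2) by auto
    then obtain \<kappa> p R where "iball \<kappa> p R" "q \<in> cinv \<kappa> ` ball p (R / 2)" by (rule iball_exists)
    then show "q \<in> (\<Union>j\<in>?J. ?B j)" by (intro UN_I[of "(\<kappa>, p, R)"]) auto
  qed
  from compactE_image[OF Y(1) op this] obtain I where "I \<subseteq> ?J" "finite I" "Y \<subseteq> (\<Union>j\<in>I. ?B j)" by metis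
  then show thesis using that by blast
qed

lemma smooth_from_sum:
  "(\<And>i. i \<in> I \<Longrightarrow> smooth_from M S (f i)) \<Longrightarrow> smooth_from M S (\<lambda>q. \<Sum>i\<in>I. f i q)"
  by (induction I rule: infinite_finite_induct) (auto intro: smooth_from_const smooth_from_add)

lemma smooth_from_mult_const:
  fixes f :: "'m \<Rightarrow> real"
  assumes "smooth_from M S f"
  shows "smooth_from M S (\<lambda>q. c * f q)"
  unfolding smooth_from_def
proof
  fix \<kappa> assume "\<kappa> \<in> atlas M"
  then have "smooth_on (snd \<kappa> ` (S \<inter> fst \<kappa>)) (f \<circ> cinv \<kappa>)" using assms by (simp add: smooth_from_def)
  from smooth_on_compose[OF this smooth_on_linear[OF bounded_linear_mult_right, of UNIV c]]
  show "smooth_on (snd \<kappa> ` (S \<inter> fst \<kappa>)) ((\<lambda>q. c * f q) \<circ> cinv \<kappa>)" by (simp add: o_def)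
qed

lemma compact_iballs:
  assumes "finite I" "\<And>\<kappa> p R. (\<kappa>, p, R) \<in> I \<Longrightarrow> iball \<kappa> p R"
  shows "compact (outer I)"
    "open (half_open I)"
proof -
  have "compact (case j of (\<kappa>, p, R) \<Rightarrow> cinv \<kappa> ` cball p R)" if "j \<in> I" for j
    using that assms(2) iball_facts(4) by (cases j) auto
  then show "compact (outer I)" using assms(1) by (intro compact_UN) auto
  have "open (case j of (\<kappa>, p, R) \<Rightarrow> cinv \<kappa> ` ball p (R / 2))" if "j \<in> I" for j
    using that assms(2) iball_facts(6) by (cases j) auto
  then show "open (half_open I)" by (intro open_UN) auto
qed

definition bump_sum :: "(('m, 'v) chart \<times> 'v \<times> real) set \<Rightarrow> 'm \<Rightarrow> real" where
  "bump_sum I q = (\<Sum>(\<kappa>, p, R)\<in>I. ext \<kappa> (bump p R) q)"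

lemma bump_sum:
  assumes I: "finite I" "\<And>\<kappa> p R. (\<kappa>, p, R) \<in> I \<Longrightarrow> iball \<kappa> p R"
  shows "smooth_from M UNIV (bump_sum I)" "0 \<le> bump_sum I q"
    "q \<notin> outer I \<Longrightarrow> bump_sum I q = 0"
    "q \<in> half_open I \<Longrightarrow> 1 \<le> bump_sum I q"
proof -
  have sm: "smooth_from M UNIV (ext \<kappa> (bump p R))" if "(\<kappa>, p, R) \<in> I" for \<kappa> p R
  proof -
    note b = I(2)[OF that]
    show ?thesis by (rule ext_smooth[OF b Ck_on_bump bump_props(3)[OF iball_facts(2)[OF b]]])
  qed
  have "smooth_from M UNIV (\<lambda>q. \<Sum>i\<in>I. case i of (\<kappa>, p, R) \<Rightarrow> ext \<kappa> (bump p R) q)"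
  proof (rule smooth_from_sum)
    fix i assume "i \<in> I"
    then show "smooth_from M UNIV (\<lambda>q. case i of (\<kappa>, p, R) \<Rightarrow> ext \<kappa> (bump p R) q)"
      using sm by (cases i) simp
  qed
  then show "smooth_from M UNIV (bump_sum I)" by (simp add: bump_sum_def[abs_def])
  have nn: "0 \<le> (case i of (\<kappa>, p, R) \<Rightarrow> ext \<kappa> (bump p R) q)" if "i \<in> I" for i
  proof -
    obtain \<kappa> p R where ie: "i = (\<kappa>, p, R)" by (cases i) auto
    note b = I(2)[OF that[unfolded ie]]
    show ?thesis by (simp add: ie ext_def bump_props(1)[OF iball_facts(2)[OF b]])
  qed
  then show "0 \<le> bump_sum I q" unfolding bump_sum_def by (rule sum_nonneg)
  show "bump_sum I q = 0" if q: "q \<notin> outer I"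
    unfolding bump_sum_def
  proof (rule sum.neutral, rule ballI)
    fix i assume i: "i \<in> I"
    obtain \<kappa> p R where ie: "i = (\<kappa>, p, R)" by (cases i) auto
    note b = I(2)[OF i[unfolded ie]]
    have "q \<notin> cinv \<kappa> ` cball p R" using q i ie by blast
    from ext_outside[OF b bump_props(3)[OF iball_facts(2)[OF b]] this]
    show "(case i of (\<kappa>, p, R) \<Rightarrow> ext \<kappa> (bump p R) q) = 0" by (simp add: ie)
  qed
  show "1 \<le> bump_sum I q" if q: "q \<in> half_open I"
  proof -
    obtain i where i: "i \<in> I" "q \<in> (case i of (\<kappa>, p, R) \<Rightarrow> cinv \<kappa> ` ball p (R / 2))"
      using q by blast
    obtain \<kappa> p R where ie: "i = (\<kappa>, p, R)" by (cases i) auto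
    note b = I(2)[OF i(1)[unfolded ie]]
    obtain x where x: "x \<in> ball p (R / 2)" "q = cinv \<kappa> x" using i(2) ie by auto
    have "x \<in> cball p (R / 2)" using x(1) by auto
    moreover have "x \<in> cball p R" using calculation iball_facts(11)[OF b] by blast
    ultimately have "ext \<kappa> (bump p R) q = 1"
      using iball_facts(8,9)[OF b] bump_props(5)[OF iball_facts(2)[OF b]] x(2) by (simp add: ext_def)
    then have "1 \<le> (case i of (\<kappa>, p, R) \<Rightarrow> ext \<kappa> (bump p R) q)" by (simp add: ie)
    also have "\<dots> \<le> bump_sum I q"
      unfolding bump_sum_def by (rule member_le_sum[OF i(1) _ I(1)]) (use nn in auto)
    finally show ?thesis .
  qed
qed

end

section \<open>The cut-off collar coordinate and the final domain\<close>

context collar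
begin

text \<open>The step rises from 0 at \<open>r / 2\<close> to 1 at \<open>3 * r / 4\<close>, so the
  value passes from \<open>t\<close> to the constant \<open>r\<close>.\<close>

definition cutoff :: "real \<Rightarrow> real" where
  "cutoff t = t + step ((4 / r) * t + - 2) * (r + - t)"

lemma cutoff_props:
  "t \<le> r / 2 \<Longrightarrow> cutoff t = t" "3 * r / 4 \<le> t \<Longrightarrow> cutoff t = r"
  "t \<le> r \<Longrightarrow> t \<le> cutoff t" "t \<le> r \<Longrightarrow> cutoff t \<le> r"
proof -
  note s = step_props[of "(4 / r) * t + - 2"]
  show "cutoff t = t" if "t \<le> r / 2"
    using s(3) that r_pos by (simp add: cutoff_def field_simps)
  show "cutoff t = r" if "3 * r / 4 \<le> t"
    using s(4) that r_pos by (simp add: cutoff_def field_simps)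
  show "t \<le> cutoff t" if "t \<le> r" using s(1) that by (simp add: cutoff_def)
  show "cutoff t \<le> r" if "t \<le> r"
    using mult_right_mono[OF s(2), of "r + - t"] that by (simp add: cutoff_def)
qed

lemma Ck_on_cutoff: "Ck_on k UNIV cutoff"
proof -
  have "Ck_on k UNIV (\<lambda>t. step ((4 / r) * t + - 2))"
    by (rule Ck_on_compose[OF open_UNIV open_UNIV subset_UNIV _ Ck_on_step])
      (intro Ck_on_add Ck_on_mult Ck_on_const Ck_on_id open_UNIV)
  then show ?thesis
    unfolding cutoff_def
    by (intro Ck_on_add Ck_on_mult Ck_on_const Ck_on_id open_UNIV
        Ck_on_bounded_linear[OF bounded_linear_minus[OF bounded_linear_ident]])
qed

text \<open>Beyond \<open>3 * r / 4\<close> the cutoff is already \<open>r\<close>, so both branches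
  agree on the rest of the collar. The threshold is strictly below \<open>r\<close>, so that
  \<open>closed_collar_part\<close> applies.\<close>

definition height :: "'m \<Rightarrow> real" where
  "height q = (if q \<in> Z \<and> tc q \<le> 3 * r / 4 then cutoff (tc q) else r)"

lemma height_Z: "q \<in> Z \<Longrightarrow> height q = cutoff (tc q)"
  using cutoff_props(2) by (simp add: height_def)

lemma height_le: "height q \<le> r"
  using cutoff_props(4) Z_coords(2) by (fastforce simp: height_def)

lemma height_small:
  assumes "height q < r / 2"
  shows "q \<in> Z" "tc q = height q"
proof -
  show q: "q \<in> Z" using assms r_pos by (cases "q \<in> Z") (auto simp: height_def)
  then have "tc q < r / 2"
    using cutoff_props(3)[of "tc q"] Z_coords(2)[OF q] assms by (simp add: height_Z)
  then show "tc q = height q" using cutoff_props(1) q by (simp add: height_Z)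
qed

lemma height_bdry: "y \<in> bdry M \<Longrightarrow> height y = 0"
  using cutoff_props(1)[of 0] r_pos by (simp add: height_Z bdry_Z)

lemma cinv_cc_tc:
  assumes "\<kappa> \<in> atlas M" "z \<in> snd (cc \<kappa>) ` fst (cc \<kappa>)"
  shows "tc (cinv (cc \<kappa>) z) = z \<bullet> bdir" "cinv (cc \<kappa>) z \<in> Z"
proof -
  note a = adm_cc[OF assms(1)]
  have f: "cinv (cc \<kappa>) z \<in> fst (cc \<kappa>)" "snd (cc \<kappa>) (cinv (cc \<kappa>) z) = z"
    using adm_facts(4,5)[OF a assms(2)] by auto
  show "tc (cinv (cc \<kappa>) z) = z \<bullet> bdir" using cc_inner_tang(1)[OF assms(1) f(1)] f(2) by simp
  show "cinv (cc \<kappa>) z \<in> Z" using f(1) fst_cc by blast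
qed

lemma height_smooth: "smooth_from M UNIV height"
proof (rule smooth_fromI)
  fix q :: 'm
  show "\<exists>\<kappa>' W. adm M \<kappa>' \<and> q \<in> fst \<kappa>' \<and> open W \<and> q \<in> W \<and>
      smooth_on (snd \<kappa>' ` (UNIV \<inter> W \<inter> fst \<kappa>')) (height \<circ> cinv \<kappa>')"
  proof (cases "q \<in> Z")
    case True
    then obtain \<kappa> where k: "\<kappa> \<in> atlas M" "q \<in> fst (cc \<kappa>)" using cc_cover by metis
    let ?A = "snd (cc \<kappa>) ` (UNIV \<inter> UNIV \<inter> fst (cc \<kappa>))"
    have "smooth_on ?A (cutoff \<circ> (\<lambda>z. z \<bullet> bdir))"
      by (rule smooth_on_compose[OF smooth_on_linear[OF bounded_linear_inner_left]
            smooth_onI_open[OF open_UNIV Ck_on_cutoff]]) auto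
    then have "smooth_on ?A (height \<circ> cinv (cc \<kappa>))"
      by (rule smooth_on_cong) (use cinv_cc_tc[OF k(1)] height_Z in auto)
    then show ?thesis using adm_cc[OF k(1)] k(2) by (intro exI[of _ "cc \<kappa>"] exI[of _ UNIV]) auto
  next
    case False
    obtain \<mu> where m: "\<mu> \<in> atlas M" "q \<in> fst \<mu>" by (rule atlas_cover)
    note a = atlas_adm[OF m(1)]
    \<comment> \<open>The complement of a closed set, hence a neighbourhood of \<open>q\<close>; on
      it the function is the constant \<open>r\<close>.\<close>
    let ?W = "- {q \<in> Z. tc q \<le> 3 * r / 4}"
    have "open ?W" using closed_collar_part[of "3 * r / 4"] r_pos by (intro open_Compl) simp
    moreover have "smooth_on (snd \<mu> ` (UNIV \<inter> ?W \<inter> fst \<mu>)) (height \<circ> cinv \<mu>)"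
      by (rule smooth_on_cong[OF smooth_on_const[of _ r]])
        (auto simp: adm_facts(3)[OF a] height_def)
    ultimately show ?thesis using a m(2) False by blast
  qed
qed

definition base :: "'m \<Rightarrow> real" where "base q = height q + - r / 4"

lemma base_smooth: "smooth_from M UNIV base"
  unfolding base_def by (rule smooth_from_add[OF height_smooth smooth_from_const])

text \<open>Zeros lie at collar coordinate \<open>r / 4\<close>, in the range where the cutoff is
  the identity. There the function is \<open>t - r / 4\<close>, with derivative 1 along the
  collar.\<close>

lemma base_good: "good base q"
proof (cases "base q = 0")
  case False
  then show ?thesis by (simp add: good_def)
next
  case True
  then have h: "height q = r / 4" by (simp add: base_def)
  then have q: "q \<in> Z" "tc q = r / 4" using height_small[of q] r_pos by auto
  have nb: "q \<notin> bdry M" using bdry_Z(2) q(2) r_pos by auto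
  obtain \<kappa> where k: "\<kappa> \<in> atlas M" "q \<in> fst (cc \<kappa>)" using cc_cover[OF q(1)] by metis
  note a = adm_cc[OF k(1)]
  define S where "S = Z \<inter> tc -` {..<r / 2}"
  have S: "open S" unfolding S_def
    by (rule continuous_open_preimage[OF continuous_tc_yc(1) open_Z]) auto
  have qS: "q \<in> S" using q r_pos by (simp add: S_def)
  let ?A = "snd (cc \<kappa>) ` (S \<inter> fst (cc \<kappa>))"
  have A: "relopen ?A" by (rule chart_relopen[OF adm_chart[OF a] S])
  have x: "snd (cc \<kappa>) q \<in> ?A" using qS k by auto
  have e: "(base \<circ> cinv (cc \<kappa>)) z = z \<bullet> bdir + - r / 4" if z: "z \<in> ?A" for z
  proof -
    obtain p where p: "p \<in> S" "p \<in> fst (cc \<kappa>)" "z = snd (cc \<kappa>) p" using z by blast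
    then show ?thesis
      using cutoff_props(1)[of "tc p"] cc_inner_tang(1)[OF k(1) p(2)] adm_facts(3)[OF a p(2)]
      by (simp add: base_def height_Z S_def)
  qed
  have sm: "smooth_on ?A (\<lambda>z. z \<bullet> bdir + - r / 4)"
    by (rule smooth_on_add[OF smooth_on_linear[OF bounded_linear_inner_left] smooth_on_const])
  have "tderiv M q (tvec M (cc \<kappa>) q bdir) base = dH (base \<circ> cinv (cc \<kappa>)) (snd (cc \<kappa>) q) bdir"
    by (rule tderiv_tvec[OF a open_UNIV UNIV_I k(2) smooth_from_adm[OF base_smooth a]])
  also have "dH (base \<circ> cinv (cc \<kappa>)) (snd (cc \<kappa>) q) = dH (\<lambda>z. z \<bullet> bdir + - r / 4) (snd (cc \<kappa>) q)"
    by (rule dH_cong[OF sm A x e])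
  also have "\<dots> = (\<lambda>v. v \<bullet> bdir)"
    by (rule dH_eq[OF _ relopen_half_space[OF A x]]) (auto intro!: derivative_eq_intros)
  finally show ?thesis using nb by (auto simp: good_def intro!: exI[of _ "tvec M (cc \<kappa>) q bdir"])
qed

text \<open>The margins fit together: the corrected function \<open>f\<close> is at most
  \<open>- r / 8\<close> on \<open>K\<^sub>0\<close> and at most \<open>- r / 4\<close> on the
  boundary, while the final perturbation changes it by at most \<open>r / 16\<close>. Both sets thus
  remain in the sublevel set.\<close>

theorem collar_domain:
  assumes K0: "compact K\<^sub>0"
  shows "\<exists>M\<^sub>1. full_submanifold M M\<^sub>1 \<and> bdry M \<subseteq> M\<^sub>1 \<and> K\<^sub>0 \<subseteq> M\<^sub>1 \<and>
    (\<exists>K \<epsilon>. compact K \<and> 0 < \<epsilon> \<and> \<epsilon> < r \<and>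
      M\<^sub>1 - K = coll ` ({0..\<epsilon>} \<times> (bdry M - K)))"
proof -
  have ch: "continuous_on UNIV height" by (rule smooth_from_continuous[OF height_smooth])
  \<comment> \<open>The rest of \<open>K\<^sub>0\<close> already satisfies
    \<open>base < - r / 8\<close>. The points in \<open>L0\<close> are off the boundary, so interior
    balls cover them.\<close>
  define L0 where "L0 = K\<^sub>0 \<inter> {q. r / 8 \<le> height q}"
  have cL0: "compact L0"
    unfolding L0_def using ch by (intro compact_Int_closed K0 closed_Collect_le continuous_intros)
  have "L0 \<inter> bdry M = {}" using height_bdry r_pos by (auto simp: L0_def)
  from iball_cover[OF cL0 this] obtain I where I: "finite I" "\<And>\<kappa> p R. (\<kappa>, p, R) \<in> I \<Longrightarrow> iball \<kappa> p R"
    and L0: "L0 \<subseteq> half_open I" by metis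
  define L where "L = outer I"
  have cL: "compact L" unfolding L_def by (rule compact_iballs(1)[OF I])
  have \<chi>: "smooth_from M UNIV (bump_sum I)" "\<And>q. 0 \<le> bump_sum I q"
    "\<And>q. q \<notin> L \<Longrightarrow> bump_sum I q = 0"
    "\<And>q. q \<in> half_open I \<Longrightarrow> 1 \<le> bump_sum I q"
    unfolding L_def by (rule bump_sum[OF I]; assumption)+
  \<comment> \<open>Since \<open>base\<close> is at most \<open>3 * r / 4\<close>, the factor
    \<open>r\<close> pushes \<open>f\<close> down to at most \<open>- r / 4\<close> on
    \<open>L0\<close>.\<close>
  define f where "f q = base q + (- r) * bump_sum I q" for q
  have "smooth_from M UNIV (\<lambda>q. (- r) * bump_sum I q)"
    by (rule smooth_from_mult_const[OF \<chi>(1)])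
  then have f: "smooth_from M UNIV f"
    unfolding f_def by (intro smooth_from_add base_smooth)
  have f_out: "f q = base q" if "q \<notin> L" for q using \<chi>(3)[OF that] by (simp add: f_def)
  have f_le: "f q \<le> base q" for q using \<chi>(2)[of q] r_pos by (simp add: f_def)
  have f_K0: "f q \<le> - r / 8" if "q \<in> K\<^sub>0" for q
  proof (cases "q \<in> L0")
    case True
    then have "1 \<le> bump_sum I q" using \<chi>(4) L0 by blast
    then have "r * 1 \<le> r * bump_sum I q" using r_pos by (intro mult_left_mono) auto
    then show ?thesis unfolding f_def base_def using height_le[of q] r_pos by linarith
  next
    case False
    then have "height q < r / 8" using that by (auto simp: L0_def)
    then show ?thesis using f_le[of q] by (simp add: base_def)
  qed
  have f_bdry: "f y \<le> - r / 4" if "y \<in> bdry M" for y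
    using f_le[of y] height_bdry[OF that] by (simp add: base_def)
  have f_good: "good f q" if "q \<notin> L" for q
  proof -
    have "open (- L)" using cL by (simp add: compact_imp_closed open_Compl)
    then have "good f q \<longleftrightarrow> good base q"
      by (rule good_cong[OF base_smooth]) (use that f_out in auto)
    then show ?thesis using base_good by simp
  qed
  \<comment> \<open>All points where \<open>f\<close> can fail to be good lie here: off
    \<open>L\<close> it agrees locally with \<open>base\<close>, and on the rest of \<open>L\<close>
    it is nonzero. The boundary has \<open>f \<le> - r / 4\<close>, so \<open>Y\<close> avoids
    it.\<close>
  define Y where "Y = L \<inter> {q. \<bar>f q\<bar> \<le> r / 8}"
  have cY: "compact Y"
    unfolding Y_def using smooth_from_continuous[OF f]
    by (intro compact_Int_closed cL closed_Collect_le continuous_intros)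
  have "Y \<inter> bdry M = {}" using f_bdry r_pos by (force simp: Y_def)
  from iball_cover[OF cY this] obtain J where J: "finite J" "\<And>\<kappa> p R. (\<kappa>, p, R) \<in> J \<Longrightarrow> iball \<kappa> p R"
    and Y: "Y \<subseteq> half_open J" by metis
  define P where "P = outer J"
  define B where "B = half_open J"
  have cP: "compact P" and oB: "open B"
    unfolding P_def B_def by (rule compact_iballs[OF J]; assumption)+
  have f_good': "good f q" if "q \<notin> Y" for q
  proof (cases "q \<in> L")
    case True
    then have "f q \<noteq> 0" using that r_pos by (auto simp: Y_def)
    then show ?thesis by (simp add: good_def)
  qed (rule f_good)
  \<comment> \<open>The part reached by the perturbing balls but not covered by the open half balls.
    It is good beforehand and must stay so.\<close>
  have cPB: "compact (P - B)" using cP oB by (rule compact_diff)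
  have gPB: "good f q" if "q \<in> P - B" for q
    by (rule f_good') (use that Y[folded B_def] in blast)
  have "0 < r / 16" using r_pos by simp
  from perturb_finite[OF J f cPB gPB this] obtain g where
    "good_perturbation f (r / 16) P (P - B \<union> half_closed J) g"
    unfolding P_def[symmetric] by (rule exE)
  note g = good_perturbationD[OF this]
  have g_good: "good g q" for q
  proof (cases "q \<in> P")
    case True
    have "B \<subseteq> half_closed J"
      unfolding B_def by (rule UN_mono) auto
    then show ?thesis using g(4) True by blast
  next
    case False
    have YP: "Y \<subseteq> P"
    proof
      fix q assume "q \<in> Y"
      then obtain \<kappa> p R where "(\<kappa>, p, R) \<in> J" "q \<in> cinv \<kappa> ` ball p (R / 2)" using Y by blast
      moreover from iball_facts(11)[OF J(2)[OF this(1)]] have "ball p (R / 2) \<subseteq> cball p R"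
        using ball_subset_cball by blast
      ultimately show "q \<in> P" unfolding P_def by blast
    qed
    have "open (- P)" using cP by (simp add: compact_imp_closed open_Compl)
    then have "good g q \<longleftrightarrow> good f q" by (rule good_cong[OF f]) (use False g(3) in auto)
    then show ?thesis using f_good' YP False by blast
  qed
  define M1 where "M1 = {q. g q \<le> 0}"
  define P' where "P' = L \<union> P"
  have cP': "compact P'" unfolding P'_def using cL cP by (rule compact_Un)
  have g_out: "g q = height q - r / 4" if "q \<notin> P'" for q
    using that g(3) f_out by (simp add: P'_def base_def)
  define Zc where "Zc = {q \<in> Z. tc q \<le> r / 4}"
  have Zc: "closed Zc" unfolding Zc_def using r_pos by (intro closed_collar_part) simp
  \<comment> \<open>The foot points of the collar fibres that meet the modified region below level
    \<open>r / 4\<close>. Adding these whole fibres to \<open>K\<close> makes \<open>K\<close>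
    saturated in the lower collar, which \<open>KQ\<close> records.\<close>
  define Q where "Q = yc ` (P' \<inter> Zc)"
  have "P' \<inter> Zc \<subseteq> Z" by (auto simp: Zc_def)
  then have cQ: "compact Q"
    unfolding Q_def
    by (intro compact_continuous_image[OF continuous_on_subset[OF continuous_tc_yc(2)]]
        compact_Int_closed cP' Zc)
  have Qb: "Q \<subseteq> bdry M" using Z_coords(3) by (auto simp: Q_def Zc_def)
  define K where "K = P' \<union> coll ` ({0..r / 4} \<times> Q)"
  have "{0..r / 4} \<times> Q \<subseteq> {0..<r} \<times> bdry M" using Qb r_pos by auto
  then have cK: "compact K"
    unfolding K_def
    by (intro compact_Un cP' compact_continuous_image continuous_on_subset[OF continuous_iota]
        compact_Times compact_Icc cQ)
  have QK: "Q \<subseteq> K"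
  proof
    fix y assume y: "y \<in> Q"
    then have "\<iota> 0 y = y" using Qb iota_0 by auto
    then have "y = coll (0, y)" by simp
    moreover have "(0, y) \<in> {0..r / 4} \<times> Q" using y r_pos by simp
    ultimately show "y \<in> K" unfolding K_def by blast
  qed
  have KQ: "yc q \<in> Q" if q: "q \<in> K" "q \<in> Zc" for q
  proof (cases "q \<in> P'")
    case True
    then show ?thesis using q(2) by (auto simp: Q_def)
  next
    case False
    then obtain t y where ty: "0 \<le> t" "t \<le> r / 4" "y \<in> Q" "q = \<iota> t y" using q(1) by (auto simp: K_def)
    then have "yc q = y" using coords_iota(2)[of t y] Qb r_pos by auto
    then show ?thesis using ty(3) by simp
  qed
  have "M1 - K = coll ` ({0..r / 4} \<times> (bdry M - K))"
  proof (intro equalityI subsetI)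
    fix q assume q: "q \<in> M1 - K"
    then have "q \<notin> P'" by (auto simp: K_def)
    then have "height q \<le> r / 4" using g_out[of q] q by (simp add: M1_def)
    then have qZ: "q \<in> Z" "0 \<le> tc q" "tc q \<le> r / 4"
      using height_small[of q] r_pos Z_coords(1)[of q] by auto
    note c = Z_coords(3,4)[OF qZ(1)]
    \<comment> \<open>Otherwise the foot point lies in \<open>Q\<close>, and its whole fibre up to
      \<open>r / 4\<close>, hence \<open>q\<close>, belongs to \<open>K\<close>.\<close>
    have "yc q \<notin> K"
    proof
      assume "yc q \<in> K"
      moreover have "yc q \<in> Zc" using bdry_Z[OF c(1)] r_pos by (simp add: Zc_def)
      ultimately have "yc q \<in> Q" using KQ[of "yc q"] bdry_Z(3)[OF c(1)] by simp
      then have "(tc q, yc q) \<in> {0..r / 4} \<times> Q" using qZ by simp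
      then have "coll (tc q, yc q) \<in> K" unfolding K_def by blast
      then show False using c(2) q by simp
    qed
    then have "(tc q, yc q) \<in> {0..r / 4} \<times> (bdry M - K)" using qZ c by simp
    then have "coll (tc q, yc q) \<in> coll ` ({0..r / 4} \<times> (bdry M - K))"
      by (rule imageI)
    then show "q \<in> coll ` ({0..r / 4} \<times> (bdry M - K))" using c(2) by simp
  next
    fix q assume "q \<in> coll ` ({0..r / 4} \<times> (bdry M - K))"
    then obtain t y where ty: "0 \<le> t" "t \<le> r / 4" "y \<in> bdry M" "y \<notin> K" "q = \<iota> t y" by auto
    have "t < r" using ty(2) r_pos by linarith
    note c = coords_iota[OF ty(1) this ty(3), folded ty(5)]
    have qZc: "q \<in> Zc" using c ty(2) by (simp add: Zc_def)
    have qK: "q \<notin> K" using KQ[of q] qZc c(2) QK ty(4) by auto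
    then have "q \<notin> P'" by (simp add: K_def)
    then have "g q = t - r / 4"
      using g_out[of q] height_Z[OF c(3)] cutoff_props(1)[of t] c(1) ty(2) r_pos by simp
    then show "q \<in> M1 - K" using qK ty(2) by (simp add: M1_def)
  qed
  moreover have "full_submanifold M M1"
    unfolding M1_def by (rule sublevel_submanifold[OF g(1) g_good])
  moreover have "bdry M \<subseteq> M1"
  proof
    fix y assume "y \<in> bdry M"
    then have "g y \<le> 0" using f_bdry[of y] g(2)[of y] r_pos by linarith
    then show "y \<in> M1" by (simp add: M1_def)
  qed
  moreover have "K\<^sub>0 \<subseteq> M1"
  proof
    fix y assume "y \<in> K\<^sub>0"
    then have "g y \<le> 0" using f_K0[of y] g(2)[of y] r_pos by linarith
    then show "y \<in> M1" by (simp add: M1_def)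
  qed
  moreover have "0 < r / 4" "r / 4 < r" using r_pos by auto
  ultimately show ?thesis using cK by blast
qed

end

theorem lemma6p5:
  fixes M :: "('m::{t2_space,second_countable_topology}, 'v::euclidean_space) riem"
    and E :: "('m, 'v, 'e::ab_group_add) dbundle"
    and \<Phi> :: "'m \<Rightarrow> 'e \<Rightarrow> 'e"
    and r :: real
    and \<iota> :: "real \<Rightarrow> 'm \<Rightarrow> 'm"
  assumes "riemannian_manifold M"
    and "complete_manifold M"
    and "\<not> compact (bdry M)"
    and "isometric_collar M r \<iota>"
    and "dirac_bundle M E"
    and "strongly_callias M E \<Phi>"
    and "callias_product M E \<Phi> r \<iota>"
  shows "\<exists>M\<^sub>1. almost_compact_essential_support M E \<Phi> r \<iota> M\<^sub>1"
proof -
  interpret collar M r \<iota> using assms by unfold_locales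
  \<comment> \<open>The value 1 is an arbitrary positive choice for \<open>R\<close>.\<close>
  obtain K\<^sub>0 where K0: "R_essential_support M E \<Phi> 1 K\<^sub>0"
    using assms(6) unfolding strongly_callias_def by (meson zero_less_one)
  then have "essential_support M E \<Phi> K\<^sub>0" unfolding essential_support_def by (meson zero_less_one)
  moreover have "compact K\<^sub>0" using K0 by (simp add: R_essential_support_def)
  ultimately show ?thesis
    using collar_domain unfolding almost_compact_essential_support_def by meson
qed

end
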